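(* Let $p,q\in[1,\infty]$. Then $$\mathfrak V(\mathscr S'(\mathbf R^d))=\bigcup_{\omega\in\mathscr P(\mathbf R^{2d})}A^{p,q}_{(\omega)}(\mathbf C^d).$$
   Context: Weights: $\mathscr P(\mathbf R^{2d})$ is the set of positive $\omega\in L^\infty_{loc}(\mathbf R^{2d})$ for which there are a constant $C>0$ and a (positive) polynomial $v$ with $\omega(x+y)\le C\omega(x)v(y)$ for all $x,y\in\mathbf R^{2d}$. Bargmann transform: for $z,w\in\mathbf C^d$ let $\langle z,w\rangle=\sum_j z_jw_j$. For $f\in\mathscr S'(\mathbf R^d)$, $(\mathfrak Vf)(z)=\langle f,\mathfrak A_d(z,\cdot)\rangle$, where $\mathfrak A_d(z,y)=\pi^{-d/4}\exp(-\tfrac12(\langle z,z\rangle+|y|^2)+2^{1/2}\langle z,y\rangle)$; it is an entire function on $\mathbf C^d$. $\mathfrak V(\mathscr S'(\mathbf R^d))=\{\mathfrak Vf:f\in\mathscr S'(\mathbf R^d)\}$. Spaces: identify $\mathbf C^d\ni x+i\xi$ with $(x,\xi)\in\mathbf R^{2d}$. $\|F\|_{L^{p,q}}=\big(\int_{\mathbf R^d}\big(\int_{\mathbf R^d}|F(x,\xi)|^p\,dx\big)^{q/p}d\xi\big)^{1/q}$, with the obvious modifications when $p=\infty$ or $q=\infty$. Let $(SF)(x,\xi)=F(2^{-1/2}x,-2^{-1/2}\xi)$. $A^{p,q}_{(\omega)}(\mathbf C^d)$ is the set of entire functions $F$ on $\mathbf C^d$ with $\|S(Fe^{-|\cdot|^2/2})\,\omega\|_{L^{p,q}}<\infty$.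 *)

theory Defs
  imports "HOL-Analysis.Analysis" "HOL-Probability.Essential_Supremum"
begin

section \<open>Tempered distributions on \<open>\<real>\<^sup>d\<close>\<close>

definition partial_deriv :: "'d \<Rightarrow> (real^'d::finite \<Rightarrow> complex) \<Rightarrow> real^'d \<Rightarrow> complex" where
  "partial_deriv j f = (\<lambda>x. frechet_derivative f (at x) (axis j 1))"

text \<open>
  Higher partial derivatives are indexed by lists of coordinates instead of multi-indices;
  for smooth functions the order of the list is immaterial.
\<close>

definition partial_derivs :: "'d list \<Rightarrow> (real^'d::finite \<Rightarrow> complex) \<Rightarrow> real^'d \<Rightarrow> complex" where
  "partial_derivs js f = foldr partial_deriv js f"

text \<open>If all iterated partial derivatives are differentiable, they are all continuous.\<close>

definition smooth :: "(real^'d::finite \<Rightarrow> complex) \<Rightarrow> bool" where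
  "smooth f \<longleftrightarrow> (\<forall>js x. partial_derivs js f differentiable (at x))"

definition monomial :: "('d \<Rightarrow> nat) \<Rightarrow> real^'d::finite \<Rightarrow> real" where
  "monomial \<alpha> x = (\<Prod>j\<in>UNIV. (x $ j) ^ \<alpha> j)"

definition schwartz_space :: "(real^'d::finite \<Rightarrow> complex) set" where
  "schwartz_space = {f. smooth f \<and>
     (\<forall>\<alpha> js. bounded (range (\<lambda>x. monomial \<alpha> x *\<^sub>R partial_derivs js f x)))}"

definition schwartz_seminorm ::
    "('d \<Rightarrow> nat) \<Rightarrow> 'd list \<Rightarrow> (real^'d::finite \<Rightarrow> complex) \<Rightarrow> real" where
  "schwartz_seminorm \<alpha> js f = (SUP x. norm (monomial \<alpha> x *\<^sub>R partial_derivs js f x))"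

text \<open>
  A tempered distribution is a linear form on the Schwartz space that is continuous for the
  topology of the seminorms above, i.e. bounded by a multiple of a finite sum of them.
  A functional is a total function here; its values outside the Schwartz space are irrelevant.
\<close>

definition tempered_distributions :: "((real^'d::finite \<Rightarrow> complex) \<Rightarrow> complex) set" where
  "tempered_distributions = {T.
     (\<forall>\<phi>\<in>schwartz_space. \<forall>\<psi>\<in>schwartz_space. T (\<lambda>x. \<phi> x + \<psi> x) = T \<phi> + T \<psi>) \<and>
     (\<forall>c. \<forall>\<phi>\<in>schwartz_space. T (\<lambda>x. c * \<phi> x) = c * T \<phi>) \<and>
     (\<exists>C N. \<forall>\<phi>\<in>schwartz_space.
        norm (T \<phi>) \<le> C * (\<Sum>\<alpha> | (\<Sum>j\<in>UNIV. \<alpha> j) \<le> N. \<Sum>js | length js \<le> N.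
                             schwartz_seminorm \<alpha> js \<phi>))}"


section \<open>The Bargmann transform\<close>

text \<open>The pairing is bilinear, without complex conjugation.\<close>

definition cdot :: "complex^'d::finite \<Rightarrow> complex^'d \<Rightarrow> complex" where
  "cdot z w = (\<Sum>j\<in>UNIV. z $ j * w $ j)"

definition bargmann_kernel :: "complex^'d::finite \<Rightarrow> real^'d \<Rightarrow> complex" where
  "bargmann_kernel z y =
     of_real (pi powr (- real CARD('d) / 4)) *
     exp (- (1/2) * (cdot z z + of_real ((norm y)\<^sup>2))
          + of_real (sqrt 2) * cdot z (\<chi> j. of_real (y $ j)))"

definition bargmann :: "((real^'d::finite \<Rightarrow> complex) \<Rightarrow> complex) \<Rightarrow> complex^'d \<Rightarrow> complex" where
  "bargmann T = (\<lambda>z. T (bargmann_kernel z))"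

text \<open>Complex differentiability in several variables: the Frechet derivative is complex linear.\<close>

definition entire :: "(complex^'d::finite \<Rightarrow> complex) \<Rightarrow> bool" where
  "entire F \<longleftrightarrow> (\<forall>z. \<exists>D. (F has_derivative D) (at z) \<and> (\<forall>c v. D (c *s v) = c * D v))"


section \<open>Weights on \<open>\<real>\<^sup>2\<^sup>d\<close>\<close>

definition locally_ess_bounded :: "('a::euclidean_space \<Rightarrow> real) \<Rightarrow> bool" where
  "locally_ess_bounded w \<longleftrightarrow> w \<in> borel_measurable lebesgue \<and>
     (\<forall>K. compact K \<longrightarrow> (\<exists>B. AE x in lebesgue. x \<in> K \<longrightarrow> \<bar>w x\<bar> \<le> B))"

definition poly_weights :: "('a::euclidean_space \<Rightarrow> real) set" where
  "poly_weights = {w. (\<forall>x. w x > 0) \<and> locally_ess_bounded w \<and>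
     (\<exists>C v. C > 0 \<and> real_polynomial_function v \<and> (\<forall>y. v y > 0) \<and>
            (\<forall>x y. w (x + y) \<le> C * w x * v y))}"


section \<open>Mixed Lebesgue norms and the spaces \<open>A\<close>\<close>

text \<open>Meant for \<open>a > 0\<close>.\<close>

definition ennreal_rpow :: "ennreal \<Rightarrow> real \<Rightarrow> ennreal" where
  "ennreal_rpow x a = (if x = top then top else ennreal (enn2real x powr a))"

definition Lp_norm :: "ennreal \<Rightarrow> 'a measure \<Rightarrow> ('a \<Rightarrow> ennreal) \<Rightarrow> ennreal" where
  "Lp_norm p M f =
     (if p = top then esssup M f
      else ennreal_rpow (\<integral>\<^sup>+x. ennreal_rpow (f x) (enn2real p) \<partial>M) (1 / enn2real p))"

text \<open>
  The inner norm, of exponent \<open>p\<close>, is in the first variable. For finite exponents, raising the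
  inner norm to the power \<open>q\<close> gives the power \<open>q / p\<close> of the inner integral.
\<close>

definition mixed_norm ::
    "ennreal \<Rightarrow> ennreal \<Rightarrow> ((real^'d::finite) \<times> (real^'d) \<Rightarrow> complex) \<Rightarrow> ennreal" where
  "mixed_norm p q F =
     Lp_norm q lebesgue (\<lambda>\<xi>. Lp_norm p lebesgue (\<lambda>x. ennreal (norm (F (x, \<xi>)))))"

definition to_complex :: "(real^'d::finite) \<times> (real^'d) \<Rightarrow> complex^'d" where
  "to_complex = (\<lambda>(x, \<xi>). \<chi> j. Complex (x $ j) (\<xi> $ j))"

definition dilation_S :: "(complex^'d::finite \<Rightarrow> complex) \<Rightarrow> (real^'d) \<times> (real^'d) \<Rightarrow> complex" where
  "dilation_S F = (\<lambda>(x, \<xi>). F (to_complex ((1 / sqrt 2) *\<^sub>R x, - (1 / sqrt 2) *\<^sub>R \<xi>)))"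

definition A_space ::
    "ennreal \<Rightarrow> ennreal \<Rightarrow> ((real^'d::finite) \<times> (real^'d) \<Rightarrow> real) \<Rightarrow> (complex^'d \<Rightarrow> complex) set" where
  "A_space p q w = {F. entire F \<and>
     mixed_norm p q (\<lambda>X. dilation_S (\<lambda>z. F z * of_real (exp (- (norm z)\<^sup>2 / 2))) X * of_real (w X))
       < \<infinity>}"

end

theory Submission
  imports Defs "HOL-Probability.Probability" "HOL-Complex_Analysis.Complex_Analysis"
begin

text \<open>
  Both sides consist of the entire functions \<open>F\<close> with \<open>\<bar>F z\<bar> \<le> C (1 + \<bar>z\<bar>\<^sup>2)\<^sup>m exp (\<bar>z\<bar>\<^sup>2 / 2)\<close>.
  The kernel satisfies this bound in every Schwartz seminorm, and so do its derivatives in \<open>z\<close>, so that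
  transforms of tempered distributions are entire with this growth; a weight \<open>(1 + \<bar>X\<bar>\<^sup>2)\<^sup>- \<^sup>k\<close> with
  large \<open>k\<close> then makes the mixed norm finite. Conversely, the mean value property over unit balls,
  applied to translates in the Fock space, turns a finite mixed norm into the pointwise bound.
  A function \<open>F\<close> with this bound is the transform of the distribution that maps \<open>\<phi>\<close> to the integral
  of \<open>F z \<Phi> (cnj z)\<close> against the Gaussian measure, where \<open>\<Phi>\<close> is the Bargmann transform of \<open>\<phi>\<close>:
  integration by parts shows that \<open>\<Phi>\<close> decays faster than any polynomial relative to \<open>exp (\<bar>z\<bar>\<^sup>2 / 2)\<close>, and the
  mean value property yields the reproducing formula.
\<close>

section \<open>Weights of polynomial growth and Lebesgue integration\<close>

text \<open>The exponents p and q drop out because the union runs over all weights: a moderate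
  weight is bounded below by a multiple of a negative power of \<open>jap\<close>, and every
  negative power of \<open>jap\<close> is itself a weight, so any polynomial loss is absorbed. The
  obstacle to pointwise bounds is that the norm controls \<bar>F\<bar> exp (- \<bar>z\<bar>^2 / 2),
  where the Gaussian is not the modulus of a holomorphic function. Near w it is, up to bounded
  factors: this is what the holomorphic factor exp (- cdot u (vcnj w)) of \<open>fock_shift\<close>
  provides. The mean value property uses only the circle action z -> cis t * z: Cauchy's formula on
  complex lines together with the rotation invariance of Lebesgue measure. A weight is merely
  Lebesgue measurable, so its slices may fail to be measurable; the estimates from a finite mixed
  norm therefore pass to a continuous minorant. In the inversion F is paired with \<Phi> (cnj z)
  because the transform of the kernel at w is exp (cdot z w), and exp (cdot (cnj z) w) is the
  reproducing kernel of the Fock space.\<close>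

definition jap :: "'a::real_normed_vector \<Rightarrow> real" where
  "jap x = 1 + (norm x)\<^sup>2"

lemma jap_ge1: "1 \<le> jap x" and jap_pos: "0 < jap x" and jap_nz: "jap x \<noteq> 0"
  and jap_nonneg: "0 \<le> jap x"
  by (auto simp: jap_def add_pos_nonneg) (smt (verit) zero_le_power2)

lemma jap_ge_norm: "norm x \<le> jap x"
proof -
  have "0 \<le> (norm x - 1)\<^sup>2 + (norm x)\<^sup>2" by simp
  then show ?thesis by (simp add: jap_def power2_eq_square algebra_simps)
qed

lemma jap_minus [simp]: "jap (- x) = jap x"
  by (simp add: jap_def)

lemma jap_mono: "norm x \<le> norm y \<Longrightarrow> jap x \<le> jap y"
  by (simp add: jap_def power_mono)

text \<open>A form of Peetre's inequality, from (a + b)^2 \<le> 2 a^2 + 2 b^2. It makes powers of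
  \<open>jap\<close> moderate weights and moves decay from one point to a nearby one.\<close>

lemma jap_add: "jap (x + y) \<le> 2 * jap x * jap y"
proof -
  have "(norm (x + y))\<^sup>2 \<le> (norm x + norm y)\<^sup>2"
    by (simp add: norm_triangle_ineq power_mono)
  also have "\<dots> \<le> 2 * (norm x)\<^sup>2 + 2 * (norm y)\<^sup>2"
    using sum_squares_bound[of "norm x" "norm y"] by (simp add: power2_sum)
  finally have "jap (x + y) \<le> 2 * jap x * jap y - 1 - 2 * (norm x)\<^sup>2 * (norm y)\<^sup>2"
    by (simp add: jap_def algebra_simps)
  then show ?thesis by (smt (verit) mult_nonneg_nonneg zero_le_power2)
qed

lemma continuous_on_jap [continuous_intros]:
  "continuous_on S f \<Longrightarrow> continuous_on S (\<lambda>x. jap (f x))"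
  unfolding jap_def by (intro continuous_intros)

lemma borel_measurable_jap [measurable]: "jap \<in> borel_measurable borel"
  by (intro borel_measurable_continuous_onI continuous_intros)

lemma jap_power_mono: "m \<le> n \<Longrightarrow> jap x ^ m \<le> jap x ^ n"
  using jap_ge1[of x] by (simp add: power_increasing)

text \<open>Reduces decay in \<open>jap\<close> to a product of the one-dimensional integrable
  functions 1 / (1 + t^2). The price is the exponent \<open>DIM('a)\<close>, about twice the
  critical one, which does no harm here.\<close>

lemma prod_1_plus_square_le_jap: "(\<Prod>b\<in>Basis. 1 + (x \<bullet> b)\<^sup>2) \<le> jap (x::'a::euclidean_space) ^ DIM('a)"
proof -
  have "(\<Prod>b\<in>Basis. 1 + (x \<bullet> b)\<^sup>2) \<le> (\<Prod>b\<in>(Basis::'a set). jap x)"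
  proof (rule prod_mono)
    fix b :: 'a assume b: "b \<in> Basis"
    have "(x \<bullet> b)\<^sup>2 \<le> (norm x)\<^sup>2"
      using Basis_le_norm[OF b, of x] by (metis power2_abs power_mono abs_ge_zero)
    then show "0 \<le> 1 + (x \<bullet> b)\<^sup>2 \<and> 1 + (x \<bullet> b)\<^sup>2 \<le> jap x"
      by (simp add: jap_def)
  qed
  then show ?thesis by simp
qed

text \<open>\<open>lborel\<close> is the image of a product measure under the coordinate map, so
  both claims are Fubini for finite products. Complex values serve the Gaussians with complex linear
  terms in \<open>bargmann_function_kernel\<close>.\<close>

lemma
  fixes f :: "'a::euclidean_space \<Rightarrow> real \<Rightarrow> complex"
  assumes f: "\<And>b. b \<in> Basis \<Longrightarrow> integrable lborel (f b)"
  shows integrable_prod_Basis: "integrable lborel (\<lambda>x::'a. \<Prod>b\<in>Basis. f b (x \<bullet> b))" (is ?A)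
    and integral_prod_Basis:
      "(\<integral>x. (\<Prod>b\<in>Basis. f b (x \<bullet> b)) \<partial>(lborel :: 'a measure)) = (\<Prod>b\<in>Basis. \<integral>t. f b t \<partial>lborel)" (is ?B)
proof -
  interpret product_sigma_finite "\<lambda>_::'a. lborel :: real measure" ..
  let ?S = "\<lambda>g. \<Sum>b\<in>(Basis::'a set). g b *\<^sub>R b"
  have [measurable]: "f b \<in> borel_measurable borel" if "b \<in> Basis" for b
    using f[OF that] by (auto dest: borel_measurable_integrable)
  have [measurable]: "?S \<in> (\<Pi>\<^sub>M b\<in>Basis. lborel) \<rightarrow>\<^sub>M borel" by measurable
  have m: "(\<lambda>x::'a. \<Prod>b\<in>Basis. f b (x \<bullet> b)) \<in> borel_measurable borel" by measurable
  have eq: "(\<Prod>b\<in>Basis. f b (?S g \<bullet> b)) = (\<Prod>b\<in>Basis. f b (g b))" for g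
    by (intro prod.cong refl) (simp add: inner_sum_left_Basis)
  show ?A
    using f by (subst lborel_eq, subst integrable_distr_eq) (auto simp: eq m intro!: product_integrable_prod)
  show ?B
    using f by (subst lborel_eq, subst integral_distr) (auto simp: eq m intro!: product_integral_prod)
qed

lemma integrable_inverse_jap:
  assumes "DIM('a) \<le> n"
  shows "integrable lborel (\<lambda>x::'a::euclidean_space. inverse (jap x ^ n))"
proof -
  have "integrable lborel (\<lambda>t::real. inverse (1 + t\<^sup>2))"
    using integrable_inverse_1_plus_square unfolding set_integrable_def by simp
  then have 1: "integrable lborel (\<lambda>t::real. complex_of_real (inverse (1 + t\<^sup>2)))"
    by (rule integrable_of_real)
  have "integrable lborel (\<lambda>x::'a. \<Prod>b\<in>Basis. complex_of_real (inverse (1 + (x \<bullet> b)\<^sup>2)))"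
    using integrable_prod_Basis[of "\<lambda>_ t. complex_of_real (inverse (1 + t\<^sup>2))"] 1 by auto
  then show ?thesis
  proof (rule Bochner_Integration.integrable_bound)
    show "AE x::'a in lborel. norm (inverse (jap x ^ n))
       \<le> norm (\<Prod>b\<in>Basis. complex_of_real (inverse (1 + (x \<bullet> b)\<^sup>2)))"
    proof (rule AE_I2)
      fix x :: 'a
      have "0 < (\<Prod>b\<in>Basis. 1 + (x \<bullet> b)\<^sup>2)" by (intro prod_pos) (simp add: add_pos_nonneg)
      moreover have "(\<Prod>b\<in>Basis. 1 + (x \<bullet> b)\<^sup>2) \<le> jap x ^ n"
        using prod_1_plus_square_le_jap[of x] jap_power_mono[OF assms, of x] by linarith
      ultimately have "inverse (jap x ^ n) \<le> inverse (\<Prod>b\<in>Basis. 1 + (x \<bullet> b)\<^sup>2)"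
        by (simp add: le_imp_inverse_le)
      also have "\<dots> = norm (\<Prod>b\<in>Basis. complex_of_real (inverse (1 + (x \<bullet> b)\<^sup>2)))"
        by (simp only: of_real_prod[symmetric] norm_of_real prod_inversef[symmetric] o_def)
          (simp add: prod_nonneg)
      finally show "norm (inverse (jap x ^ n)) \<le> norm (\<Prod>b\<in>Basis. complex_of_real (inverse (1 + (x \<bullet> b)\<^sup>2)))"
        by (simp add: jap_nonneg)
    qed
  qed measurable
qed

lemma integrable_bounded_by_jap:
  fixes f :: "'a::euclidean_space \<Rightarrow> 'b::{banach,second_countable_topology}"
  assumes "f \<in> borel_measurable borel" "DIM('a) \<le> n" "\<And>x. norm (f x) \<le> C * inverse (jap x ^ n)"
  shows "integrable lborel f"
proof (rule Bochner_Integration.integrable_bound)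
  show "integrable lborel (\<lambda>x::'a. C * inverse (jap x ^ n))"
    using integrable_inverse_jap[OF assms(2)] by simp
  show "AE x in lborel. norm (f x) \<le> norm (C * inverse (jap x ^ n))"
    using assms(3) by (smt (verit) AE_I2 real_norm_def)
qed (use assms in simp)

lemma exp_minus_le_inverse_jap: "\<exists>C. \<forall>x::'a::real_normed_vector. exp (- (norm x)\<^sup>2 / c) \<le> C * inverse (jap x ^ n)"
  if "c > 0"
proof -
  \<comment> \<open>\<open>K\<close> dominates both 1 and c * Suc n, hence (1 + t) / K \<le> 1 + t /
    (c * Suc n) \<le> exp (t / (c * Suc n)); the power Suc n of this is the bound. Suc n instead of
    n avoids dividing by 0.\<close>
  define K where "K = 1 + c * Suc n"
  have K: "K \<ge> 1" "K > 0" using that by (auto simp: K_def add_pos_nonneg)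
  have *: "(1 + t) ^ n * exp (- t / c) \<le> K ^ Suc n" if "t \<ge> 0" for t
  proof -
    have "(1 + t) / K \<le> 1 + t / (c * Suc n)"
    proof -
      have "1 / K \<le> 1" using K by simp
      moreover have "t / K \<le> t / (c * Suc n)"
        using \<open>c > 0\<close> \<open>t \<ge> 0\<close> K by (intro divide_left_mono) (auto simp: K_def)
      ultimately show ?thesis by (simp only: add_divide_distrib add_mono)
    qed
    also have "\<dots> \<le> exp (t / (c * Suc n))" by (rule exp_ge_add_one_self)
    finally have "((1 + t) / K) ^ Suc n \<le> exp (t / (c * Suc n)) ^ Suc n"
      using \<open>t \<ge> 0\<close> K by (intro power_mono) auto
    also have "\<dots> = exp (t / c)"
      by (subst exp_of_nat_mult[symmetric]) (simp del: of_nat_Suc)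
    finally have "(1 + t) ^ Suc n \<le> K ^ Suc n * exp (t / c)"
      using K by (simp add: power_divide field_simps del: power_Suc)
    moreover have "(1 + t) ^ n \<le> (1 + t) ^ Suc n"
      using \<open>t \<ge> 0\<close> by (intro power_increasing) auto
    ultimately have "(1 + t) ^ n \<le> K ^ Suc n * exp (t / c)" by linarith
    then show ?thesis by (simp add: exp_minus field_simps del: power_Suc)
  qed
  show ?thesis
  proof (intro exI allI)
    fix x :: 'a
    have "jap x ^ n * exp (- (norm x)\<^sup>2 / c) \<le> K ^ Suc n"
      unfolding jap_def by (rule *) simp
    then show "exp (- (norm x)\<^sup>2 / c) \<le> K ^ Suc n * inverse (jap x ^ n)"
      using jap_pos[of x] by (simp add: field_simps del: power_Suc)
  qed
qed

section \<open>Translations, isometries and integration by parts for Lebesgue measure\<close>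

lemma nn_integral_lborel_affine:
  fixes f :: "'a::euclidean_space \<Rightarrow> ennreal"
  assumes [measurable]: "f \<in> borel_measurable borel" and "\<bar>c\<bar> = 1"
  shows "(\<integral>\<^sup>+x. f (t + c *\<^sub>R x) \<partial>lborel) = (\<integral>\<^sup>+x. f x \<partial>lborel)"
proof -
  have "c \<noteq> 0" using assms by auto
  from lborel_affine[OF this, of t]
  have "(lborel :: 'a measure) = density (distr lborel borel (\<lambda>x. t + c *\<^sub>R x)) (\<lambda>_. 1)"
    using assms by simp
  then have "(lborel :: 'a measure) = distr lborel borel (\<lambda>x. t + c *\<^sub>R x)"
    by (simp add: density_1)
  then have "(\<integral>\<^sup>+x. f x \<partial>lborel) = (\<integral>\<^sup>+x. f x \<partial>distr lborel borel (\<lambda>x. t + c *\<^sub>R x))" by simp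
  also have "\<dots> = (\<integral>\<^sup>+x. f (t + c *\<^sub>R x) \<partial>lborel)"
    by (subst nn_integral_distr) auto
  finally show ?thesis by simp
qed

lemma
  fixes f :: "'a::euclidean_space \<Rightarrow> 'b::{banach,second_countable_topology}"
  assumes [measurable]: "f \<in> borel_measurable borel"
  shows integral_translate: "(\<integral>x. f (t + x) \<partial>lborel) = (\<integral>x. f x \<partial>lborel)"
    and integrable_translate: "integrable lborel (\<lambda>x. f (t + x)) \<longleftrightarrow> integrable lborel f"
proof -
  show "(\<integral>x. f (t + x) \<partial>lborel) = (\<integral>x. f x \<partial>lborel)"
    by (subst (2) lborel_distr_plus[symmetric, of t], subst integral_distr) auto
  show "integrable lborel (\<lambda>x. f (t + x)) \<longleftrightarrow> integrable lborel f"
    by (subst (2) lborel_distr_plus[symmetric, of t], subst integrable_distr_eq) auto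
qed

text \<open>The uniqueness argument for Haar measure: the Lebesgue measure and its image under a linear
  isometry are both translation invariant, and they agree on the radial function \<open>jap\<close>.\<close>

lemma nn_integral_orthogonal_transformation:
  fixes T :: "'a::euclidean_space \<Rightarrow> 'a" and g :: "'a \<Rightarrow> ennreal"
  assumes T: "orthogonal_transformation T" and g[measurable]: "g \<in> borel_measurable borel"
  shows "(\<integral>\<^sup>+x. g (T x) \<partial>lborel) = (\<integral>\<^sup>+x. g x \<partial>lborel)"
proof -
  define f where "f = (\<lambda>x::'a. ennreal (inverse (jap x ^ DIM('a))))"
  have [measurable]: "f \<in> borel_measurable borel" unfolding f_def by measurable
  have linT: "linear T" using T by (rule orthogonal_transformation_linear)
  have [measurable]: "T \<in> borel_measurable borel"
    by (intro borel_measurable_continuous_onI linear_continuous_on linear_linear[THEN iffD2] linT)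
  have fT: "f (T x) = f x" for x
    using T by (simp add: f_def jap_def orthogonal_transformation_norm)
  have c_fin: "(\<integral>\<^sup>+x. f x \<partial>lborel) < \<infinity>"
    unfolding f_def using integrable_inverse_jap[where 'a='a, OF order_refl]
    by (subst nn_integral_eq_integral) (auto simp: jap_nonneg)
  have c_pos: "(\<integral>\<^sup>+x. f x \<partial>lborel) \<noteq> 0"
  proof
    assume "(\<integral>\<^sup>+x. f x \<partial>lborel) = 0"
    then have "AE x in lborel. f x = 0" by (subst (asm) nn_integral_0_iff_AE) auto
    moreover have "f x \<noteq> 0" for x by (simp add: f_def jap_pos ennreal_eq_0_iff not_le)
    ultimately have "AE x in (lborel :: 'a measure). False" by simp
    then show False by (simp add: AE_iff_null null_sets_def emeasure_lborel_UNIV)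
  qed
  have shift: "(\<integral>\<^sup>+y. f (x + T y) * g (T y) \<partial>lborel) = (\<integral>\<^sup>+y. f y * g (T y - x) \<partial>lborel)" for x
  proof -
    obtain w where w: "T w = x" using orthogonal_transformation_surj[OF T] by (metis surjD)
    have "(\<integral>\<^sup>+y. f (x + T y) * g (T y) \<partial>lborel) = (\<integral>\<^sup>+y. f (x + T ((-w) + 1 *\<^sub>R y)) * g (T ((-w) + 1 *\<^sub>R y)) \<partial>lborel)"
      by (rule nn_integral_lborel_affine[symmetric]) auto
    also have "\<dots> = (\<integral>\<^sup>+y. f (T y) * g (T y - x) \<partial>lborel)"
      by (simp add: linear_add[OF linT] linear_neg[OF linT] w linear_diff[OF linT])
    finally show ?thesis by (simp add: fT)
  qed
  \<comment> \<open>The integral of f (x + T y) * g (T y) is evaluated in both orders. Integrating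
    in x first splits off the integral of f; integrating in y first allows the shift by w with T w =
    x, after which the x-integral of g (T y - x) is that of g. The common factor is positive and
    finite, so it cancels.\<close>
  have "(\<integral>\<^sup>+x. f x \<partial>lborel) * (\<integral>\<^sup>+y. g (T y) \<partial>lborel) = (\<integral>\<^sup>+y. (\<integral>\<^sup>+x. f x \<partial>lborel) * g (T y) \<partial>lborel)"
    by (simp add: nn_integral_cmult)
  also have "\<dots> = (\<integral>\<^sup>+y. (\<integral>\<^sup>+x. f (T y + 1 *\<^sub>R x) \<partial>lborel) * g (T y) \<partial>lborel)"
    by (subst nn_integral_lborel_affine) auto
  also have "\<dots> = (\<integral>\<^sup>+y. (\<integral>\<^sup>+x. f (x + T y) * g (T y) \<partial>lborel) \<partial>lborel)"
    by (simp add: nn_integral_multc add.commute)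
  also have "\<dots> = (\<integral>\<^sup>+x. (\<integral>\<^sup>+y. f (x + T y) * g (T y) \<partial>lborel) \<partial>lborel)"
    by (rule lborel_pair.Fubini') measurable
  also have "\<dots> = (\<integral>\<^sup>+x. (\<integral>\<^sup>+y. f y * g (T y - x) \<partial>lborel) \<partial>lborel)"
    by (simp add: shift)
  also have "\<dots> = (\<integral>\<^sup>+y. (\<integral>\<^sup>+x. f y * g (T y - x) \<partial>lborel) \<partial>lborel)"
    by (rule lborel_pair.Fubini') measurable
  also have "\<dots> = (\<integral>\<^sup>+y. f y * (\<integral>\<^sup>+x. g (T y + (-1) *\<^sub>R x) \<partial>lborel) \<partial>lborel)"
    by (simp add: nn_integral_cmult)
  also have "\<dots> = (\<integral>\<^sup>+y. f y * (\<integral>\<^sup>+x. g x \<partial>lborel) \<partial>lborel)"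
    by (subst nn_integral_lborel_affine) auto
  also have "\<dots> = (\<integral>\<^sup>+x. f x \<partial>lborel) * (\<integral>\<^sup>+x. g x \<partial>lborel)"
    by (simp add: nn_integral_multc)
  finally show ?thesis
    using c_fin c_pos by (auto simp: ennreal_mult_cancel_left)
qed

lemma lborel_orthogonal_transformation:
  fixes T :: "'a::euclidean_space \<Rightarrow> 'a"
  assumes T: "orthogonal_transformation T"
  shows "distr lborel borel T = lborel"
proof (rule measure_eqI)
  have [measurable]: "T \<in> borel_measurable borel"
    by (intro borel_measurable_continuous_onI linear_continuous_on linear_linear[THEN iffD2]
        orthogonal_transformation_linear T)
  fix A assume "A \<in> sets (distr lborel borel T)"
  then have [measurable]: "A \<in> sets borel" by simp
  have "emeasure (distr lborel borel T) A = (\<integral>\<^sup>+x. indicator A (T x) \<partial>lborel)"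
    by (subst nn_integral_distr[symmetric, of _ _ borel]) auto
  also have "\<dots> = emeasure lborel A"
    by (subst nn_integral_orthogonal_transformation[OF T]) auto
  finally show "emeasure (distr lborel borel T) A = emeasure lborel A" .
qed simp

text \<open>By translation invariance every difference quotient of \<open>g\<close> has integral 0,
  and the bound on \<open>g'\<close> yields an integrable majorant of the quotients, so the limit
  has integral 0 too. This is integration by parts without slicing along the direction
  \<open>b\<close>.\<close>

lemma integral_directional_derivative_eq_0:
  fixes g g' :: "'a::euclidean_space \<Rightarrow> complex"
  assumes der: "\<And>x. ((\<lambda>t. g (x + t *\<^sub>R b)) has_vector_derivative g' x) (at 0)"
    and int: "integrable lborel g" and n: "DIM('a) \<le> n"
    and g'[measurable]: "g' \<in> borel_measurable borel"
    and bound: "\<And>x. norm (g' x) \<le> C * inverse (jap x ^ n)"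
  shows "(\<integral>x. g' x \<partial>lborel) = 0"
proof -
  have [measurable]: "g \<in> borel_measurable borel" using int by (auto dest: borel_measurable_integrable)
  have der': "((\<lambda>t. g (x + t *\<^sub>R b)) has_vector_derivative g' (x + s *\<^sub>R b)) (at s)" for x s
  proof -
    have "((\<lambda>t. g ((x + s *\<^sub>R b) + t *\<^sub>R b)) \<circ> (\<lambda>t. t - s) has_vector_derivative (1 *\<^sub>R g' (x + s *\<^sub>R b))) (at s)"
      by (rule vector_diff_chain_at) (auto intro!: derivative_eq_intros der)
    then show ?thesis by (simp add: o_def algebra_simps)
  qed
  define h where "h = (\<lambda>n::nat. inverse (real (Suc n)))"
  have h: "0 < h n" "h n \<le> 1" "\<bar>h n\<bar> = h n" for n by (auto simp: h_def field_simps)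
  have C: "0 \<le> C" using bound[of 0] by (simp add: jap_def) (smt (verit) norm_ge_zero)
  define s where "s = (\<lambda>n x. (g (h n *\<^sub>R b + x) - g x) /\<^sub>R h n)"
  have "(\<lambda>k. \<integral>x. s k x \<partial>lborel) \<longlonglongrightarrow> (\<integral>x. g' x \<partial>lborel)"
  proof (rule integral_dominated_convergence)
    show "AE x in lborel. (\<lambda>k. s k x) \<longlonglongrightarrow> g' x"
    proof (rule AE_I2)
      fix x
      have "((\<lambda>t. (g (x + t *\<^sub>R b) - g x) /\<^sub>R t) \<longlongrightarrow> g' x) (at 0)"
      proof (rule LIM_zero_cancel, rule tendsto_norm_zero_cancel)
        have "((\<lambda>t. norm ((1 / norm (t - 0)) *\<^sub>R (g (x + t *\<^sub>R b) - (g (x + 0 *\<^sub>R b) + (t - 0) *\<^sub>R g' x)))) \<longlongrightarrow> 0) (at 0)"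
          using der[of x] unfolding has_vector_derivative_def has_derivative_at2 by (intro tendsto_norm_zero) blast
        then show "((\<lambda>t. norm ((g (x + t *\<^sub>R b) - g x) /\<^sub>R t - g' x)) \<longlongrightarrow> 0) (at 0)"
        proof (rule Lim_transform_eventually)
          have "norm ((1 / norm (t - 0)) *\<^sub>R (g (x + t *\<^sub>R b) - (g (x + 0 *\<^sub>R b) + (t - 0) *\<^sub>R g' x)))
              = norm ((g (x + t *\<^sub>R b) - g x) /\<^sub>R t - g' x)" if "t \<noteq> 0" for t
          proof -
            have "(g (x + t *\<^sub>R b) - g x) /\<^sub>R t - g' x = (1 / t) *\<^sub>R (g (x + t *\<^sub>R b) - (g x + t *\<^sub>R g' x))"
              using that by (simp add: scaleR_diff_right scaleR_add_right divide_inverse)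
            then show ?thesis by simp
          qed
          then show "\<forall>\<^sub>F t in at 0. norm ((1 / norm (t - 0)) *\<^sub>R (g (x + t *\<^sub>R b) - (g (x + 0 *\<^sub>R b) + (t - 0) *\<^sub>R g' x)))
              = norm ((g (x + t *\<^sub>R b) - g x) /\<^sub>R t - g' x)"
            by (auto simp: eventually_at intro!: exI[of _ 1])
        qed
      qed
      moreover have "filterlim h (at 0) sequentially"
        unfolding h_def by real_asymp
      ultimately have "(\<lambda>k. (g (x + h k *\<^sub>R b) - g x) /\<^sub>R h k) \<longlonglongrightarrow> g' x"
        by (rule filterlim_compose)
      then show "(\<lambda>k. s k x) \<longlonglongrightarrow> g' x" by (simp add: s_def add.commute)
    qed
    \<comment> \<open>The factor (2 * jap b)^n is the cost, by \<open>jap_add\<close>, of moving the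
      bound back to x from the point x + t b, 0 < t < 1, that the mean value inequality
      supplies.\<close>
    show "integrable lborel (\<lambda>x::'a. C * (2 * jap b) ^ n * inverse (jap x ^ n))"
      using integrable_inverse_jap[OF n] by simp
    show "AE x in lborel. norm (s k x) \<le> C * (2 * jap b) ^ n * inverse (jap x ^ n)" for k
    proof (rule AE_I2)
      fix x
      have "\<exists>t\<in>{0<..<h k}. norm (g (x + h k *\<^sub>R b) - g (x + 0 *\<^sub>R b)) \<le> norm ((h k - 0) *\<^sub>R g' (x + t *\<^sub>R b))"
        using h[of k] der'[of x]
        by (intro mvt_general) (auto simp: has_vector_derivative_def intro!: continuous_at_imp_continuous_on
            has_vector_derivative_continuous[OF der'])
      then obtain t where t: "0 < t" "t < h k" and le: "norm (g (x + h k *\<^sub>R b) - g x) \<le> h k * norm (g' (x + t *\<^sub>R b))"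
        using h[of k] by auto
      have "jap x = jap ((x + t *\<^sub>R b) + - (t *\<^sub>R b))" by simp
      also have "\<dots> \<le> 2 * jap (x + t *\<^sub>R b) * jap (- (t *\<^sub>R b))" by (rule jap_add)
      also have "\<dots> \<le> 2 * jap (x + t *\<^sub>R b) * jap b"
        using t h[of k] by (intro mult_left_mono) (auto intro!: jap_mono mult_left_le_one_le simp: jap_nonneg)
      finally have "jap x ^ n \<le> (2 * jap (x + t *\<^sub>R b) * jap b) ^ n"
        by (intro power_mono) (auto simp: jap_nonneg)
      then have le2: "inverse (jap (x + t *\<^sub>R b) ^ n) \<le> (2 * jap b) ^ n * inverse (jap x ^ n)"
        using jap_pos[of x] jap_pos[of "x + t *\<^sub>R b"] by (simp add: field_simps power_mult_distrib)
      have "norm (s k x) \<le> norm (g' (x + t *\<^sub>R b))"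
      proof -
        have "norm (s k x) = norm (g (x + h k *\<^sub>R b) - g x) / h k"
          by (simp add: s_def add.commute divide_inverse_commute h)
        then show ?thesis using le h[of k] by (simp add: pos_divide_le_eq mult.commute)
      qed
      also have "\<dots> \<le> C * inverse (jap (x + t *\<^sub>R b) ^ n)" by (rule bound)
      also have "\<dots> \<le> C * ((2 * jap b) ^ n * inverse (jap x ^ n))"
        using C le2 by (intro mult_left_mono)
      finally show "norm (s k x) \<le> C * (2 * jap b) ^ n * inverse (jap x ^ n)" by (simp add: mult.assoc)
    qed
  qed (auto simp: s_def)
  moreover have "(\<integral>x. s k x \<partial>lborel) = 0" for k
    using int unfolding s_def
    by (simp add: Bochner_Integration.integral_diff integrable_translate integral_translate)
  ultimately have "(\<lambda>k::nat. 0) \<longlonglongrightarrow> (\<integral>x. g' x \<partial>lborel)" by simp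
  then show ?thesis using LIMSEQ_unique tendsto_const by metis
qed

section \<open>Rotations and the mean value property\<close>

lemma norm_vec_squared: "(norm (z :: 'a::real_normed_vector ^ 'n::finite))\<^sup>2 = (\<Sum>j\<in>UNIV. (norm (z $ j))\<^sup>2)"
  by (simp add: norm_vec_def L2_set_def sum_nonneg)

lemma norm_vector_smult: "norm (c *s z) = cmod c * norm (z :: complex ^ 'n::finite)"
proof -
  have "(norm (c *s z))\<^sup>2 = (cmod c * norm z)\<^sup>2"
    by (simp add: norm_vec_squared norm_mult power_mult_distrib sum_distrib_left)
  then show ?thesis by (simp add: power2_eq_iff_nonneg)
qed

text \<open>The linear map behind \<open>dilation_S\<close>, kept as a map so that all integrals run
  over pairs of real vectors. It halves squared norms, the source of the factors 2 in comparisons of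
  \<open>jap X\<close> with \<open>jap (tau X)\<close>.\<close>

definition tau :: "(real^'d::finite) \<times> (real^'d) \<Rightarrow> complex^'d" where
  "tau X = to_complex ((1 / sqrt 2) *\<^sub>R fst X, - (1 / sqrt 2) *\<^sub>R snd X)"

lemma tau_nth: "tau X $ j = Complex (fst X $ j / sqrt 2) (- (snd X $ j / sqrt 2))"
  by (simp add: tau_def to_complex_def)

lemma dilation_S_eq: "dilation_S F X = F (tau X)"
  by (simp add: dilation_S_def tau_def split: prod.splits)

lemma linear_tau: "linear tau"
  by (rule linearI) (auto simp: vec_eq_iff tau_nth complex_eq_iff add_divide_distrib)

lemma continuous_on_tau [continuous_intros]:
  "continuous_on S f \<Longrightarrow> continuous_on S (\<lambda>x. tau (f x))"
  by (rule bounded_linear.continuous_on[OF linear_linear[THEN iffD2, OF linear_tau]])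

lemma tau_add: "tau (X + Y) = tau X + tau Y" and tau_zero [simp]: "tau 0 = 0"
  by (rule linear_add[OF linear_tau], rule linear_0[OF linear_tau])

lemma norm_tau_squared: "(norm (tau X))\<^sup>2 = (norm X)\<^sup>2 / 2"
  by (cases X) (simp add: norm_vec_squared norm_Pair tau_nth cmod_def power_divide sum_nonneg
      sum.distrib add_divide_distrib sum_divide_distrib)

lemma norm_tau: "norm (tau X) = norm X / sqrt 2"
proof -
  have "(norm (tau X))\<^sup>2 = (norm X / sqrt 2)\<^sup>2" by (simp add: norm_tau_squared power_divide)
  then show ?thesis by (simp add: power2_eq_iff_nonneg)
qed

lemma surj_tau: "surj tau"
proof (rule surjI)
  fix z :: "complex^'d"
  show "tau ((\<chi> j. sqrt 2 * Re (z $ j)), (\<chi> j. - (sqrt 2 * Im (z $ j)))) = z"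
    by (simp add: vec_eq_iff tau_nth)
qed

text \<open>Multiplication by a unit complex number, transported through \<open>tau\<close>; the
  minus sign in \<open>tau\<close> makes it a clockwise turn of the pair.\<close>

definition rot :: "real \<Rightarrow> (real^'d::finite) \<times> (real^'d) \<Rightarrow> (real^'d) \<times> (real^'d)" where
  "rot t X = (cos t *\<^sub>R fst X + sin t *\<^sub>R snd X, cos t *\<^sub>R snd X - sin t *\<^sub>R fst X)"

lemma tau_rot: "tau (rot t X) = cis t *s tau X"
  by (simp add: vec_eq_iff tau_nth rot_def complex_eq_iff add_divide_distrib diff_divide_distrib)

lemma norm_rot [simp]: "norm (rot t X) = norm X"
proof -
  have "norm (tau (rot t X)) = norm (tau X)"
    by (simp add: tau_rot norm_vector_smult)
  then show ?thesis by (simp add: norm_tau)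
qed

lemma orthogonal_transformation_rot: "orthogonal_transformation (rot t)"
  unfolding orthogonal_transformation
proof
  show "linear (rot t)"
    by (rule linearI) (auto simp: rot_def algebra_simps)
qed simp

lemma continuous_on_rot [continuous_intros]:
  fixes f :: "'a::t2_space \<Rightarrow> real"
  shows "continuous_on S f \<Longrightarrow> continuous_on S g \<Longrightarrow> continuous_on S (\<lambda>x. rot (f x) (g x))"
  unfolding rot_def by (auto intro!: continuous_intros)

text \<open>Cauchy's formula at the centre of the unit circle, parametrized by {0..1}. The indicator
  form over \<open>lborel\<close> is the one that Fubini needs in
  \<open>rotation_mean_value\<close>.\<close>

lemma circle_mean_value:
  assumes "f holomorphic_on UNIV"
  shows "(\<integral>t. indicator {0..1} t *\<^sub>R f (cis (2 * pi * t)) \<partial>lborel) = f 0"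
proof -
  have "((\<lambda>u. f u / (u - 0)) has_contour_integral (2 * of_real pi * \<i> * f 0)) (circlepath 0 1)"
    by (rule Cauchy_integral_circlepath_simple) (auto intro: holomorphic_on_subset[OF assms])
  then have "((\<lambda>t. f (circlepath 0 1 t) / (circlepath 0 1 t - 0) * vector_derivative (circlepath 0 1) (at t within {0..1}))
      has_integral (2 * of_real pi * \<i> * f 0)) {0..1}"
    by (simp add: has_contour_integral_def)
  then have "((\<lambda>t. 2 * pi * \<i> * f (cis (2 * pi * t))) has_integral (2 * of_real pi * \<i> * f 0)) {0..1}"
  proof (rule has_integral_eq[rotated])
    fix t :: real assume "t \<in> {0..1}"
    then show "f (circlepath 0 1 t) / (circlepath 0 1 t - 0) * vector_derivative (circlepath 0 1) (at t within {0..1})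
       = 2 * pi * \<i> * f (cis (2 * pi * t))"
      by (subst vector_derivative_circlepath01) (auto simp: circlepath cis_conv_exp algebra_simps)
  qed
  from has_integral_mult_right[OF this, of "1 / (2 * pi * \<i>)"]
  have *: "((\<lambda>t. f (cis (2 * pi * t))) has_integral f 0) {0..1}" by (simp add: mult.assoc)
  have "continuous_on {0..1} (\<lambda>t. f (cis (2 * pi * t)))"
    by (rule continuous_on_compose2[OF holomorphic_on_imp_continuous_on[OF assms]])
      (auto intro!: continuous_intros)
  then have "set_integrable lborel {0..1} (\<lambda>t. f (cis (2 * pi * t)))"
    by (rule borel_integrable_atLeastAtMost')
  from set_borel_integral_eq_integral(2)[OF this] * show ?thesis
    by (simp add: set_lebesgue_integral_def integral_unique)
qed

text \<open>Averaging the integrand over the circle action \<open>rot\<close> replaces \<open>G\<close> by its value at the origin.\<close>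

lemma rotation_mean_value:
  fixes G :: "complex^'d::finite \<Rightarrow> complex" and w :: "(real^'d) \<times> (real^'d) \<Rightarrow> real"
  assumes contG: "continuous_on UNIV G" and holG: "\<And>v. (\<lambda>\<zeta>. G (\<zeta> *s v)) holomorphic_on UNIV"
    and w: "\<And>t X. w (rot t X) = w X" and intw: "integrable lborel w"
    and int: "integrable lborel (\<lambda>X. G (tau X) * w X)"
  shows "(\<integral>X. G (tau X) * w X \<partial>lborel) = G 0 * (\<integral>X. w X \<partial>lborel)"
proof -
  define k where "k = (\<lambda>X. G (tau X) * w X)"
  have [measurable]: "k \<in> borel_measurable borel" 
    using int by (auto simp: k_def dest: borel_measurable_integrable)
  define \<rho> where "\<rho> = (\<lambda>t. rot (2 * pi * t) :: (real^'d) \<times> (real^'d) \<Rightarrow> _)"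
  have [measurable]: "(\<lambda>p. \<rho> (fst p) (snd p)) \<in> borel_measurable (borel \<Otimes>\<^sub>M borel)"
    unfolding \<rho>_def borel_prod by (intro borel_measurable_continuous_onI continuous_intros)
  have \<rho>m[measurable]: "\<rho> t \<in> borel_measurable borel" for t
    unfolding \<rho>_def by (intro borel_measurable_continuous_onI continuous_intros)
  have distr: "distr lborel borel (\<rho> t) = lborel" for t
    unfolding \<rho>_def by (rule lborel_orthogonal_transformation[OF orthogonal_transformation_rot])
  have int_rot: "(\<integral>X. k' (\<rho> t X) \<partial>lborel) = (\<integral>X. k' X \<partial>lborel)"
    if [measurable]: "k' \<in> borel_measurable borel" for t and k' :: "_ \<Rightarrow> 'b::{banach,second_countable_topology}"
    by (subst (2) distr[of t, symmetric], subst integral_distr) auto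
  have intk: "integrable lborel (\<lambda>X. k (\<rho> t X))" for t
    using int by (subst (asm) distr[of t, symmetric], subst (asm) integrable_distr_eq) (auto simp: k_def)
  let ?h = "\<lambda>t X. indicator {0..1} t *\<^sub>R k (\<rho> t X)"
  \<comment> \<open>For each t the rotated function has the same L1 norm, so joint integrability
    reduces to that of the indicator of the unit interval.\<close>
  have fub: "integrable (lborel \<Otimes>\<^sub>M lborel) (\<lambda>(t, X). ?h t X)"
  proof (rule lborel_pair.Fubini_integrable)
    show "(\<lambda>(t, X). ?h t X) \<in> borel_measurable (lborel \<Otimes>\<^sub>M lborel)"
      by (simp add: case_prod_beta)
    have "(\<integral>X. norm (?h t X) \<partial>lborel) = indicator {0..1} t *\<^sub>R (\<integral>X. norm (k X) \<partial>lborel)" for t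
      using int_rot[of "\<lambda>X. norm (k X)" t] by simp
    then show "integrable lborel (\<lambda>t. \<integral>X. norm (case (t, X) of (t, X) \<Rightarrow> ?h t X) \<partial>lborel)"
      by (simp del: norm_scaleR)
    show "AE t in lborel. integrable lborel (\<lambda>X. case (t, X) of (t, X) \<Rightarrow> ?h t X)"
      using intk by simp
  qed
  have "(\<integral>X. k X \<partial>lborel) = (\<integral>t. (\<integral>X. ?h t X \<partial>lborel) \<partial>lborel)"
    using int_rot[of k] by simp
  also have "\<dots> = (\<integral>X. (\<integral>t. ?h t X \<partial>lborel) \<partial>lborel)"
    by (rule lborel_pair.Fubini_integral[OF fub, symmetric])
  also have "\<dots> = (\<integral>X. G 0 * w X \<partial>lborel)"
  proof (rule Bochner_Integration.integral_cong[OF refl])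
    fix X
    have "(\<integral>t. ?h t X \<partial>lborel) = (\<integral>t. (indicator {0..1} t *\<^sub>R G (cis (2 * pi * t) *s tau X)) * w X \<partial>lborel)"
      by (simp add: k_def \<rho>_def tau_rot w)
    also have "\<dots> = (\<integral>t. indicator {0..1} t *\<^sub>R G (cis (2 * pi * t) *s tau X) \<partial>lborel) * w X"
      by (rule integral_mult_left_zero)
    also have "\<dots> = G 0 * w X"
      by (subst circle_mean_value[OF holG[of "tau X"]]) simp
    finally show "(\<integral>t. ?h t X \<partial>lborel) = G 0 * w X" .
  qed
  also have "\<dots> = G 0 * (\<integral>X. w X \<partial>lborel)"
    using intw by simp
  finally show ?thesis by (simp add: k_def)
qed

lemma entire_continuous_on: "entire F \<Longrightarrow> continuous_on S F"
  unfolding entire_def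
  by (meson continuous_at_imp_continuous_on has_derivative_continuous)

lemma has_derivative_vector_smult_right:
  "((\<lambda>\<zeta>. \<zeta> *s v + w) has_derivative (\<lambda>c. c *s (v :: complex^'n::finite))) F"
proof -
  have "linear (\<lambda>c. c *s v)"
    by (rule linearI) (auto simp: vec_eq_iff algebra_simps)
  then have "bounded_linear (\<lambda>c. c *s v)" by (rule linear_linear[THEN iffD2])
  then show ?thesis
    by (auto intro!: derivative_eq_intros bounded_linear_imp_has_derivative)
qed

text \<open>A complex linear derivative, restricted to a line, is multiplication by
  \<open>D v\<close>. The circle averages use no more of holomorphy than this; the offset
  \<open>w\<close> is there for \<open>fock_shift\<close>.\<close>

lemma entire_holomorphic_on_line:
  assumes "entire F"
  shows "(\<lambda>\<zeta>. F (\<zeta> *s v + w)) holomorphic_on S"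
proof -
  have "\<exists>d. ((\<lambda>\<zeta>. F (\<zeta> *s v + w)) has_field_derivative d) (at \<zeta>)" for \<zeta>
  proof -
    obtain D where D: "(F has_derivative D) (at (\<zeta> *s v + w))" "\<And>c v. D (c *s v) = c * D v"
      using assms unfolding entire_def by metis
    have "((\<lambda>\<zeta>. F (\<zeta> *s v + w)) has_derivative (\<lambda>c. D (c *s v))) (at \<zeta>)"
      using has_derivative_compose[OF has_derivative_vector_smult_right D(1)] .
    then have "((\<lambda>\<zeta>. F (\<zeta> *s v + w)) has_field_derivative D v) (at \<zeta>)"
      by (simp add: has_field_derivative_def D(2) mult.commute[of _ "D v"])
    then show ?thesis ..
  qed
  then show ?thesis
    by (metis field_differentiable_at_within field_differentiable_def holomorphic_onI)
qed

section \<open>The Schwartz space\<close>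

lemma partial_derivs_Nil [simp]: "partial_derivs [] f = f"
  and partial_derivs_Cons [simp]: "partial_derivs (j # js) f = partial_deriv j (partial_derivs js f)"
  by (simp_all add: partial_derivs_def)

lemma partial_deriv_eq: "(f has_derivative D) (at x) \<Longrightarrow> partial_deriv j f x = D (axis j 1)"
  by (metis frechet_derivative_at partial_deriv_def)

text \<open>To compute all derivatives of a function it suffices to exhibit a family of functions,
  indexed by lists of coordinates, that is closed under partial derivatives.\<close>

lemma
  assumes "\<And>js x. (g js has_derivative D js x) (at x)" "\<And>j js x. D js x (axis j 1) = g (j # js) x"
  shows partial_derivs_family: "partial_derivs js (g []) = g js" and smooth_family: "smooth (g [])"
proof -
  show *: "partial_derivs js (g []) = g js" for js
  proof (induction js)
    case (Cons j js)
    have "partial_deriv j (g js) = g (j # js)"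
      using assms by (auto simp: fun_eq_iff partial_deriv_eq[OF assms(1)])
    then show ?case by (simp add: Cons.IH)
  qed simp
  show "smooth (g [])"
    unfolding smooth_def * using assms(1) by (auto simp: differentiable_def)
qed

lemma smooth_has_derivative:
  "smooth f \<Longrightarrow> (partial_derivs js f has_derivative frechet_derivative (partial_derivs js f) (at x)) (at x)"
  by (simp add: smooth_def frechet_derivative_works)

lemma smooth_continuous_on: "smooth f \<Longrightarrow> continuous_on S (partial_derivs js f)"
  by (meson continuous_at_imp_continuous_on differentiable_imp_continuous_within smooth_def)

lemma schwartz_smooth: "\<phi> \<in> schwartz_space \<Longrightarrow> smooth \<phi>"
  by (simp add: schwartz_space_def)

lemma schwartz_seminorm_upper:
  "\<phi> \<in> schwartz_space \<Longrightarrow> norm (monomial \<alpha> x *\<^sub>R partial_derivs js \<phi> x) \<le> schwartz_seminorm \<alpha> js \<phi>"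
  unfolding schwartz_seminorm_def
  by (intro cSUP_upper bounded_imp_bdd_above)
    (auto simp: schwartz_space_def bounded_iff)

lemma schwartz_seminorm_least:
  "(\<And>x. norm (monomial \<alpha> x *\<^sub>R partial_derivs js \<phi> x) \<le> B) \<Longrightarrow> schwartz_seminorm \<alpha> js \<phi> \<le> B"
  unfolding schwartz_seminorm_def by (rule cSUP_least) auto

lemma schwartz_seminorm_nonneg: "\<phi> \<in> schwartz_space \<Longrightarrow> 0 \<le> schwartz_seminorm \<alpha> js \<phi>"
  using schwartz_seminorm_upper[of \<phi> \<alpha> undefined js] norm_ge_zero order_trans by blast

lemma schwartz_spaceI:
  assumes "smooth \<phi>" "\<And>\<alpha> js. \<exists>B. \<forall>x. norm (monomial \<alpha> x *\<^sub>R partial_derivs js \<phi> x) \<le> B"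
  shows "\<phi> \<in> schwartz_space"
  using assms unfolding schwartz_space_def bounded_iff by auto

lemma schwartz_add:
  assumes "\<phi> \<in> schwartz_space" "\<psi> \<in> schwartz_space"
  shows "(\<lambda>x. \<phi> x + \<psi> x) \<in> schwartz_space"
    and "partial_derivs js (\<lambda>x. \<phi> x + \<psi> x) = (\<lambda>x. partial_derivs js \<phi> x + partial_derivs js \<psi> x)"
proof -
  let ?g = "\<lambda>js x. partial_derivs js \<phi> x + partial_derivs js \<psi> x"
  note d = smooth_has_derivative[OF schwartz_smooth[OF assms(1)]] smooth_has_derivative[OF schwartz_smooth[OF assms(2)]]
  have 1: "(?g js has_derivative (\<lambda>h. frechet_derivative (partial_derivs js \<phi>) (at x) h +
      frechet_derivative (partial_derivs js \<psi>) (at x) h)) (at x)" for js x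
    by (intro has_derivative_add d)
  have 2: "smooth (\<lambda>x. \<phi> x + \<psi> x)"
    using smooth_family[of ?g, OF 1] by (simp add: partial_deriv_def)
  show 3: "partial_derivs js (\<lambda>x. \<phi> x + \<psi> x) = ?g js" for js
    using partial_derivs_family[of ?g, OF 1] by (simp add: partial_deriv_def)
  show "(\<lambda>x. \<phi> x + \<psi> x) \<in> schwartz_space"
  proof (rule schwartz_spaceI[OF 2], intro exI allI)
    fix \<alpha> js x
    show "norm (monomial \<alpha> x *\<^sub>R partial_derivs js (\<lambda>x. \<phi> x + \<psi> x) x)
      \<le> schwartz_seminorm \<alpha> js \<phi> + schwartz_seminorm \<alpha> js \<psi>"
      unfolding 3 scaleR_add_right by (intro norm_triangle_mono schwartz_seminorm_upper assms)
  qed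
qed

lemma schwartz_cmult:
  assumes "\<phi> \<in> schwartz_space"
  shows "(\<lambda>x. c * \<phi> x) \<in> schwartz_space"
    and "partial_derivs js (\<lambda>x. c * \<phi> x) = (\<lambda>x. c * partial_derivs js \<phi> x)"
proof -
  let ?g = "\<lambda>js x. c * partial_derivs js \<phi> x"
  note d = smooth_has_derivative[OF schwartz_smooth[OF assms(1)]]
  have 1: "(?g js has_derivative (\<lambda>h. c * frechet_derivative (partial_derivs js \<phi>) (at x) h)) (at x)" for js x
    by (intro has_derivative_mult_right d)
  have 2: "smooth (\<lambda>x. c * \<phi> x)"
    using smooth_family[of ?g, OF 1] by (simp add: partial_deriv_def)
  show 3: "partial_derivs js (\<lambda>x. c * \<phi> x) = ?g js" for js
    using partial_derivs_family[of ?g, OF 1] by (simp add: partial_deriv_def)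
  show "(\<lambda>x. c * \<phi> x) \<in> schwartz_space"
  proof (rule schwartz_spaceI[OF 2], intro exI allI)
    fix \<alpha> js x
    have "norm (monomial \<alpha> x *\<^sub>R partial_derivs js (\<lambda>x. c * \<phi> x) x)
      = norm c * norm (monomial \<alpha> x *\<^sub>R partial_derivs js \<phi> x)"
      unfolding 3 by (simp add: norm_mult)
    then show "norm (monomial \<alpha> x *\<^sub>R partial_derivs js (\<lambda>x. c * \<phi> x) x)
      \<le> norm c * schwartz_seminorm \<alpha> js \<phi>"
      using mult_left_mono[OF schwartz_seminorm_upper[OF assms, of \<alpha> x js] norm_ge_zero[of c]] by presburger
  qed
qed

section \<open>Continuity estimates on the Schwartz space\<close>

definition schwartz_norm :: "nat \<Rightarrow> (real^'d::finite \<Rightarrow> complex) \<Rightarrow> real" where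
  "schwartz_norm N \<phi> = (\<Sum>\<alpha> | (\<Sum>j\<in>UNIV. \<alpha> j) \<le> N. \<Sum>js | length js \<le> N. schwartz_seminorm \<alpha> js \<phi>)"

lemma finite_multi_indices [simp]: "finite {\<alpha>::'d::finite \<Rightarrow> nat. (\<Sum>j\<in>UNIV. \<alpha> j) \<le> N}"
proof (rule finite_subset)
  show "{\<alpha>::'d \<Rightarrow> nat. (\<Sum>j\<in>UNIV. \<alpha> j) \<le> N} \<subseteq> (\<Pi>\<^sub>E j\<in>UNIV. {..N})"
  proof
    fix \<alpha> :: "'d \<Rightarrow> nat" assume \<alpha>: "\<alpha> \<in> {\<alpha>. (\<Sum>j\<in>UNIV. \<alpha> j) \<le> N}"
    have "\<alpha> j \<le> (\<Sum>j\<in>UNIV. \<alpha> j)" for j by (rule member_le_sum) auto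
    then have "\<alpha> j \<le> N" for j using \<alpha> le_trans by blast
    then show "\<alpha> \<in> (\<Pi>\<^sub>E j\<in>UNIV. {..N})" by (auto simp: PiE_def extensional_def)
  qed
qed (auto intro: finite_PiE)

lemma finite_coordinate_lists [simp]: "finite {js::'d::finite list. length js \<le> N}"
  using finite_lists_length_le[of "UNIV :: 'd set" N] by simp

lemma schwartz_norm_nonneg: "\<phi> \<in> schwartz_space \<Longrightarrow> 0 \<le> schwartz_norm N \<phi>"
  unfolding schwartz_norm_def by (intro sum_nonneg schwartz_seminorm_nonneg)

lemma schwartz_seminorm_le_norm:
  assumes "\<phi> \<in> schwartz_space" "(\<Sum>j\<in>UNIV. \<alpha> j) \<le> N" "length js \<le> N"
  shows "schwartz_seminorm \<alpha> js \<phi> \<le> schwartz_norm N \<phi>"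
proof -
  have "schwartz_seminorm \<alpha> js \<phi> \<le> (\<Sum>js | length js \<le> N. schwartz_seminorm \<alpha> js \<phi>)"
    by (rule member_le_sum) (use assms in \<open>auto intro: schwartz_seminorm_nonneg\<close>)
  also have "\<dots> \<le> schwartz_norm N \<phi>"
    unfolding schwartz_norm_def
    by (rule member_le_sum[of \<alpha> _ "\<lambda>\<alpha>. \<Sum>js | length js \<le> N. schwartz_seminorm \<alpha> js \<phi>"])
      (use assms in \<open>auto intro!: sum_nonneg schwartz_seminorm_nonneg\<close>)
  finally show ?thesis .
qed

lemma schwartz_norm_mono:
  assumes "\<phi> \<in> schwartz_space" "M \<le> N"
  shows "schwartz_norm M \<phi> \<le> schwartz_norm N \<phi>"
proof -
  have "schwartz_norm M \<phi> \<le> (\<Sum>\<alpha> | (\<Sum>j\<in>UNIV. \<alpha> j) \<le> M. \<Sum>js | length js \<le> N. schwartz_seminorm \<alpha> js \<phi>)"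
    unfolding schwartz_norm_def
    by (intro sum_mono sum_mono2) (use assms in \<open>auto intro: schwartz_seminorm_nonneg\<close>)
  also have "\<dots> \<le> schwartz_norm N \<phi>"
    unfolding schwartz_norm_def
    by (intro sum_mono2) (use assms in \<open>auto intro!: sum_nonneg schwartz_seminorm_nonneg\<close>)
  finally show ?thesis .
qed

text \<open>\<open>q\<close> is an arbitrary functional, not necessarily a seminorm, so the notion
  covers both \<phi> -> norm (T \<phi>) and bounds assembled from raising operators. Its closure
  rules replace the bookkeeping of C and N.\<close>

definition schwartz_bounded :: "((real^'d::finite \<Rightarrow> complex) \<Rightarrow> real) \<Rightarrow> bool" where
  "schwartz_bounded q \<longleftrightarrow> (\<exists>C N. 0 \<le> C \<and> (\<forall>\<phi>\<in>schwartz_space. q \<phi> \<le> C * schwartz_norm N \<phi>))"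

lemma schwartz_bounded_mono:
  "schwartz_bounded q \<Longrightarrow> (\<And>\<phi>. \<phi> \<in> schwartz_space \<Longrightarrow> r \<phi> \<le> q \<phi>) \<Longrightarrow> schwartz_bounded r"
  unfolding schwartz_bounded_def by (meson order_trans)

lemma schwartz_bounded_seminorm: "schwartz_bounded (schwartz_seminorm \<alpha> js)"
  unfolding schwartz_bounded_def
  by (rule exI[of _ 1], rule exI[of _ "max (\<Sum>j\<in>UNIV. \<alpha> j) (length js)"])
    (auto intro: schwartz_seminorm_le_norm)

lemma schwartz_bounded_zero: "schwartz_bounded (\<lambda>_. 0)"
  unfolding schwartz_bounded_def by (rule exI[of _ 0]) auto

lemma schwartz_bounded_add:
  assumes "schwartz_bounded q" "schwartz_bounded r"
  shows "schwartz_bounded (\<lambda>\<phi>. q \<phi> + r \<phi>)"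
proof -
  obtain C N where 1: "0 \<le> C" "\<And>\<phi>. \<phi> \<in> schwartz_space \<Longrightarrow> q \<phi> \<le> C * schwartz_norm N \<phi>"
    using assms unfolding schwartz_bounded_def by meson
  obtain D M where 2: "0 \<le> D" "\<And>\<phi>. \<phi> \<in> schwartz_space \<Longrightarrow> r \<phi> \<le> D * schwartz_norm M \<phi>"
    using assms unfolding schwartz_bounded_def by meson
  have "q \<phi> + r \<phi> \<le> (C + D) * schwartz_norm (max M N) \<phi>" if "\<phi> \<in> schwartz_space" for \<phi>
  proof -
    have "q \<phi> \<le> C * schwartz_norm (max M N) \<phi>"
      using 1(2)[OF that] schwartz_norm_mono[OF that, of N "max M N"] 1(1) by (meson max.cobounded2 mult_left_mono order_trans)
    moreover have "r \<phi> \<le> D * schwartz_norm (max M N) \<phi>"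
      using 2(2)[OF that] schwartz_norm_mono[OF that, of M "max M N"] 2(1) by (meson max.cobounded1 mult_left_mono order_trans)
    ultimately show ?thesis by (simp add: algebra_simps)
  qed
  then show ?thesis using 1(1) 2(1) unfolding schwartz_bounded_def by (meson add_nonneg_nonneg)
qed

lemma schwartz_bounded_cmult:
  assumes "schwartz_bounded q" "0 \<le> c"
  shows "schwartz_bounded (\<lambda>\<phi>. c * q \<phi>)"
proof -
  obtain C N where 1: "0 \<le> C" "\<And>\<phi>. \<phi> \<in> schwartz_space \<Longrightarrow> q \<phi> \<le> C * schwartz_norm N \<phi>"
    using assms unfolding schwartz_bounded_def by meson
  then have "c * q \<phi> \<le> (c * C) * schwartz_norm N \<phi>" if "\<phi> \<in> schwartz_space" for \<phi>
    using that assms(2) by (simp add: mult_left_mono mult.assoc)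
  then show ?thesis using 1(1) assms(2) unfolding schwartz_bounded_def by (meson mult_nonneg_nonneg)
qed

lemma schwartz_bounded_sum:
  "finite A \<Longrightarrow> (\<And>a. a \<in> A \<Longrightarrow> schwartz_bounded (q a)) \<Longrightarrow> schwartz_bounded (\<lambda>\<phi>. \<Sum>a\<in>A. q a \<phi>)"
  by (induction rule: finite_induct) (auto intro: schwartz_bounded_zero schwartz_bounded_add)

lemma schwartz_bounded_sum_list:
  "schwartz_bounded (\<lambda>\<phi>. \<Sum>l\<leftarrow>ls. schwartz_seminorm \<alpha> l \<phi>)"
  by (induction ls) (auto intro: schwartz_bounded_zero schwartz_bounded_add schwartz_bounded_seminorm)

text \<open>Up to a factor, the creation operator of the harmonic oscillator. The Bargmann transform
  turns it into multiplication by sqrt 2 * z $ j (\<open>bargmann_function_raising\<close>), so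
  smoothness and decay of \<phi> become decay of its transform.\<close>

definition raising :: "'d \<Rightarrow> (real^'d::finite \<Rightarrow> complex) \<Rightarrow> real^'d \<Rightarrow> complex" where
  "raising j \<phi> x = of_real (x $ j) * \<phi> x - partial_deriv j \<phi> x"

text \<open>The lists obtained from \<open>js\<close> by deleting one occurrence of \<open>j\<close>: they index the terms
  of the commutator of \<open>partial_derivs js\<close> with the multiplication by the coordinate \<open>j\<close>.\<close>

fun deletions :: "'d \<Rightarrow> 'd list \<Rightarrow> 'd list list" where
  "deletions j [] = []"
| "deletions j (k # js) = (if k = j then [js] else []) @ map ((#) k) (deletions j js)"

lemma has_derivative_sum_list:
  "(\<And>l. l \<in> set ls \<Longrightarrow> (f l has_derivative f' l) F) \<Longrightarrow>
    ((\<lambda>x. \<Sum>l\<leftarrow>ls. f l x) has_derivative (\<lambda>h. \<Sum>l\<leftarrow>ls. f' l h)) F"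
  by (induction ls) (auto intro: has_derivative_add)

lemma monomial_fun_upd: "monomial (\<alpha>(j := Suc (\<alpha> j))) x = x $ j * monomial \<alpha> x"
proof -
  have "(\<Prod>i\<in>UNIV - {j}. (x $ i) ^ (\<alpha>(j := Suc (\<alpha> j))) i) = (\<Prod>i\<in>UNIV - {j}. (x $ i) ^ \<alpha> i)"
    by (intro prod.cong) auto
  then show ?thesis
    unfolding monomial_def by (simp add: prod.remove[of UNIV j])
qed

lemma norm_sum_list_le: "norm (\<Sum>l\<leftarrow>ls. f l) \<le> (\<Sum>l\<leftarrow>ls. norm (f l :: 'a::real_normed_vector))"
  by (induction ls) (auto intro: norm_triangle_mono)

lemma schwartz_raising:
  fixes \<phi> :: "real^'d::finite \<Rightarrow> complex"
  assumes "\<phi> \<in> schwartz_space"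
  shows "raising j \<phi> \<in> schwartz_space"
    and "schwartz_seminorm \<alpha> js (raising j \<phi>) \<le> schwartz_seminorm (\<alpha>(j := Suc (\<alpha> j))) js \<phi> +
       (\<Sum>l\<leftarrow>deletions j js. schwartz_seminorm \<alpha> l \<phi>) + schwartz_seminorm \<alpha> (js @ [j]) \<phi>" 
proof -
  let ?d = "\<lambda>js x. frechet_derivative (partial_derivs js \<phi>) (at x)"
  \<comment> \<open>Leibniz' rule for multiplication by x $ j. In \<open>js @ [j]\<close> the index
    j is innermost because \<open>raising\<close> differentiates in direction j before the
    directions of \<open>js\<close>; derivatives are never reordered.\<close>
  let ?g = "\<lambda>js (x :: real^'d). of_real (x $ j) * partial_derivs js \<phi> x + (\<Sum>l\<leftarrow>deletions j js. partial_derivs l \<phi> x)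
     - partial_derivs (js @ [j]) \<phi> x"
  let ?D = "\<lambda>js x (h :: real^'d). (of_real (x $ j) * ?d js x h + of_real (h $ j) * partial_derivs js \<phi> x) +
     (\<Sum>l\<leftarrow>deletions j js. ?d l x h) - ?d (js @ [j]) x h"
  note d = smooth_has_derivative[OF schwartz_smooth[OF assms]]
  have coord: "((\<lambda>x. complex_of_real (x $ j)) has_derivative (\<lambda>h. of_real ((h :: real^'d) $ j))) (at x)" for x :: "real^'d"
    by (rule bounded_linear_imp_has_derivative)
      (intro bounded_linear_compose[OF bounded_linear_of_real] bounded_linear_vec_nth)
  have 1: "(?g js has_derivative ?D js x) (at x)" for js x
    by (intro has_derivative_diff has_derivative_add has_derivative_sum_list has_derivative_mult d coord)
  have 2: "?D js x (axis k 1) = ?g (k # js) x" for k js x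
    by (simp add: partial_deriv_def axis_def map_map o_def algebra_simps)
  have eq: "?g [] = raising j \<phi>" by (simp add: raising_def fun_eq_iff)
  have 3: "smooth (raising j \<phi>)"
    using smooth_family[of ?g, OF 1 2] unfolding eq .
  have 4: "partial_derivs js (raising j \<phi>) = ?g js" for js
    using partial_derivs_family[of ?g, OF 1 2] unfolding eq .
  let ?B = "\<lambda>\<alpha> js. schwartz_seminorm (\<alpha>(j := Suc (\<alpha> j))) js \<phi> +
       (\<Sum>l\<leftarrow>deletions j js. schwartz_seminorm \<alpha> l \<phi>) + schwartz_seminorm \<alpha> (js @ [j]) \<phi>"
  have 5: "norm (monomial \<alpha> x *\<^sub>R partial_derivs js (raising j \<phi>) x) \<le> ?B \<alpha> js" for \<alpha> js x
  proof -
    have "monomial \<alpha> x *\<^sub>R partial_derivs js (raising j \<phi>) x =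
      monomial (\<alpha>(j := Suc (\<alpha> j))) x *\<^sub>R partial_derivs js \<phi> x +
      (\<Sum>l\<leftarrow>deletions j js. monomial \<alpha> x *\<^sub>R partial_derivs l \<phi> x)
      - monomial \<alpha> x *\<^sub>R partial_derivs (js @ [j]) \<phi> x"
      unfolding 4 monomial_fun_upd
      by (simp add: scaleR_conv_of_real algebra_simps sum_list_mult_const)
    also have "norm \<dots> \<le> norm (monomial (\<alpha>(j := Suc (\<alpha> j))) x *\<^sub>R partial_derivs js \<phi> x) +
      (\<Sum>l\<leftarrow>deletions j js. norm (monomial \<alpha> x *\<^sub>R partial_derivs l \<phi> x))
      + norm (monomial \<alpha> x *\<^sub>R partial_derivs (js @ [j]) \<phi> x)"
      by (intro norm_triangle_le_diff add_mono norm_triangle_mono order_refl norm_sum_list_le)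
    also have "\<dots> \<le> ?B \<alpha> js"
      by (intro add_mono sum_list_mono schwartz_seminorm_upper assms)
    finally show ?thesis .
  qed
  show "raising j \<phi> \<in> schwartz_space" using 3 5 by (blast intro: schwartz_spaceI)
  show "schwartz_seminorm \<alpha> js (raising j \<phi>) \<le> ?B \<alpha> js" using 5 by (rule schwartz_seminorm_least)
qed

text \<open>Continuity of \<open>raising j\<close> on the Schwartz space: each seminorm of the image
  is at most a finite sum of seminorms of \<phi>, and \<open>schwartz_norm N\<close> consists of
  finitely many.\<close>

lemma schwartz_bounded_raising:
  assumes "schwartz_bounded q"
  shows "schwartz_bounded (\<lambda>\<phi>. q (raising j \<phi>))"
proof -
  obtain C N where 1: "0 \<le> C" "\<And>\<phi>. \<phi> \<in> schwartz_space \<Longrightarrow> q \<phi> \<le> C * schwartz_norm N \<phi>"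
    using assms unfolding schwartz_bounded_def by meson
  have 2: "schwartz_bounded (\<lambda>\<phi>. schwartz_seminorm \<alpha> js (raising j \<phi>))" for \<alpha> js
    by (rule schwartz_bounded_mono[OF _ schwartz_raising(2)])
      (intro schwartz_bounded_add schwartz_bounded_seminorm schwartz_bounded_sum_list)
  have "schwartz_bounded (\<lambda>\<phi>. C * schwartz_norm N (raising j \<phi>))"
    unfolding schwartz_norm_def
    by (intro schwartz_bounded_cmult schwartz_bounded_sum 1 2) auto
  then show ?thesis
    by (rule schwartz_bounded_mono) (use 1(2) schwartz_raising(1) in blast)
qed

lemma schwartz_raising_power: "\<phi> \<in> schwartz_space \<Longrightarrow> (raising j ^^ m) \<phi> \<in> schwartz_space"
  by (induction m) (auto intro: schwartz_raising)

lemma schwartz_bounded_raising_power: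
  "schwartz_bounded q \<Longrightarrow> schwartz_bounded (\<lambda>\<phi>. q ((raising j ^^ m) \<phi>))"
proof (induction m arbitrary: q)
  case (Suc m)
  then show ?case using Suc.IH[OF schwartz_bounded_raising[OF Suc.prems]] by simp
qed simp

text \<open>The definition allows any real C; as \<open>schwartz_norm\<close> is nonnegative on
  Schwartz functions, C may be replaced by its absolute value.\<close>

lemma tempered_distributions_iff:
  "T \<in> tempered_distributions \<longleftrightarrow>
     (\<forall>\<phi>\<in>schwartz_space. \<forall>\<psi>\<in>schwartz_space. T (\<lambda>x. \<phi> x + \<psi> x) = T \<phi> + T \<psi>) \<and>
     (\<forall>c. \<forall>\<phi>\<in>schwartz_space. T (\<lambda>x. c * \<phi> x) = c * T \<phi>) \<and>
     schwartz_bounded (\<lambda>\<phi>. norm (T \<phi>))" (is "?L \<longleftrightarrow> ?A \<and> ?M \<and> ?B")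
proof -
  have "(\<exists>C N. \<forall>\<phi>\<in>schwartz_space. norm (T \<phi>) \<le> C * schwartz_norm N \<phi>) \<longleftrightarrow> ?B"
  proof
    assume "\<exists>C N. \<forall>\<phi>\<in>schwartz_space. norm (T \<phi>) \<le> C * schwartz_norm N \<phi>"
    then obtain C N where CN: "\<And>\<phi>. \<phi>\<in>schwartz_space \<Longrightarrow> norm (T \<phi>) \<le> C * schwartz_norm N \<phi>" by blast
    have "norm (T \<phi>) \<le> \<bar>C\<bar> * schwartz_norm N \<phi>" if "\<phi>\<in>schwartz_space" for \<phi>
      using CN[OF that] schwartz_norm_nonneg[OF that, of N] by (smt (verit) mult_right_mono)
    then show ?B unfolding schwartz_bounded_def by (meson abs_ge_zero)
  qed (auto simp: schwartz_bounded_def)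
  then show ?thesis
    unfolding tempered_distributions_def schwartz_norm_def by blast
qed

section \<open>Derivatives of the Bargmann kernel\<close>

text \<open>Polynomials in the components of \<open>z\<close> and \<open>y\<close>, as syntax: the derivatives of the Bargmann
  kernel are products of such polynomials with the kernel.\<close>

datatype 'd kpoly = KConst complex | KZ 'd | KY 'd | KAdd "'d kpoly" "'d kpoly" | KMul "'d kpoly" "'d kpoly"

primrec keval :: "'d kpoly \<Rightarrow> complex^'d::finite \<Rightarrow> real^'d \<Rightarrow> complex" where
  "keval (KConst c) z y = c"
| "keval (KZ j) z y = z $ j"
| "keval (KY j) z y = of_real (y $ j)"
| "keval (KAdd P Q) z y = keval P z y + keval Q z y"
| "keval (KMul P Q) z y = keval P z y * keval Q z y"

primrec kdiff_y :: "'d \<Rightarrow> 'd kpoly \<Rightarrow> 'd kpoly" where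
  "kdiff_y j (KConst c) = KConst 0"
| "kdiff_y j (KZ i) = KConst 0"
| "kdiff_y j (KY i) = KConst (if i = j then 1 else 0)"
| "kdiff_y j (KAdd P Q) = KAdd (kdiff_y j P) (kdiff_y j Q)"
| "kdiff_y j (KMul P Q) = KAdd (KMul (kdiff_y j P) Q) (KMul P (kdiff_y j Q))"

primrec kdiff_z :: "'d \<Rightarrow> 'd kpoly \<Rightarrow> 'd kpoly" where
  "kdiff_z j (KConst c) = KConst 0"
| "kdiff_z j (KZ i) = KConst (if i = j then 1 else 0)"
| "kdiff_z j (KY i) = KConst 0"
| "kdiff_z j (KAdd P Q) = KAdd (kdiff_z j P) (kdiff_z j Q)"
| "kdiff_z j (KMul P Q) = KAdd (KMul (kdiff_z j P) Q) (KMul P (kdiff_z j Q))"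

text \<open>Differentiation conjugated by the kernel: the derivative of P times the kernel is the
  kernel times the derivative of P plus P times the logarithmic derivative sqrt 2 * z $ j - y $ j.
  In \<open>twisted_z\<close> the latter is sqrt 2 * y $ j - z $ j.\<close>

definition twisted_y :: "'d \<Rightarrow> 'd kpoly \<Rightarrow> 'd kpoly" where
  "twisted_y j P = KAdd (kdiff_y j P)
     (KMul (KAdd (KMul (KConst (of_real (sqrt 2))) (KZ j)) (KMul (KConst (-1)) (KY j))) P)"

definition twisted_z :: "'d \<Rightarrow> 'd kpoly \<Rightarrow> 'd kpoly" where
  "twisted_z j P = KAdd (kdiff_z j P)
     (KMul (KAdd (KMul (KConst (of_real (sqrt 2))) (KY j)) (KMul (KConst (-1)) (KZ j))) P)"

definition kfun :: "'d kpoly \<Rightarrow> complex^'d::finite \<Rightarrow> real^'d \<Rightarrow> complex" where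
  "kfun P z y = keval P z y * bargmann_kernel z y"

lemma kfun_1: "kfun (KConst 1) = bargmann_kernel"
  by (simp add: kfun_def fun_eq_iff)

text \<open>Splits the exponent by coordinates, so that derivatives and moduli are computed one
  coordinate at a time and a product of two kernels can be integrated by Fubini.\<close>

lemma bargmann_kernel_eq:
  "bargmann_kernel (z :: complex^'d::finite) y = of_real (pi powr (- real CARD('d) / 4)) *
     exp (\<Sum>j\<in>UNIV. - (1/2) * ((z $ j)\<^sup>2 + (of_real (y $ j))\<^sup>2) + of_real (sqrt 2) * z $ j * of_real (y $ j))"
proof -
  have "complex_of_real ((norm y)\<^sup>2) = (\<Sum>j\<in>UNIV. (of_real (y $ j))\<^sup>2)"
    by (simp add: norm_vec_squared)
  then show ?thesis
    unfolding bargmann_kernel_def cdot_def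
    by (simp add: power2_eq_square sum.distrib sum_distrib_left sum_subtractf mult.assoc distrib_left
        sum_negf sum_divide_distrib)
qed

text \<open>The cross derivatives of the two logarithmic factors agree: both are sqrt 2 if j = k and
  0 otherwise. Equality holds after \<open>keval\<close> only, as the syntax trees differ.\<close>

lemma twisted_commute: "keval (twisted_y j (twisted_z k P)) z y = keval (twisted_z k (twisted_y j P)) z y"
proof -
  have "keval (kdiff_y j (kdiff_z k P)) z y = keval (kdiff_z k (kdiff_y j P)) z y"
    by (induction P) (auto simp: algebra_simps)
  then show ?thesis
    by (auto simp: twisted_y_def twisted_z_def algebra_simps)
qed

lemma keval_has_derivative_y:
  "(keval P z has_derivative (\<lambda>h. \<Sum>j\<in>UNIV. of_real (h $ j) * keval (kdiff_y j P) z y)) (at y)"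
proof (induction P)
  case (KConst c)
  have "keval (KConst c) z = (\<lambda>_. c)" by (simp add: fun_eq_iff)
  then show ?case by simp
next
  case (KZ i)
  have "keval (KZ i) z = (\<lambda>_. z $ i)" by (simp add: fun_eq_iff)
  then show ?case by simp
next
  case (KY i)
  have "keval (KY i) z = (\<lambda>y. of_real (y $ i))" by (simp add: fun_eq_iff)
  moreover have "((\<lambda>y. complex_of_real (y $ i)) has_derivative (\<lambda>h. of_real ((h :: real^'a) $ i))) (at y)"
    by (rule bounded_linear_imp_has_derivative)
      (intro bounded_linear_compose[OF bounded_linear_of_real] bounded_linear_vec_nth)
  ultimately show ?case by (simp add: if_distrib[of "\<lambda>x. _ * x"] cong: if_cong)
next
  case (KAdd P Q)
  have "keval (KAdd P Q) z = (\<lambda>y. keval P z y + keval Q z y)" by (simp add: fun_eq_iff)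
  moreover note has_derivative_add[OF KAdd.IH]
  ultimately show ?case by (simp add: sum.distrib distrib_left)
next
  case (KMul P Q)
  have "keval (KMul P Q) z = (\<lambda>y. keval P z y * keval Q z y)" by (simp add: fun_eq_iff)
  moreover note has_derivative_mult[OF KMul.IH]
  ultimately show ?case
    by (simp add: sum.distrib distrib_left sum_distrib_left sum_distrib_right mult_ac add.commute)
qed

lemma keval_has_derivative_z:
  "((\<lambda>z. keval P z y) has_derivative (\<lambda>h. \<Sum>j\<in>UNIV. h $ j * keval (kdiff_z j P) z y)) (at z)"
proof (induction P)
  case (KZ i)
  have "((\<lambda>z. z $ i) has_derivative (\<lambda>h. (h :: complex^'a) $ i)) (at z)"
    by (rule bounded_linear_imp_has_derivative) (rule bounded_linear_vec_nth)
  then show ?case by (simp add: if_distrib[of "\<lambda>x. _ * x"] cong: if_cong)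
next
  case (KAdd P Q)
  note has_derivative_add[OF KAdd.IH]
  then show ?case by (simp add: sum.distrib distrib_left)
next
  case (KMul P Q)
  note has_derivative_mult[OF KMul.IH]
  then show ?case
    by (simp add: sum.distrib distrib_left sum_distrib_left sum_distrib_right mult_ac add.commute)
qed simp_all

lemma kernel_has_derivative_y:
  "(bargmann_kernel z has_derivative
     (\<lambda>h. \<Sum>j\<in>UNIV. of_real (h $ j) * ((of_real (sqrt 2) * z $ j - of_real (y $ j)) * bargmann_kernel z y))) (at y)"
proof -
  let ?c = "complex_of_real (pi powr (- real CARD('a) / 4))"
  let ?f = "\<lambda>j (y :: real^'a). - (1/2) * ((z $ j)\<^sup>2 + (of_real (y $ j))\<^sup>2) + of_real (sqrt 2) * z $ j * of_real (y $ j)"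
  have coord: "((\<lambda>y. complex_of_real (y $ i)) has_derivative (\<lambda>h. of_real ((h :: real^'a) $ i))) (at y)" for i
    by (rule bounded_linear_imp_has_derivative)
      (intro bounded_linear_compose[OF bounded_linear_of_real] bounded_linear_vec_nth)
  have f: "(?f j has_derivative (\<lambda>h. of_real (h $ j) * (of_real (sqrt 2) * z $ j - of_real (y $ j)))) (at y)" for j
    by (rule derivative_eq_intros coord refl | simp add: algebra_simps)+
  have s: "((\<lambda>y. \<Sum>j\<in>UNIV. ?f j y) has_derivative
      (\<lambda>h. \<Sum>j\<in>UNIV. of_real (h $ j) * (of_real (sqrt 2) * z $ j - of_real (y $ j)))) (at y)"
    by (intro has_derivative_sum f)
  have "((\<lambda>y. ?c * exp (\<Sum>j\<in>UNIV. ?f j y)) has_derivative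
      (\<lambda>h. ?c * (exp (\<Sum>j\<in>UNIV. ?f j y) * (\<Sum>j\<in>UNIV. of_real (h $ j) * (of_real (sqrt 2) * z $ j - of_real (y $ j)))))) (at y)"
    by (intro has_derivative_mult_right has_derivative_compose[OF s DERIV_exp[unfolded has_field_derivative_def]])
  then show ?thesis
    unfolding bargmann_kernel_eq[abs_def] by (simp add: sum_distrib_left sum_distrib_right mult_ac)
qed

lemma kernel_has_derivative_z:
  "((\<lambda>z. bargmann_kernel z y) has_derivative
     (\<lambda>h. \<Sum>j\<in>UNIV. h $ j * ((of_real (sqrt 2) * of_real (y $ j) - z $ j) * bargmann_kernel z y))) (at z)"
proof -
  let ?c = "complex_of_real (pi powr (- real CARD('a) / 4))"
  let ?f = "\<lambda>j (z :: complex^'a). - (1/2) * ((z $ j)\<^sup>2 + (of_real (y $ j))\<^sup>2) + of_real (sqrt 2) * z $ j * of_real (y $ j)"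
  have coord: "((\<lambda>z. z $ i) has_derivative (\<lambda>h. (h :: complex^'a) $ i)) (at z)" for i
    by (rule bounded_linear_imp_has_derivative) (rule bounded_linear_vec_nth)
  have f: "(?f j has_derivative (\<lambda>h. h $ j * (of_real (sqrt 2) * of_real (y $ j) - z $ j))) (at z)" for j
    by (rule derivative_eq_intros coord refl | simp add: algebra_simps)+
  have s: "((\<lambda>z. \<Sum>j\<in>UNIV. ?f j z) has_derivative
      (\<lambda>h. \<Sum>j\<in>UNIV. h $ j * (of_real (sqrt 2) * of_real (y $ j) - z $ j))) (at z)"
    by (intro has_derivative_sum f)
  have "((\<lambda>z. ?c * exp (\<Sum>j\<in>UNIV. ?f j z)) has_derivative
      (\<lambda>h. ?c * (exp (\<Sum>j\<in>UNIV. ?f j z) * (\<Sum>j\<in>UNIV. h $ j * (of_real (sqrt 2) * of_real (y $ j) - z $ j))))) (at z)"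
    by (intro has_derivative_mult_right has_derivative_compose[OF s DERIV_exp[unfolded has_field_derivative_def]])
  then show ?thesis
    unfolding bargmann_kernel_eq[abs_def] by (simp add: sum_distrib_left sum_distrib_right mult_ac)
qed

lemma kfun_has_derivative_y:
  "(kfun P z has_derivative (\<lambda>h. \<Sum>j\<in>UNIV. of_real (h $ j) * kfun (twisted_y j P) z y)) (at y)"
proof -
  have "kfun P z = (\<lambda>y. keval P z y * bargmann_kernel z y)" by (simp add: kfun_def fun_eq_iff)
  moreover note has_derivative_mult[OF keval_has_derivative_y[of P z y] kernel_has_derivative_y[of z y]]
  ultimately show ?thesis
    by (simp add: kfun_def twisted_y_def sum.distrib[symmetric] sum_distrib_left sum_distrib_right algebra_simps)
qed

lemma kfun_has_derivative_z:
  "((\<lambda>z. kfun P z y) has_derivative (\<lambda>h. \<Sum>j\<in>UNIV. h $ j * kfun (twisted_z j P) z y)) (at z)"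
proof -
  note has_derivative_mult[OF keval_has_derivative_z[of P y z] kernel_has_derivative_z[of y z]]
  then show ?thesis
    by (simp add: kfun_def twisted_z_def sum.distrib[symmetric] sum_distrib_left sum_distrib_right algebra_simps)
qed

lemma continuous_on_kfun: "continuous_on UNIV (\<lambda>p. kfun P (fst p) (snd p))"
proof -
  have "continuous_on UNIV (\<lambda>p. keval P (fst p) (snd p))"
    by (induction P) (auto intro!: continuous_intros)
  then show ?thesis
    unfolding kfun_def bargmann_kernel_def cdot_def by (intro continuous_intros) auto
qed

lemma
  shows partial_derivs_kfun: "partial_derivs js (kfun P z) = kfun (foldr twisted_y js P) z"
    and smooth_kfun: "smooth (kfun P z)"
proof -
  let ?g = "\<lambda>js. kfun (foldr twisted_y js P) z"
  let ?D = "\<lambda>js y h. \<Sum>j\<in>UNIV. of_real (h $ j) * kfun (twisted_y j (foldr twisted_y js P)) z y"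
  have 1: "(?g js has_derivative ?D js y) (at y)" for js y
    by (rule kfun_has_derivative_y)
  have 2: "?D js y (axis k 1) = ?g (k # js) y" for k js y
    by (simp add: axis_def if_distrib[of "\<lambda>x. x * _"] if_distrib[of of_real] cong: if_cong)
  show "partial_derivs js (kfun P z) = ?g js" "smooth (kfun P z)"
    using partial_derivs_family[of ?g, OF 1 2] smooth_family[of ?g, OF 1 2] by simp_all
qed

text \<open>The induction hypothesis equates functions, whereas \<open>twisted_y\<close> acts on
  syntax trees; the induction step therefore passes through the actual partial derivative.\<close>

lemma kfun_foldr_twisted_commute:
  "kfun (foldr twisted_y js (twisted_z k P)) z = kfun (twisted_z k (foldr twisted_y js P)) z"
proof (induction js)
  case (Cons j js)
  have "kfun (foldr twisted_y (j # js) (twisted_z k P)) z = partial_deriv j (kfun (foldr twisted_y js (twisted_z k P)) z)"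
    using partial_derivs_kfun[of "[j]"] by simp
  also have "\<dots> = kfun (twisted_y j (twisted_z k (foldr twisted_y js P))) z"
    unfolding Cons.IH using partial_derivs_kfun[of "[j]"] by simp
  also have "\<dots> = kfun (twisted_z k (foldr twisted_y (j # js) P)) z"
    by (simp add: kfun_def fun_eq_iff twisted_commute)
  finally show ?case .
qed simp

text \<open>Completing the square: a Gaussian in y centred at sqrt 2 * Re z remains, and the factor
  exp (\<bar>z\<bar>^2 / 2) in front is the origin of the growth rate in all later bounds.\<close>

lemma norm_bargmann_kernel:
  "norm (bargmann_kernel (z :: complex^'d::finite) y) = pi powr (- real CARD('d) / 4) *
     (exp ((norm z)\<^sup>2 / 2) * exp (- (norm (y - sqrt 2 *\<^sub>R (\<chi> j. Re (z $ j))))\<^sup>2 / 2))"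
proof -
  have sq: "sqrt 2 * (sqrt 2 * a) = 2 * a" for a by (simp flip: mult.assoc)
  have "Re (- (1/2) * ((z $ j)\<^sup>2 + (of_real (y $ j))\<^sup>2) + of_real (sqrt 2) * z $ j * of_real (y $ j))
     = (cmod (z $ j))\<^sup>2 / 2 - (y $ j - sqrt 2 * Re (z $ j))\<^sup>2 / 2" for j
    unfolding cmod_power2 by (simp add: power2_eq_square field_simps sq)
  then have "Re (\<Sum>j\<in>UNIV. - (1/2) * ((z $ j)\<^sup>2 + (of_real (y $ j))\<^sup>2) + of_real (sqrt 2) * z $ j * of_real (y $ j))
     = (norm z)\<^sup>2 / 2 - (norm (y - sqrt 2 *\<^sub>R (\<chi> j. Re (z $ j))))\<^sup>2 / 2"
    by (simp only: Re_sum norm_vec_squared) (simp add: sum_subtractf sum_divide_distrib)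
  then show ?thesis
    unfolding bargmann_kernel_eq
    by (simp only: norm_mult norm_exp_eq_Re norm_of_real exp_add[symmetric]) simp
qed

section \<open>Estimates for the kernel, uniform in y\<close>

lemma keval_bound: "\<exists>C m. 0 \<le> C \<and> (\<forall>z y. norm (keval P z y) \<le> C * jap z ^ m * jap y ^ m)"
proof (induction P)
  case (KConst c)
  then show ?case by (intro exI[of _ "norm c"] exI[of _ 0]) simp
next
  case (KZ j)
  have "norm (z $ j) \<le> 1 * jap z ^ 1 * jap y ^ 1" for z :: "complex^'a" and y :: "real^'a"
  proof -
    have "norm (z $ j) \<le> norm z" by (rule Finite_Cartesian_Product.norm_nth_le)
    also have "\<dots> \<le> jap z * 1" by (simp add: jap_ge_norm)
    also have "\<dots> \<le> jap z * jap y" by (intro mult_left_mono jap_ge1 jap_nonneg)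
    finally show ?thesis by simp
  qed
  then show ?case using zero_le_one by (metis keval.simps(2))
next
  case (KY j)
  have "norm (complex_of_real (y $ j)) \<le> 1 * jap z ^ 1 * jap y ^ 1" for z :: "complex^'a" and y :: "real^'a"
  proof -
    have "norm (y $ j) \<le> norm y" by (rule Finite_Cartesian_Product.norm_nth_le)
    also have "\<dots> \<le> 1 * jap y" by (simp add: jap_ge_norm)
    also have "\<dots> \<le> jap z * jap y" by (intro mult_right_mono jap_ge1 jap_nonneg)
    finally show ?thesis by simp
  qed
  then show ?case using zero_le_one by (metis keval.simps(3))
next
  case (KAdd P Q)
  then obtain C m D n where 1: "0 \<le> C" "\<And>z y. norm (keval P z y) \<le> C * jap z ^ m * jap y ^ m"
    and 2: "0 \<le> D" "\<And>z y. norm (keval Q z y) \<le> D * jap z ^ n * jap y ^ n" by metis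
  have "norm (keval (KAdd P Q) z y) \<le> (C + D) * jap z ^ (m + n) * jap y ^ (m + n)" for z y
  proof -
    have "norm (keval P z y) \<le> C * jap z ^ (m + n) * jap y ^ (m + n)"
      by (rule order_trans[OF 1(2)], intro mult_mono jap_power_mono) (auto simp: 1 jap_nonneg)
    moreover have "norm (keval Q z y) \<le> D * jap z ^ (m + n) * jap y ^ (m + n)"
      by (rule order_trans[OF 2(2)], intro mult_mono jap_power_mono) (auto simp: 2 jap_nonneg)
    ultimately show ?thesis
      using norm_triangle_ineq[of "keval P z y" "keval Q z y"] by (simp add: algebra_simps)
  qed
  then show ?case using 1(1) 2(1) by (meson add_nonneg_nonneg)
next
  case (KMul P Q)
  then obtain C m D n where 1: "0 \<le> C" "\<And>z y. norm (keval P z y) \<le> C * jap z ^ m * jap y ^ m"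
    and 2: "0 \<le> D" "\<And>z y. norm (keval Q z y) \<le> D * jap z ^ n * jap y ^ n" by metis
  have "norm (keval (KMul P Q) z y) \<le> (C * D) * jap z ^ (m + n) * jap y ^ (m + n)" for z y
  proof -
    have "norm (keval P z y) * norm (keval Q z y) \<le> (C * jap z ^ m * jap y ^ m) * (D * jap z ^ n * jap y ^ n)"
      by (intro mult_mono 1 2) (auto simp: 1 jap_nonneg)
    then show ?thesis by (simp add: norm_mult power_add mult_ac)
  qed
  then show ?case using 1(1) 2(1) by (meson mult_nonneg_nonneg)
qed

lemma kfun_bound:
  fixes P :: "'d::finite kpoly"
  shows "\<exists>C m. 0 \<le> C \<and> (\<forall>z y. jap y ^ k * norm (kfun P z y) \<le> C * jap z ^ m * exp ((norm z)\<^sup>2 / 2))"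
proof -
  obtain C m where 1: "0 \<le> C" "\<And>z y. norm (keval P z y) \<le> C * jap z ^ m * jap y ^ m"
    using keval_bound by metis
  define n where "n = k + m"
  obtain D where D: "\<And>x::real^'d. exp (- (norm x)\<^sup>2 / 2) \<le> D * inverse (jap x ^ n)"
    using exp_minus_le_inverse_jap[of 2 n] by auto
  have "0 \<le> D" using D[of 0] by (simp add: jap_def)
  define c where "c = pi powr (- real CARD('d) / 4)"
  have "0 \<le> c" by (simp add: c_def)
  have "jap y ^ k * norm (kfun P z y) \<le> (C * D * 4 ^ n * c) * jap z ^ (m + n) * exp ((norm z)\<^sup>2 / 2)" for z y
  proof -
    \<comment> \<open>The centre of the Gaussian. By \<open>jap_add\<close>, powers of
      \<open>jap y\<close> split into powers of \<open>jap (y - x)\<close>, absorbed by the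
      Gaussian, and powers of \<open>jap x\<close>, charged to z; the two factors 2 produce
      4^n.\<close>
    define x :: "real^'d" where "x = sqrt 2 *\<^sub>R (\<chi> j. Re (z $ j))"
    have "(norm x)\<^sup>2 \<le> 2 * (norm z)\<^sup>2"
      unfolding x_def by (simp add: norm_vec_squared power_mult_distrib cmod_power2 sum_distrib_left[symmetric] sum_mono)
    then have "jap x \<le> 2 * jap z" by (simp add: jap_def)
    have "jap y = jap ((y - x) + x)" by simp
    also have "\<dots> \<le> 2 * jap (y - x) * jap x" by (rule jap_add)
    also have "\<dots> \<le> 2 * jap (y - x) * (2 * jap z)"
      by (intro mult_left_mono \<open>jap x \<le> 2 * jap z\<close>) (simp add: jap_nonneg)
    finally have "jap y ^ n \<le> (4 * jap (y - x) * jap z) ^ n"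
      by (intro power_mono) (auto simp: jap_nonneg)
    then have "jap y ^ n * exp (- (norm (y - x))\<^sup>2 / 2) \<le> (4 * jap (y - x) * jap z) ^ n * (D * inverse (jap (y - x) ^ n))"
      by (intro mult_mono D) (auto simp: jap_nonneg)
    also have "\<dots> = 4 ^ n * D * jap z ^ n"
      by (simp add: power_mult_distrib jap_nz)
    finally have *: "jap y ^ n * exp (- (norm (y - x))\<^sup>2 / 2) \<le> 4 ^ n * D * jap z ^ n" .
    have "jap y ^ k * norm (kfun P z y) \<le> jap y ^ k * ((C * jap z ^ m * jap y ^ m) * norm (bargmann_kernel z y))"
      unfolding kfun_def norm_mult by (intro mult_left_mono mult_right_mono 1) (auto simp: jap_nonneg)
    also have "\<dots> = (C * c * jap z ^ m * exp ((norm z)\<^sup>2 / 2)) * (jap y ^ n * exp (- (norm (y - x))\<^sup>2 / 2))"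
      unfolding norm_bargmann_kernel x_def[symmetric] c_def[symmetric] by (simp add: n_def power_add)
    also have "\<dots> \<le> (C * c * jap z ^ m * exp ((norm z)\<^sup>2 / 2)) * (4 ^ n * D * jap z ^ n)"
      using 1(1) \<open>0 \<le> c\<close> by (intro mult_left_mono *) (simp add: jap_nonneg)
    finally show ?thesis by (simp add: power_add mult_ac)
  qed
  moreover have "0 \<le> C * D * 4 ^ n * c" using 1(1) \<open>0 \<le> D\<close> \<open>0 \<le> c\<close> by simp
  ultimately show ?thesis by blast
qed

lemma abs_monomial_le: "\<bar>monomial \<alpha> x\<bar> \<le> jap x ^ (\<Sum>j\<in>UNIV. \<alpha> j)"
proof -
  have "\<bar>monomial \<alpha> x\<bar> = (\<Prod>j\<in>UNIV. \<bar>x $ j\<bar> ^ \<alpha> j)"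
    by (simp add: monomial_def abs_prod power_abs)
  also have "\<dots> \<le> (\<Prod>j\<in>UNIV. jap x ^ \<alpha> j)"
  proof (intro prod_mono conjI power_mono)
    fix j show "\<bar>x $ j\<bar> \<le> jap x"
      using component_le_norm_cart[of x j] jap_ge_norm[of x] by linarith
  qed auto
  also have "\<dots> = jap x ^ (\<Sum>j\<in>UNIV. \<alpha> j)" by (rule power_sum[symmetric])
  finally show ?thesis .
qed

lemma norm_monomial_scaleR_le:
  assumes "jap y ^ (\<Sum>j\<in>UNIV. \<alpha> j) * norm (c::complex) \<le> B"
  shows "norm (monomial \<alpha> y *\<^sub>R c) \<le> B"
  using mult_right_mono[OF abs_monomial_le norm_ge_zero[of c], of \<alpha> y] assms by simp

lemma kfun_schwartz:
  fixes P :: "'d::finite kpoly"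
  shows "kfun P z \<in> schwartz_space"
proof (rule schwartz_spaceI[OF smooth_kfun])
  fix \<alpha> :: "'d \<Rightarrow> nat" and js
  obtain C m where "\<And>z y. jap y ^ (\<Sum>j\<in>UNIV. \<alpha> j) * norm (kfun (foldr twisted_y js P) z y) \<le> C * jap z ^ m * exp ((norm z)\<^sup>2 / 2)"
    using kfun_bound[of "\<Sum>j\<in>UNIV. \<alpha> j" "foldr twisted_y js P"] by blast
  then show "\<exists>B. \<forall>x. norm (monomial \<alpha> x *\<^sub>R partial_derivs js (kfun P z) x) \<le> B"
    unfolding partial_derivs_kfun by (meson norm_monomial_scaleR_le)
qed

lemma bargmann_kernel_schwartz: "bargmann_kernel z \<in> schwartz_space"
  using kfun_schwartz[of "KConst 1" z] by (simp add: kfun_1)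

lemma kfun_locally_bounded:
  fixes P :: "'d::finite kpoly"
  shows "\<exists>B. 0 \<le> B \<and> (\<forall>h y. norm h \<le> 1 \<longrightarrow> jap y ^ k * norm (kfun P (z + h) y) \<le> B)"
proof -
  obtain C m where C: "0 \<le> C" "\<And>z y. jap y ^ k * norm (kfun P z y) \<le> C * jap z ^ m * exp ((norm z)\<^sup>2 / 2)"
    using kfun_bound[of k P] by blast
  have "jap y ^ k * norm (kfun P (z + h) y) \<le> C * (2 * jap z * 2) ^ m * exp ((norm z + 1)\<^sup>2 / 2)"
    if "norm h \<le> 1" for h y
  proof (rule order_trans[OF C(2)], intro mult_mono power_mono)
    have "jap h \<le> 2" using that by (simp add: jap_def power_le_one)
    then show "jap (z + h) \<le> 2 * jap z * 2"
      using jap_add[of z h] mult_left_mono[of "jap h" 2 "2 * jap z"] jap_nonneg[of z] by linarith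
    have "(norm (z + h))\<^sup>2 \<le> (norm z + 1)\<^sup>2"
      using norm_triangle_ineq[of z h] that by (intro power_mono) auto
    then show "exp ((norm (z + h))\<^sup>2 / 2) \<le> exp ((norm z + 1)\<^sup>2 / 2)" by simp
  qed (auto simp: C jap_nonneg)
  moreover have "0 \<le> C * (2 * jap z * 2) ^ m * exp ((norm z + 1)\<^sup>2 / 2)" using C(1) by (simp add: jap_nonneg)
  ultimately show ?thesis by blast
qed

lemma kfun_line_derivative:
  "((\<lambda>t. kfun P (z + t *\<^sub>R h) y) has_derivative (\<lambda>s. s *\<^sub>R (\<Sum>j\<in>UNIV. h $ j * kfun (twisted_z j P) (z + t *\<^sub>R h) y))) (at t)"
proof -
  have "((\<lambda>t. z + t *\<^sub>R h) has_derivative (\<lambda>s. s *\<^sub>R h)) (at t)"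
    by (auto intro!: derivative_eq_intros)
  from has_derivative_compose[OF this kfun_has_derivative_z]
  show ?thesis by (simp add: scaleR_sum_right)
qed

lemma norm_sum_vec_mult_le:
  assumes "\<And>j. norm (f j) \<le> B j"
  shows "norm (\<Sum>j\<in>UNIV. (h :: complex^'d::finite) $ j * f j) \<le> norm h * (\<Sum>j\<in>UNIV. B j)"
proof -
  have "norm (\<Sum>j\<in>UNIV. h $ j * f j) \<le> (\<Sum>j\<in>UNIV. norm h * B j)"
    by (rule sum_norm_le) (simp add: norm_mult mult_mono Finite_Cartesian_Product.norm_nth_le assms)
  then show ?thesis by (simp add: sum_distrib_left)
qed

lemma kfun_lipschitz:
  fixes P :: "'d::finite kpoly"
  shows "\<exists>B. 0 \<le> B \<and> (\<forall>h y. norm h \<le> 1 \<longrightarrow> jap y ^ k * norm (kfun P (z + h) y - kfun P z y) \<le> B * norm h)"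
proof -
  obtain B where B: "\<And>j. 0 \<le> B j"
    "\<And>j h y. norm h \<le> 1 \<Longrightarrow> jap y ^ k * norm (kfun (twisted_z j P) (z + h) y) \<le> B j"
    using kfun_locally_bounded[of k "twisted_z _ P" z] by metis
  have "jap y ^ k * norm (kfun P (z + h) y - kfun P z y) \<le> (\<Sum>j\<in>UNIV. B j) * norm h" if h: "norm h \<le> 1" for h y
  proof -
    have "\<exists>t\<in>{0<..<1}. norm (kfun P (z + 1 *\<^sub>R h) y - kfun P (z + 0 *\<^sub>R h) y) \<le>
       norm ((1 - 0) *\<^sub>R (\<Sum>j\<in>UNIV. h $ j * kfun (twisted_z j P) (z + t *\<^sub>R h) y))"
      by (rule mvt_general[of 0 1 "\<lambda>t. kfun P (z + t *\<^sub>R h) y"])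
        (auto intro!: kfun_line_derivative continuous_at_imp_continuous_on has_derivative_continuous[OF kfun_line_derivative])
    then obtain t where t: "0 < t" "t < 1" and
      le: "norm (kfun P (z + h) y - kfun P z y) \<le> norm (\<Sum>j\<in>UNIV. h $ j * kfun (twisted_z j P) (z + t *\<^sub>R h) y)"
      by auto
    have "norm (t *\<^sub>R h) \<le> 1" using t h by (simp add: mult_le_one)
    from B(2)[OF this] have "norm (kfun (twisted_z j P) (z + t *\<^sub>R h) y) \<le> B j / jap y ^ k" for j
      by (simp add: field_simps jap_pos)
    from order_trans[OF le norm_sum_vec_mult_le[OF this]]
    have "norm (kfun P (z + h) y - kfun P z y) \<le> norm h * (\<Sum>j\<in>UNIV. B j / jap y ^ k)" by simp
    then show ?thesis by (simp add: field_simps jap_pos flip: sum_divide_distrib)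
  qed
  then show ?thesis using B(1) by (meson sum_nonneg)
qed

text \<open>Second order from first-order information: with L the linear term at z, the function t
  -> kfun P (z + t h) y - t L has as derivative the difference of the linear terms at z + t h and at
  z, which \<open>kfun_lipschitz\<close> bounds quadratically in h. The arbitrary power of
  \<open>jap y\<close> makes this an estimate for every Schwartz seminorm.\<close>

lemma kfun_taylor:
  fixes P :: "'d::finite kpoly"
  shows "\<exists>B. 0 \<le> B \<and> (\<forall>h y. norm h \<le> 1 \<longrightarrow>
     jap y ^ k * norm (kfun P (z + h) y - kfun P z y - (\<Sum>j\<in>UNIV. h $ j * kfun (twisted_z j P) z y)) \<le> B * (norm h)\<^sup>2)"
proof -
  obtain B where B: "\<And>j. 0 \<le> B j"
    "\<And>j h y. norm h \<le> 1 \<Longrightarrow> jap y ^ k * norm (kfun (twisted_z j P) (z + h) y - kfun (twisted_z j P) z y) \<le> B j * norm h"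
    using kfun_lipschitz[of k "twisted_z _ P" z] by metis
  have "jap y ^ k * norm (kfun P (z + h) y - kfun P z y - (\<Sum>j\<in>UNIV. h $ j * kfun (twisted_z j P) z y)) \<le> (\<Sum>j\<in>UNIV. B j) * (norm h)\<^sup>2"
    if h: "norm h \<le> 1" for h y
  proof -
    let ?L = "\<Sum>j\<in>UNIV. h $ j * kfun (twisted_z j P) z y"
    let ?f = "\<lambda>t. kfun P (z + t *\<^sub>R h) y - t *\<^sub>R ?L"
    let ?f' = "\<lambda>t s. s *\<^sub>R (\<Sum>j\<in>UNIV. h $ j * kfun (twisted_z j P) (z + t *\<^sub>R h) y) - s *\<^sub>R ?L"
    have d: "(?f has_derivative ?f' t) (at t)" for t
      by (intro has_derivative_diff kfun_line_derivative) (auto intro!: derivative_eq_intros)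
    have "\<exists>t\<in>{0<..<1}. norm (?f 1 - ?f 0) \<le> norm (?f' t (1 - 0))"
      by (rule mvt_general[of 0 1 ?f])
        (auto intro!: d continuous_at_imp_continuous_on has_derivative_continuous[OF d])
    then obtain t where t: "0 < t" "t < 1" and
      "norm (?f 1 - ?f 0) \<le> norm (?f' t (1 - 0))"
      by auto
    then have le: "norm (kfun P (z + h) y - kfun P z y - ?L) \<le>
       norm (\<Sum>j\<in>UNIV. h $ j * (kfun (twisted_z j P) (z + t *\<^sub>R h) y - kfun (twisted_z j P) z y))"
      by (simp add: right_diff_distrib sum_subtractf algebra_simps)
    have th: "norm (t *\<^sub>R h) \<le> 1" "norm (t *\<^sub>R h) \<le> norm h" using t h by (auto simp: mult_le_one mult_left_le_one_le)
    have "jap y ^ k * norm (kfun (twisted_z j P) (z + t *\<^sub>R h) y - kfun (twisted_z j P) z y) \<le> B j * norm h" for j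
      using B(2)[OF th(1), of y j] mult_left_mono[OF th(2) B(1)[of j]] by linarith
    then have "norm (kfun (twisted_z j P) (z + t *\<^sub>R h) y - kfun (twisted_z j P) z y) \<le> B j * norm h / jap y ^ k" for j
      by (simp add: field_simps jap_pos)
    from order_trans[OF le norm_sum_vec_mult_le[OF this]]
    have "norm (kfun P (z + h) y - kfun P z y - ?L) \<le> norm h * (\<Sum>j\<in>UNIV. B j * norm h / jap y ^ k)" .
    then show ?thesis
      by (simp add: field_simps jap_pos power2_eq_square flip: sum_divide_distrib sum_distrib_right sum_distrib_left)
  qed
  then show ?thesis using B(1) by (meson sum_nonneg)
qed

section \<open>Transforms of tempered distributions\<close>

lemma zero_schwartz: "(\<lambda>x. 0) \<in> schwartz_space"
  using schwartz_cmult(1)[OF bargmann_kernel_schwartz, of 0] by simp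

lemma
  assumes "finite A" "\<And>a. a \<in> A \<Longrightarrow> f a \<in> schwartz_space"
  shows schwartz_sum: "(\<lambda>x. \<Sum>a\<in>A. f a x) \<in> schwartz_space"
    and partial_derivs_sum: "partial_derivs js (\<lambda>x. \<Sum>a\<in>A. f a x) = (\<lambda>x. \<Sum>a\<in>A. partial_derivs js (f a) x)"
proof -
  have "(\<lambda>x. \<Sum>a\<in>A. f a x) \<in> schwartz_space \<and>
      partial_derivs js (\<lambda>x. \<Sum>a\<in>A. f a x) = (\<lambda>x. \<Sum>a\<in>A. partial_derivs js (f a) x)" for js
    using assms
  proof (induction A rule: finite_induct)
    case empty
    then show ?case using schwartz_cmult(2)[OF zero_schwartz, of js 0] by (simp add: zero_schwartz)
  next
    case (insert a A)
    then show ?case by (simp add: schwartz_add[of "f a"])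
  qed
  then show "(\<lambda>x. \<Sum>a\<in>A. f a x) \<in> schwartz_space"
    "partial_derivs js (\<lambda>x. \<Sum>a\<in>A. f a x) = (\<lambda>x. \<Sum>a\<in>A. partial_derivs js (f a) x)" by auto
qed

context
  fixes T :: "(real^'d::finite \<Rightarrow> complex) \<Rightarrow> complex"
  assumes T: "T \<in> tempered_distributions"
begin

lemma tempered_add: "\<phi> \<in> schwartz_space \<Longrightarrow> \<psi> \<in> schwartz_space \<Longrightarrow> T (\<lambda>x. \<phi> x + \<psi> x) = T \<phi> + T \<psi>"
  and tempered_cmult: "\<phi> \<in> schwartz_space \<Longrightarrow> T (\<lambda>x. c * \<phi> x) = c * T \<phi>"
  using T by (auto simp: tempered_distributions_iff)

lemma tempered_sum:
  assumes "finite A" "\<And>a. a \<in> A \<Longrightarrow> f a \<in> schwartz_space"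
  shows "T (\<lambda>x. \<Sum>a\<in>A. f a x) = (\<Sum>a\<in>A. T (f a))"
  using assms
proof (induction A rule: finite_induct)
  case empty
  then show ?case using tempered_cmult[OF zero_schwartz, of 0] by simp
next
  case (insert a A)
  then show ?case by (simp add: tempered_add schwartz_sum)
qed

lemma tempered_bounded:
  "\<exists>C N. 0 \<le> C \<and> (\<forall>\<phi>\<in>schwartz_space. norm (T \<phi>) \<le> C * schwartz_norm N \<phi>)"
  using T by (simp add: tempered_distributions_iff schwartz_bounded_def)

text \<open>Differences are written with factors -1 because sums and scalar multiples are the
  operations for which closure of the Schwartz space and linearity of T are stated.\<close>

definition taylor_remainder :: "complex^'d \<Rightarrow> complex^'d \<Rightarrow> real^'d \<Rightarrow> complex" where
  "taylor_remainder z h = (\<lambda>y. (bargmann_kernel (z + h) y + (-1) * bargmann_kernel z y) +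
     (-1) * (\<Sum>j\<in>UNIV. h $ j * kfun (twisted_z j (KConst 1)) z y))"

text \<open>Since y- and z-derivatives commute (\<open>kfun_foldr_twisted_commute\<close>), each
  y-derivative of the remainder is again a first-order remainder, of a differentiated kernel, and
  \<open>kfun_taylor\<close> applies to it.\<close>

lemma
  shows taylor_remainder_schwartz: "taylor_remainder z h \<in> schwartz_space"
    and partial_derivs_taylor_remainder: "partial_derivs js (taylor_remainder z h) =
     (\<lambda>y. kfun (foldr twisted_y js (KConst 1)) (z + h) y - kfun (foldr twisted_y js (KConst 1)) z y -
       (\<Sum>j\<in>UNIV. h $ j * kfun (twisted_z j (foldr twisted_y js (KConst 1))) z y))"
    and tempered_taylor_remainder: "T (taylor_remainder z h) = bargmann T (z + h) - bargmann T z -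
      (\<Sum>j\<in>UNIV. h $ j * T (kfun (twisted_z j (KConst 1)) z))"
proof -
  let ?s = "\<lambda>j y. h $ j * kfun (twisted_z j (KConst 1)) z y"
  have 1: "?s j \<in> schwartz_space" for j
    by (intro schwartz_cmult kfun_schwartz)
  have 2: "(\<lambda>y. \<Sum>j\<in>UNIV. ?s j y) \<in> schwartz_space"
    by (rule schwartz_sum) (auto intro: 1)
  have 3: "(\<lambda>y. (-1) * bargmann_kernel z y) \<in> schwartz_space"
    by (intro schwartz_cmult bargmann_kernel_schwartz)
  have 4: "(\<lambda>y. bargmann_kernel (z + h) y + (-1) * bargmann_kernel z y) \<in> schwartz_space"
    by (intro schwartz_add(1) 3 bargmann_kernel_schwartz)
  have 5: "(\<lambda>y. (-1) * (\<Sum>j\<in>UNIV. ?s j y)) \<in> schwartz_space"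
    by (rule schwartz_cmult(1)[OF 2])
  show "taylor_remainder z h \<in> schwartz_space"
    unfolding taylor_remainder_def by (intro schwartz_add(1) 4 5)
  show "partial_derivs js (taylor_remainder z h) =
     (\<lambda>y. kfun (foldr twisted_y js (KConst 1)) (z + h) y - kfun (foldr twisted_y js (KConst 1)) z y -
       (\<Sum>j\<in>UNIV. h $ j * kfun (twisted_z j (foldr twisted_y js (KConst 1))) z y))"
    unfolding taylor_remainder_def schwartz_add(2)[OF 4 5] schwartz_cmult(2)[OF 2]
      schwartz_add(2)[OF bargmann_kernel_schwartz 3] schwartz_cmult(2)[OF bargmann_kernel_schwartz]
      partial_derivs_sum[of UNIV ?s, OF finite 1] schwartz_cmult(2)[OF kfun_schwartz]
    unfolding kfun_1[symmetric] partial_derivs_kfun kfun_foldr_twisted_commute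
    by (simp add: fun_eq_iff)
  show "T (taylor_remainder z h) = bargmann T (z + h) - bargmann T z -
      (\<Sum>j\<in>UNIV. h $ j * T (kfun (twisted_z j (KConst 1)) z))"
    unfolding taylor_remainder_def tempered_add[OF 4 5] tempered_cmult[OF 2]
      tempered_add[OF bargmann_kernel_schwartz 3] tempered_cmult[OF bargmann_kernel_schwartz]
      tempered_sum[of UNIV ?s, OF finite 1] tempered_cmult[OF kfun_schwartz] bargmann_def
    by simp
qed

text \<open>Differentiability of the kernel in z as a map into the Schwartz space, the form in which
  the continuity of T can be used.\<close>

lemma schwartz_norm_taylor_remainder:
  "\<exists>B. 0 \<le> B \<and> (\<forall>h. norm h \<le> 1 \<longrightarrow> schwartz_norm N (taylor_remainder z h) \<le> B * (norm h)\<^sup>2)"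
proof -
  have "\<exists>B. 0 \<le> B \<and> (\<forall>h. norm h \<le> 1 \<longrightarrow> schwartz_seminorm \<alpha> js (taylor_remainder z h) \<le> B * (norm h)\<^sup>2)" for \<alpha> js
  proof -
    have "\<exists>B. 0 \<le> B \<and> (\<forall>h y. norm h \<le> 1 \<longrightarrow>
      jap y ^ (\<Sum>j\<in>UNIV. \<alpha> j) * norm (partial_derivs js (taylor_remainder z h) y) \<le> B * (norm h)\<^sup>2)"
      unfolding partial_derivs_taylor_remainder by (rule kfun_taylor)
    then show ?thesis by (meson norm_monomial_scaleR_le schwartz_seminorm_least)
  qed
  then obtain B where B: "\<And>\<alpha> js. 0 \<le> B \<alpha> js"
    "\<And>\<alpha> js h. norm h \<le> 1 \<Longrightarrow> schwartz_seminorm \<alpha> js (taylor_remainder z h) \<le> B \<alpha> js * (norm h)\<^sup>2"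
    by metis
  let ?B = "\<Sum>\<alpha> | (\<Sum>j\<in>UNIV. \<alpha> j) \<le> N. \<Sum>js | length js \<le> N. B \<alpha> js"
  have "schwartz_norm N (taylor_remainder z h) \<le> ?B * (norm h)\<^sup>2" if "norm h \<le> 1" for h
    unfolding schwartz_norm_def sum_distrib_right by (intro sum_mono B(2) that)
  moreover have "0 \<le> ?B" by (intro sum_nonneg B(1))
  ultimately show ?thesis by blast
qed

text \<open>T carries the remainder estimate over to the transform. The derivative is a combination
  of the components of h with constant coefficients, hence complex linear.\<close>

lemma entire_bargmann: "entire (bargmann T)"
  unfolding entire_def
proof (intro allI exI conjI)
  fix z c v
  let ?D = "\<lambda>h. \<Sum>j\<in>UNIV. h $ j * T (kfun (twisted_z j (KConst 1)) z)"
  show "?D (c *s v) = c * ?D v" by (simp add: sum_distrib_left mult.assoc)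
  obtain C N where C: "0 \<le> C" "\<And>\<phi>. \<phi>\<in>schwartz_space \<Longrightarrow> norm (T \<phi>) \<le> C * schwartz_norm N \<phi>"
    using tempered_bounded by blast
  obtain B where B: "0 \<le> B" "\<And>h. norm h \<le> 1 \<Longrightarrow> schwartz_norm N (taylor_remainder z h) \<le> B * (norm h)\<^sup>2"
    using schwartz_norm_taylor_remainder[of N z] by blast
  show "(bargmann T has_derivative ?D) (at z)"
  proof (rule has_derivativeI_sandwich)
    show "(0::real) < 1" by simp
    have "linear ?D"
      by (rule linearI) (auto simp: sum.distrib scaleR_sum_right algebra_simps)
    then show "bounded_linear ?D" by (rule linear_linear[THEN iffD2])
    show "norm (bargmann T w - bargmann T z - ?D (w - z)) / norm (w - z) \<le> (C * B) * norm (w - z)"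
      if w: "w \<noteq> z" "dist w z < 1" for w
    proof -
      have "bargmann T w - bargmann T z - ?D (w - z) = T (taylor_remainder z (w - z))"
        unfolding tempered_taylor_remainder by simp
      also have "norm \<dots> \<le> C * schwartz_norm N (taylor_remainder z (w - z))"
        by (rule C(2)[OF taylor_remainder_schwartz])
      also have "\<dots> \<le> C * (B * (norm (w - z))\<^sup>2)"
        using w(2) by (intro mult_left_mono B C) (auto simp: dist_norm)
      finally show ?thesis using w(1) by (simp add: field_simps power2_eq_square)
    qed
    show "((\<lambda>w. (C * B) * norm (w - z)) \<longlongrightarrow> 0) (at z)"
      by (auto intro!: tendsto_eq_intros)
  qed
qed

lemma bargmann_growth:
  "\<exists>C m. 0 \<le> C \<and> (\<forall>z. norm (bargmann T z) \<le> C * jap z ^ m * exp ((norm z)\<^sup>2 / 2))"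
proof -
  obtain C N where C: "0 \<le> C" "\<And>\<phi>. \<phi>\<in>schwartz_space \<Longrightarrow> norm (T \<phi>) \<le> C * schwartz_norm N \<phi>"
    using tempered_bounded by blast
  have "\<exists>B m. 0 \<le> B \<and> (\<forall>z. schwartz_seminorm \<alpha> js (bargmann_kernel z) \<le> B * jap z ^ m * exp ((norm z)\<^sup>2 / 2))"
    for \<alpha> :: "'d \<Rightarrow> nat" and js
  proof -
    obtain B m where "0 \<le> B" "\<And>z y. jap y ^ (\<Sum>j\<in>UNIV. \<alpha> j) * norm (partial_derivs js (bargmann_kernel z) y)
        \<le> B * jap z ^ m * exp ((norm z)\<^sup>2 / 2)"
      unfolding kfun_1[symmetric] partial_derivs_kfun
      using kfun_bound[of "\<Sum>j\<in>UNIV. \<alpha> j" "foldr twisted_y js (KConst 1)"] by metis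
    then show ?thesis by (meson norm_monomial_scaleR_le schwartz_seminorm_least)
  qed
  then obtain B m where B: "\<And>\<alpha> js. 0 \<le> B \<alpha> js"
    "\<And>\<alpha> js z. schwartz_seminorm \<alpha> js (bargmann_kernel (z :: complex^'d)) \<le> B \<alpha> js * jap z ^ m \<alpha> js * exp ((norm z)\<^sup>2 / 2)"
    by metis
  let ?S = "{\<alpha> :: 'd \<Rightarrow> nat. (\<Sum>j\<in>UNIV. \<alpha> j) \<le> N}" and ?J = "{js :: 'd list. length js \<le> N}"
  \<comment> \<open>The sum of all exponents is a single exponent that dominates each of the
    finitely many \<open>m \<alpha> js\<close>.\<close>
  let ?B = "\<Sum>\<alpha>\<in>?S. \<Sum>js\<in>?J. B \<alpha> js" and ?m = "\<Sum>\<alpha>\<in>?S. \<Sum>js\<in>?J. m \<alpha> js"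
  have m: "m \<alpha> js \<le> ?m" if "\<alpha> \<in> ?S" "js \<in> ?J" for \<alpha> js
  proof -
    have "m \<alpha> js \<le> (\<Sum>js\<in>?J. m \<alpha> js)" by (rule member_le_sum) (use that in auto)
    also have "\<dots> \<le> ?m" by (rule member_le_sum[of \<alpha>]) (use that in auto)
    finally show ?thesis .
  qed
  have "norm (bargmann T z) \<le> (C * ?B) * jap z ^ ?m * exp ((norm z)\<^sup>2 / 2)" for z
  proof -
    have "schwartz_norm N (bargmann_kernel z) \<le> (\<Sum>\<alpha>\<in>?S. \<Sum>js\<in>?J. B \<alpha> js * jap z ^ ?m * exp ((norm z)\<^sup>2 / 2))"
      unfolding schwartz_norm_def
    proof (intro sum_mono)
      fix \<alpha> js assume *: "\<alpha> \<in> ?S" "js \<in> ?J"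
      have "schwartz_seminorm \<alpha> js (bargmann_kernel z) \<le> B \<alpha> js * jap z ^ m \<alpha> js * exp ((norm z)\<^sup>2 / 2)"
        by (rule B(2))
      also have "\<dots> \<le> B \<alpha> js * jap z ^ ?m * exp ((norm z)\<^sup>2 / 2)"
        by (intro mult_right_mono mult_left_mono jap_power_mono m * B(1)) simp
      finally show "schwartz_seminorm \<alpha> js (bargmann_kernel z) \<le> B \<alpha> js * jap z ^ ?m * exp ((norm z)\<^sup>2 / 2)" .
    qed
    also have "\<dots> = ?B * jap z ^ ?m * exp ((norm z)\<^sup>2 / 2)" by (simp add: sum_distrib_right)
    finally have "C * schwartz_norm N (bargmann_kernel z) \<le> C * (?B * jap z ^ ?m * exp ((norm z)\<^sup>2 / 2))"
      by (rule mult_left_mono[OF _ C(1)])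
    moreover have "norm (bargmann T z) \<le> C * schwartz_norm N (bargmann_kernel z)"
      unfolding bargmann_def by (rule C(2)[OF bargmann_kernel_schwartz])
    ultimately show ?thesis by (simp add: mult.assoc)
  qed
  moreover have "0 \<le> C * ?B" by (intro mult_nonneg_nonneg sum_nonneg B(1) C(1))
  ultimately show ?thesis by blast
qed

end

section \<open>Mixed norms and polynomial weights\<close>

lemma jap_conv_Basis: "jap (x :: 'a::euclidean_space) = 1 + (\<Sum>b\<in>Basis. (x \<bullet> b)\<^sup>2)"
  unfolding jap_def power2_norm_eq_inner by (subst euclidean_inner) (simp add: power2_eq_square)

lemma real_polynomial_function_jap_power:
  "real_polynomial_function (\<lambda>x::'a::euclidean_space. jap x ^ k)"
proof -
  have "real_polynomial_function (\<lambda>x::'a. \<Sum>b\<in>Basis. (x \<bullet> b)\<^sup>2)"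
    by (rule real_polynomial_function_sum[OF finite_Basis], rule real_polynomial_function_power,
        rule real_polynomial_function.intros(1), rule bounded_linear_inner_left)
  then show ?thesis
    unfolding jap_conv_Basis by (intro real_polynomial_function_power real_polynomial_function.intros(2,3))
qed

lemma real_polynomial_function_bound:
  "real_polynomial_function v \<Longrightarrow> \<exists>C m. 0 \<le> C \<and> (\<forall>x. \<bar>v x\<bar> \<le> C * jap x ^ m)"
proof (induction rule: real_polynomial_function.induct)
  case (linear f)
  then obtain K where K: "0 < K" "\<And>x. norm (f x) \<le> norm x * K" using bounded_linear.pos_bounded by blast
  have "\<bar>f x\<bar> \<le> K * jap x ^ 1" for x
  proof -
    have "K * norm x \<le> K * jap x" using K(1) by (intro mult_left_mono jap_ge_norm) simp
    then show ?thesis using K(2)[of x] by (simp only: mult.commute[of _ K] power_one_right real_norm_def)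
  qed
  then show ?case using K(1) by (meson less_imp_le)
next
  case (const c)
  then show ?case by (intro exI[of _ "\<bar>c\<bar>"] exI[of _ 0]) simp
next
  case (add f g)
  then obtain C m D n where 1: "0 \<le> C" "\<And>x. \<bar>f x\<bar> \<le> C * jap x ^ m"
    and 2: "0 \<le> D" "\<And>x. \<bar>g x\<bar> \<le> D * jap x ^ n" by metis
  have "\<bar>f x + g x\<bar> \<le> (C + D) * jap x ^ (m + n)" for x
  proof -
    have "\<bar>f x\<bar> \<le> C * jap x ^ (m + n)"
      using 1(2)[of x] mult_left_mono[OF jap_power_mono[of m "m + n" x] 1(1)] by simp
    moreover have "\<bar>g x\<bar> \<le> D * jap x ^ (m + n)"
      using 2(2)[of x] mult_left_mono[OF jap_power_mono[of n "m + n" x] 2(1)] by simp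
    ultimately show ?thesis by (simp add: algebra_simps)
  qed
  then show ?case using 1(1) 2(1) by (meson add_nonneg_nonneg)
next
  case (mult f g)
  then obtain C m D n where 1: "0 \<le> C" "\<And>x. \<bar>f x\<bar> \<le> C * jap x ^ m"
    and 2: "0 \<le> D" "\<And>x. \<bar>g x\<bar> \<le> D * jap x ^ n" by metis
  have "\<bar>f x * g x\<bar> \<le> (C * D) * jap x ^ (m + n)" for x
  proof -
    have "\<bar>f x\<bar> * \<bar>g x\<bar> \<le> (C * jap x ^ m) * (D * jap x ^ n)"
      by (intro mult_mono 1 2) (auto simp: 1 jap_nonneg)
    then show ?thesis by (simp add: abs_mult power_add mult_ac)
  qed
  then show ?case using 1(1) 2(1) by (meson mult_nonneg_nonneg)
qed

text \<open>Moderateness is \<open>jap_add\<close> applied to x = (x + y) + (- y), with constant 2^k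
  and polynomial jap^k.\<close>

lemma inverse_jap_power_poly_weight:
  "(\<lambda>X::'a::euclidean_space. inverse (jap X ^ k)) \<in> poly_weights"
proof -
  have cont: "continuous_on UNIV (\<lambda>X::'a. inverse (jap X ^ k))"
    by (intro continuous_intros) (auto simp: jap_nz)
  have le1: "inverse (jap X ^ k) \<le> 1" for X :: 'a
    using one_le_power[OF jap_ge1, of X k] by (simp add: field_simps jap_pos)
  have "(\<lambda>X::'a. inverse (jap X ^ k)) \<in> borel_measurable lebesgue"
    using borel_measurable_continuous_onI[OF cont] by (simp add: measurable_completion)
  then have "locally_ess_bounded (\<lambda>X::'a. inverse (jap X ^ k))"
    unfolding locally_ess_bounded_def using le1 by (auto intro!: exI[of _ 1] AE_I2 simp: jap_nonneg)
  moreover have "inverse (jap (x + y) ^ k) \<le> 2 ^ k * inverse (jap x ^ k) * jap y ^ k" for x y :: 'a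
  proof -
    have "jap x = jap ((x + y) + - y)" by simp
    also have "\<dots> \<le> 2 * jap (x + y) * jap (- y)" by (rule jap_add)
    finally have "jap x ^ k \<le> (2 * jap (x + y) * jap y) ^ k"
      by (intro power_mono) (auto simp: jap_nonneg)
    then show ?thesis by (simp add: field_simps jap_pos power_mult_distrib)
  qed
  ultimately show ?thesis
    unfolding poly_weights_def using real_polynomial_function_jap_power[of k, where 'a='a]
    by (auto simp: jap_pos intro!: exI[of _ "2 ^ k"] exI[of _ "\<lambda>x. jap x ^ k"])
qed

text \<open>Moderateness for X and - X compares the value at X with that at 0, at a polynomial cost.
  It replaces an arbitrary weight by a continuous minorant of explicit decay.\<close>

lemma poly_weight_lower_bound:
  assumes "w \<in> (poly_weights :: ('a::euclidean_space \<Rightarrow> real) set)"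
  shows "\<exists>c m. 0 < c \<and> (\<forall>X. c * inverse (jap X ^ m) \<le> w X)"
proof -
  obtain C v where pos: "\<And>x. w x > 0" and "C > 0" and v: "real_polynomial_function v" "\<And>y. v y > 0"
    and le: "\<And>x y. w (x + y) \<le> C * w x * v y"
    using assms unfolding poly_weights_def by blast
  obtain D m where D: "0 \<le> D" "\<And>x. \<bar>v x\<bar> \<le> D * jap x ^ m"
    using real_polynomial_function_bound[OF v(1)] by blast
  have "0 < D" using D(2)[of 0] v(2)[of 0] by (simp add: jap_def)
  have "w 0 / (C * D) * inverse (jap X ^ m) \<le> w X" for X
  proof -
    have "w 0 \<le> C * w X * v (- X)" using le[of X "- X"] by simp
    also have "\<dots> \<le> C * w X * (D * jap X ^ m)"
      using D(2)[of "- X"] \<open>C > 0\<close> pos[of X] by (intro mult_left_mono) auto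
    finally show ?thesis using \<open>C > 0\<close> \<open>D > 0\<close> by (simp add: field_simps jap_pos)
  qed
  then show ?thesis using \<open>C > 0\<close> \<open>D > 0\<close> pos[of 0] by (meson divide_pos_pos mult_pos_pos)
qed

section \<open>Lebesgue norms: decay, measurability, local integrals\<close>

lemma ennreal_rpow_ennreal [simp]: "0 \<le> c \<Longrightarrow> ennreal_rpow (ennreal c) a = ennreal (c powr a)"
  by (simp add: ennreal_rpow_def)

lemma ennreal_rpow_mono: "x \<le> y \<Longrightarrow> 0 \<le> a \<Longrightarrow> ennreal_rpow x a \<le> ennreal_rpow y a"
  by (cases x; cases y) (auto simp: ennreal_rpow_def powr_mono2 top_unique)

lemma borel_measurable_ennreal_rpow [measurable]:
  assumes [measurable]: "f \<in> borel_measurable M"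
  shows "(\<lambda>x. ennreal_rpow (f x) a) \<in> borel_measurable M"
proof -
  have "{x \<in> space M. f x = top} \<in> sets M" by measurable
  then show ?thesis unfolding ennreal_rpow_def by (intro measurable_If) measurable
qed

lemma enn2real_ge_1: "1 \<le> p \<Longrightarrow> p \<noteq> top \<Longrightarrow> 1 \<le> enn2real p"
  by (cases p) (auto simp: ennreal_1[symmetric] simp del: ennreal_1)

text \<open>B is independent of f and C, so C can carry the decay in the other variable when the
  norms are iterated. As inverse (jap x ^ n) \<le> 1, its r-th power is at most itself, and one n
  serves all exponents.\<close>

lemma Lp_norm_inverse_jap_bound:
  assumes p: "1 \<le> p" and n: "DIM('a) \<le> n"
  shows "\<exists>B\<ge>0. \<forall>C f. 0 \<le> C \<longrightarrow> f \<in> borel_measurable lebesgue \<longrightarrow>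
     (\<forall>x::'a::euclidean_space. f x \<le> ennreal (C * inverse (jap x ^ n))) \<longrightarrow> Lp_norm p lebesgue f \<le> ennreal (C * B)"
proof (cases "p = top")
  case True
  have "Lp_norm p lebesgue f \<le> ennreal (C * 1)"
    if "0 \<le> C" "f \<in> borel_measurable lebesgue" "\<And>x::'a. f x \<le> ennreal (C * inverse (jap x ^ n))" for C f
  proof -
    have "f x \<le> ennreal C" for x
    proof (rule order_trans[OF that(3)], rule ennreal_leI)
      have "inverse (jap x ^ n) \<le> 1" using one_le_power[OF jap_ge1, of x n] by (simp add: field_simps jap_pos)
      then show "C * inverse (jap x ^ n) \<le> C" using that(1) mult_left_le by blast
    qed
    then show ?thesis using that(2) True by (auto simp: Lp_norm_def intro!: esssup_I)
  qed
  then show ?thesis by (intro exI[of _ 1]) auto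
next
  case False
  define r where "r = enn2real p"
  have r: "1 \<le> r" unfolding r_def using p False by (rule enn2real_ge_1)
  define I where "I = (\<integral>x. inverse (jap (x :: 'a) ^ n) \<partial>lborel)"
  have I: "0 \<le> I" "(\<integral>\<^sup>+x. ennreal (inverse (jap (x :: 'a) ^ n)) \<partial>lebesgue) = ennreal I"
    using integrable_inverse_jap[OF n]
    by (auto simp: I_def nn_integral_completion nn_integral_eq_integral jap_nonneg)
  have "Lp_norm p lebesgue f \<le> ennreal (C * I powr (1 / r))"
    if C: "0 \<le> C" and f: "\<And>x::'a. f x \<le> ennreal (C * inverse (jap x ^ n))" for C f
  proof -
    have "ennreal_rpow (f x) r \<le> ennreal (C powr r) * ennreal (inverse (jap x ^ n))" for x
    proof -
      have i: "0 \<le> inverse (jap x ^ n)" "inverse (jap x ^ n) \<le> 1"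
        using one_le_power[OF jap_ge1, of x n] by (auto simp: field_simps jap_pos jap_nonneg)
      have "ennreal_rpow (f x) r \<le> ennreal_rpow (ennreal (C * inverse (jap x ^ n))) r"
        using f r by (intro ennreal_rpow_mono) auto
      also have "\<dots> = ennreal (C powr r * inverse (jap x ^ n) powr r)"
        using C i(1) by (subst ennreal_rpow_ennreal) (auto simp: powr_mult)
      also have "\<dots> \<le> ennreal (C powr r * inverse (jap x ^ n) powr 1)"
        using i r by (intro ennreal_leI mult_left_mono powr_mono') auto
      finally show ?thesis using i by (simp add: ennreal_mult')
    qed
    then have "(\<integral>\<^sup>+x. ennreal_rpow (f x) r \<partial>lebesgue) \<le> (\<integral>\<^sup>+x. ennreal (C powr r) * ennreal (inverse (jap (x :: 'a) ^ n)) \<partial>lebesgue)"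
      by (intro nn_integral_mono)
    also have "\<dots> = ennreal (C powr r * I)"
      using I by (subst nn_integral_cmult) (auto simp: ennreal_mult' intro!: measurable_completion)
    finally have "Lp_norm p lebesgue f \<le> ennreal_rpow (ennreal (C powr r * I)) (1 / r)"
      unfolding Lp_norm_def r_def[symmetric] using False r by (auto intro!: ennreal_rpow_mono)
    also have "\<dots> = ennreal (C * I powr (1 / r))"
      using C I r by (subst ennreal_rpow_ennreal) (auto simp: powr_mult powr_powr)
    finally show ?thesis .
  qed
  then show ?thesis by (intro exI[of _ "I powr (1 / r)"]) auto
qed

text \<open>The points where f exceeds its essential supremum form an open null set, hence an empty
  one.\<close>

lemma esssup_lebesgue_continuous:
  fixes f :: "'a::euclidean_space \<Rightarrow> real"
  assumes "continuous_on UNIV f"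
  shows "esssup lebesgue (\<lambda>x. ennreal (f x)) = (SUP x. ennreal (f x))"
proof (rule antisym)
  have m: "(\<lambda>x. ennreal (f x)) \<in> borel_measurable lebesgue"
    using borel_measurable_continuous_onI[OF assms] by (auto intro: measurable_completion)
  show "esssup lebesgue (\<lambda>x. ennreal (f x)) \<le> (SUP x. ennreal (f x))"
    by (rule esssup_I[OF m]) (intro AE_I2 SUP_upper UNIV_I)
  show "(SUP x. ennreal (f x)) \<le> esssup lebesgue (\<lambda>x. ennreal (f x))"
  proof (rule SUP_least, rule ccontr)
    fix x assume "\<not> ennreal (f x) \<le> esssup lebesgue (\<lambda>x. ennreal (f x))"
    then have x: "esssup lebesgue (\<lambda>x. ennreal (f x)) < ennreal (f x)" by simp
    let ?U = "{y. esssup lebesgue (\<lambda>x. ennreal (f x)) < ennreal (f y)}"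
    have c: "continuous_on UNIV (\<lambda>x. ennreal (f x))"
      by (intro continuous_on_ennreal assms)
    have "open ?U" using c by (intro open_Collect_less continuous_intros) auto
    moreover have "?U \<in> null_sets lebesgue"
      using esssup_zero_measure[of lebesgue "\<lambda>x. ennreal (f x)"] \<open>open ?U\<close> by (auto simp: null_sets_def)
    ultimately have "?U = {}"
      using open_not_negligible negligible_iff_null_sets by blast
    then show False using x by blast
  qed
qed

text \<open>The outer essential supremum can be bounded by \<open>esssup_I\<close> only for a
  measurable function. For p = \<infinity> the inner supremum is uncountable, but its superlevel
  sets are unions of open sets; for finite p Tonelli applies.\<close>

lemma borel_measurable_inner_Lp_norm:
  fixes h :: "'a::euclidean_space \<times> 'b::euclidean_space \<Rightarrow> real"
  assumes h: "continuous_on UNIV h" and nonneg: "\<And>X. 0 \<le> h X"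
  shows "(\<lambda>\<xi>. Lp_norm p lebesgue (\<lambda>x. ennreal (h (x, \<xi>)))) \<in> borel_measurable borel"
proof (cases "p = top")
  case True
  have slice: "continuous_on UNIV (\<lambda>x. h (x, \<xi>))" "continuous_on UNIV (\<lambda>\<xi>. h (x, \<xi>))" for x \<xi>
    by (auto intro!: continuous_on_compose2[OF h] continuous_intros)
  have "(\<lambda>\<xi>. SUP x. ennreal (h (x, \<xi>))) \<in> borel_measurable borel"
  proof (rule borel_measurableI_greater)
    fix y
    have "{\<xi> \<in> space borel. y < (SUP x. ennreal (h (x, \<xi>)))} = (\<Union>x. {\<xi>. y < ennreal (h (x, \<xi>))})"
      by (auto simp: less_SUP_iff)
    moreover have "open (\<Union>x. {\<xi>. y < ennreal (h (x, \<xi>))})"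
      by (intro open_UN ballI open_Collect_less continuous_on_const continuous_on_ennreal slice)
    ultimately show "{\<xi> \<in> space borel. y < (SUP x. ennreal (h (x, \<xi>)))} \<in> sets borel"
      by simp
  qed
  then show ?thesis
    using True by (simp add: Lp_norm_def esssup_lebesgue_continuous[OF slice(1)])
next
  case False
  have [measurable]: "h \<in> borel_measurable (borel \<Otimes>\<^sub>M borel)"
    unfolding borel_prod by (rule borel_measurable_continuous_onI[OF h])
  have "(\<lambda>\<xi>. \<integral>\<^sup>+x. ennreal_rpow (ennreal (h (x, \<xi>))) (enn2real p) \<partial>lborel) \<in> borel_measurable borel"
    by measurable
  then have "(\<lambda>\<xi>. ennreal_rpow (\<integral>\<^sup>+x. ennreal_rpow (ennreal (h (x, \<xi>))) (enn2real p) \<partial>lborel) (1 / enn2real p)) \<in> borel_measurable borel"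
    by measurable
  moreover have "(\<lambda>x. ennreal_rpow (ennreal (h (x, \<xi>))) (enn2real p)) \<in> borel_measurable lborel" for \<xi>
    by measurable
  ultimately show ?thesis using False by (simp add: Lp_norm_def nn_integral_completion)
qed

lemma growth_in_A_space:
  fixes F :: "complex^'d::finite \<Rightarrow> complex"
  assumes "1 \<le> p" "1 \<le> q" and F: "entire F"
    and C: "0 \<le> C" "\<And>z. norm (F z) \<le> C * jap z ^ m * exp ((norm z)\<^sup>2 / 2)"
  shows "\<exists>\<omega>\<in>poly_weights. F \<in> A_space p q \<omega>"
proof -
  let ?n = "DIM(real^'d)"
  \<comment> \<open>The exponent m cancels the growth of F; of the remaining 2 * ?n, one ?n becomes
    decay in x and the other decay in \<xi>.\<close>
  define \<omega> where "\<omega> = (\<lambda>X::(real^'d) \<times> (real^'d). inverse (jap X ^ (m + 2 * ?n)))"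
  define h where "h = (\<lambda>X. norm (F (tau X)) * exp (- (norm (tau X))\<^sup>2 / 2) * \<omega> X)"
  have h_eq: "norm (dilation_S (\<lambda>z. F z * of_real (exp (- (norm z)\<^sup>2 / 2))) X * of_real (\<omega> X)) = h X" for X
  proof -
    have "0 \<le> \<omega> X" by (simp add: \<omega>_def jap_nonneg)
    then show ?thesis by (simp add: dilation_S_eq h_def norm_mult)
  qed
  have h_cont: "continuous_on UNIV h"
    unfolding h_def \<omega>_def
    by (intro continuous_intros continuous_on_compose2[OF entire_continuous_on[OF F, of UNIV]]) (auto simp: jap_nz)
  have h_nonneg: "0 \<le> h X" for X by (simp add: h_def \<omega>_def jap_nonneg)
  have h_le: "h (x, \<xi>) \<le> C * inverse (jap \<xi> ^ ?n) * inverse (jap x ^ ?n)" for x \<xi>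
  proof -
    let ?X = "(x, \<xi>)"
    have "norm x \<le> norm ?X" "norm \<xi> \<le> norm ?X"
      using norm_fst_le[of x \<xi>] norm_snd_le[of \<xi> x] by simp_all
    then have j: "jap x ^ ?n \<le> jap ?X ^ ?n" "jap \<xi> ^ ?n \<le> jap ?X ^ ?n"
      by (auto intro!: power_mono jap_mono simp: jap_nonneg)
    have "jap (tau ?X) \<le> jap ?X" by (simp add: jap_def norm_tau_squared)
    then have jt: "jap (tau ?X) ^ m \<le> jap ?X ^ m" by (intro power_mono) (auto simp: jap_nonneg)
    have "norm (F (tau ?X)) * exp (- (norm (tau ?X))\<^sup>2 / 2) \<le> C * jap (tau ?X) ^ m * exp ((norm (tau ?X))\<^sup>2 / 2) * exp (- (norm (tau ?X))\<^sup>2 / 2)"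
      by (intro mult_right_mono C) simp
    also have "\<dots> = C * jap (tau ?X) ^ m" by (simp add: exp_minus field_simps)
    also have "\<dots> \<le> C * jap ?X ^ m" by (intro mult_left_mono jt C)
    finally have "h ?X \<le> C * jap ?X ^ m * \<omega> ?X"
      unfolding h_def by (intro mult_right_mono) (auto simp: \<omega>_def jap_nonneg)
    also have "\<dots> = C * (inverse (jap ?X ^ ?n) * inverse (jap ?X ^ ?n))"
    proof -
      have "jap ?X ^ (m + 2 * ?n) = jap ?X ^ m * (jap ?X ^ ?n * jap ?X ^ ?n)"
        by (simp only: power_add mult_2)
      then show ?thesis by (simp add: \<omega>_def jap_nz inverse_mult_distrib mult.assoc del: DIM_cart)
    qed
    also have "\<dots> \<le> C * (inverse (jap \<xi> ^ ?n) * inverse (jap x ^ ?n))"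
      by (intro mult_left_mono mult_mono le_imp_inverse_le j C) (auto simp: jap_pos jap_nonneg)
    finally show ?thesis by (simp only: mult.assoc)
  qed
  obtain B where B: "0 \<le> B" "\<And>C f. 0 \<le> C \<Longrightarrow> f \<in> borel_measurable lebesgue \<Longrightarrow>
     (\<And>x::real^'d. f x \<le> ennreal (C * inverse (jap x ^ ?n))) \<Longrightarrow> Lp_norm p lebesgue f \<le> ennreal (C * B)"
    using Lp_norm_inverse_jap_bound[OF assms(1), of ?n, where 'a="real^'d"] by auto
  obtain B' where B': "0 \<le> B'" "\<And>C f. 0 \<le> C \<Longrightarrow> f \<in> borel_measurable lebesgue \<Longrightarrow>
     (\<And>x::real^'d. f x \<le> ennreal (C * inverse (jap x ^ ?n))) \<Longrightarrow> Lp_norm q lebesgue f \<le> ennreal (C * B')"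
    using Lp_norm_inverse_jap_bound[OF assms(2), of ?n, where 'a="real^'d"] by auto
  have "Lp_norm p lebesgue (\<lambda>x. ennreal (h (x, \<xi>))) \<le> ennreal (C * inverse (jap \<xi> ^ ?n) * B)" for \<xi>
  proof (rule B(2))
    show "0 \<le> C * inverse (jap \<xi> ^ ?n)" using C(1) by (simp add: jap_nonneg)
    have "continuous_on UNIV (\<lambda>x. h (x, \<xi>))"
      by (auto intro!: continuous_on_compose2[OF h_cont] continuous_intros)
    then show "(\<lambda>x. ennreal (h (x, \<xi>))) \<in> borel_measurable lebesgue"
      using borel_measurable_continuous_onI[of "\<lambda>x. h (x, \<xi>)"] by (auto intro!: measurable_completion)
    show "ennreal (h (x, \<xi>)) \<le> ennreal (C * inverse (jap \<xi> ^ ?n) * inverse (jap x ^ ?n))" for x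
      by (rule ennreal_leI[OF h_le])
  qed
  then have "Lp_norm q lebesgue (\<lambda>\<xi>. Lp_norm p lebesgue (\<lambda>x. ennreal (h (x, \<xi>)))) \<le> ennreal ((C * B) * B')"
    using C(1) B(1) borel_measurable_inner_Lp_norm[OF h_cont h_nonneg]
    by (intro B'(2)) (auto intro: measurable_completion simp: mult_ac)
  then have "mixed_norm p q (\<lambda>X. dilation_S (\<lambda>z. F z * of_real (exp (- (norm z)\<^sup>2 / 2))) X * of_real (\<omega> X)) < \<infinity>"
    unfolding mixed_norm_def h_eq by (rule le_less_trans) simp
  then have "F \<in> A_space p q \<omega>" using F by (simp add: A_space_def)
  moreover have "\<omega> \<in> poly_weights" unfolding \<omega>_def by (rule inverse_jap_power_poly_weight)
  ultimately show ?thesis by blast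
qed

text \<open>A substitute for Hoelder's inequality: by homogeneity one may take the norm to be 1,
  and then \<open>j \<le> 1 + j\<^sup>p\<close>.\<close>

lemma set_nn_integral_le_Lp_norm:
  fixes J N :: "'a::euclidean_space \<Rightarrow> ennreal"
  assumes p: "1 \<le> p" and J[measurable]: "J \<in> borel_measurable borel" and le: "\<And>x. J x \<le> N x"
    and S[measurable]: "S \<in> sets borel"
  shows "(\<integral>\<^sup>+x\<in>S. J x \<partial>lborel) \<le> (emeasure lborel S + 1) * Lp_norm p lebesgue N"
proof -
  have eq: "(\<integral>\<^sup>+x\<in>S. J x \<partial>lborel) = (\<integral>\<^sup>+x. J x * indicator S x \<partial>lebesgue)"
    by (subst nn_integral_completion) auto
  show ?thesis
  proof (cases "p = top")
    case True
    let ?L = "esssup lebesgue N"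
    have "AE x in lebesgue. J x * indicator S x \<le> ?L * indicator S x"
      using esssup_AE[of N lebesgue]
    proof eventually_elim
      case (elim x)
      then have "J x \<le> ?L" using le[of x] by (rule order_trans[rotated])
      then show ?case by (simp add: indicator_def)
    qed
    then have "(\<integral>\<^sup>+x. J x * indicator S x \<partial>lebesgue) \<le> (\<integral>\<^sup>+x. ?L * indicator S x \<partial>lebesgue)"
      by (rule nn_integral_mono_AE)
    also have "\<dots> = ?L * emeasure lebesgue S" by (simp add: nn_integral_cmult_indicator)
    also have "\<dots> \<le> (emeasure lborel S + 1) * ?L" by (subst mult.commute) (intro mult_right_mono, auto)
    finally show ?thesis using True by (simp add: eq Lp_norm_def)
  next
    case False
    define r where "r = enn2real p"
    have r: "1 \<le> r" unfolding r_def using p False by (rule enn2real_ge_1)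
    define L where "L = Lp_norm p lebesgue N"
    have L: "L = ennreal_rpow (\<integral>\<^sup>+x. ennreal_rpow (N x) r \<partial>lebesgue) (1 / r)"
      using False by (simp add: L_def Lp_norm_def r_def)
    have IJ: "(\<integral>\<^sup>+x. ennreal_rpow (J x) r \<partial>lebesgue) \<le> (\<integral>\<^sup>+x. ennreal_rpow (N x) r \<partial>lebesgue)"
      using le r by (intro nn_integral_mono ennreal_rpow_mono) auto
    have [measurable]: "J \<in> borel_measurable lebesgue" "S \<in> sets lebesgue"
      by (auto intro: measurable_completion)
    show ?thesis
    proof (cases "L = top")
      case True
      then show ?thesis unfolding L_def[symmetric] by (simp add: ennreal_mult_top)
    next
      case False
      then obtain I where I: "0 \<le> I" "(\<integral>\<^sup>+x. ennreal_rpow (N x) r \<partial>lebesgue) = ennreal I"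
        unfolding L by (cases "\<integral>\<^sup>+x. ennreal_rpow (N x) r \<partial>lebesgue") (auto simp: ennreal_rpow_def)
      define l where "l = I powr (1 / r)"
      have Ll: "L = ennreal l" and lr: "l powr r = I" "0 \<le> l"
        using I r by (auto simp: L l_def powr_powr)
      show ?thesis
      proof (cases "l = 0")
        case True
        then have "I = 0" using lr r by simp
        then have "(\<integral>\<^sup>+x. ennreal_rpow (J x) r \<partial>lebesgue) = 0" using IJ I by simp
        then have "AE x in lebesgue. ennreal_rpow (J x) r = 0"
          by (subst (asm) nn_integral_0_iff_AE) auto
        then have "AE x in lebesgue. J x * indicator S x = 0"
        proof eventually_elim
          case (elim x)
          then show ?case
            by (cases "J x") (auto simp: ennreal_rpow_def powr_eq_0_iff split: if_splits)
        qed
        then have "(\<integral>\<^sup>+x. J x * indicator S x \<partial>lebesgue) = 0" by (subst nn_integral_0_iff_AE) auto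
        then show ?thesis by (simp add: eq)
      next
        case l: False
        then have "0 < l" using lr by simp
        \<comment> \<open>With l the norm of N and I = l^r: if j > l, then j / l \<le> (j / l)^r =
          j^r / I. The two terms integrate to at most l times the measure of S and to l, whence the
          factor \<open>emeasure lborel S + 1\<close>.\<close>
        have pt: "J x * indicator S x \<le> ennreal l * indicator S x + ennreal (l / I) * ennreal_rpow (J x) r" for x
        proof (cases "J x" )
          case (real j)
          have "j \<le> l + l / I * j powr r"
          proof (cases "j \<le> l")
            case True
            then show ?thesis using \<open>0 < l\<close> I(1) by (smt (verit) divide_nonneg_nonneg mult_nonneg_nonneg powr_ge_zero)
          next
            case False
            then have "j / l \<le> (j / l) powr r"
              using powr_mono[of 1 r "j / l"] \<open>0 < l\<close> r by simp
            also have "\<dots> = j powr r / I" using real \<open>0 < l\<close> by (simp add: powr_divide lr)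
            finally have "j \<le> l / I * j powr r" using \<open>0 < l\<close> by (simp add: field_simps)
            then show ?thesis using \<open>0 < l\<close> by linarith
          qed
          then have "ennreal j \<le> ennreal (l + l / I * j powr r)" by (rule ennreal_leI)
          also have "\<dots> = ennreal l + ennreal (l / I) * ennreal (j powr r)"
          proof -
            have "ennreal (l / I * j powr r) = ennreal (l / I) * ennreal (j powr r)"
              using \<open>0 < l\<close> I(1) by (intro ennreal_mult') simp
            moreover have "0 \<le> l / I * j powr r" using \<open>0 < l\<close> I(1) by simp
            ultimately show ?thesis using ennreal_plus[OF less_imp_le[OF \<open>0 < l\<close>], of "l / I * j powr r"] by simp
          qed
          finally show ?thesis using real by (simp add: indicator_def)
        next
          case top
          have "0 < I" using lr \<open>0 < l\<close> by (metis powr_gt_zero less_irrefl)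
          then have "ennreal (l / I) \<noteq> 0" using \<open>0 < l\<close> by simp
          then show ?thesis using top by (simp add: ennreal_rpow_def ennreal_mult_top)
        qed
        have "(\<integral>\<^sup>+x. J x * indicator S x \<partial>lebesgue) \<le>
          (\<integral>\<^sup>+x. ennreal l * indicator S x + ennreal (l / I) * ennreal_rpow (J x) r \<partial>lebesgue)"
          by (intro nn_integral_mono pt)
        also have "\<dots> = ennreal l * emeasure lebesgue S + ennreal (l / I) * (\<integral>\<^sup>+x. ennreal_rpow (J x) r \<partial>lebesgue)"
          by (subst nn_integral_add) (auto simp: nn_integral_cmult nn_integral_cmult_indicator)
        also have "\<dots> \<le> ennreal l * emeasure lborel S + ennreal (l / I) * ennreal I"
          using IJ I by (intro add_mono mult_left_mono) auto
        also have "ennreal (l / I) * ennreal I = ennreal l"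
          using \<open>0 < l\<close> lr I by (subst ennreal_mult'[symmetric]) (auto simp: powr_gt_zero)
        finally show ?thesis
          unfolding eq L_def[symmetric] Ll by (simp add: distrib_left mult.commute add.commute)
      qed
    qed
  qed
qed

section \<open>Pointwise bounds from mixed norms\<close>

definition vcnj :: "complex^'d::finite \<Rightarrow> complex^'d" where
  "vcnj z = (\<chi> j. cnj (z $ j))"

lemma vcnj_nth [simp]: "vcnj z $ j = cnj (z $ j)"
  by (simp add: vcnj_def)

lemma norm_add_squared: "(norm (u + w :: complex^'d::finite))\<^sup>2 = (norm u)\<^sup>2 + (norm w)\<^sup>2 + 2 * Re (cdot u (vcnj w))"
proof -
  have "(norm ((u + w) $ j))\<^sup>2 = (norm (u $ j))\<^sup>2 + (norm (w $ j))\<^sup>2 + 2 * Re (u $ j * vcnj w $ j)" for j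
    unfolding cmod_power2 by (simp add: power2_eq_square algebra_simps)
  then show ?thesis
    unfolding norm_vec_squared cdot_def by (simp add: sum.distrib sum_distrib_left)
qed

lemma cdot_smult_left: "cdot (c *s u) w = c * cdot u w"
  by (simp add: cdot_def sum_distrib_left mult.assoc)

lemma cdot_zero_left [simp]: "cdot 0 w = 0"
  by (simp add: cdot_def)

text \<open>Up to the constant \<open>exp (\<bar>w\<bar>\<^sup>2 / 2)\<close>, this is the isometric action of translations on the Fock space.\<close>

definition fock_shift :: "(complex^'d::finite \<Rightarrow> complex) \<Rightarrow> complex^'d \<Rightarrow> complex^'d \<Rightarrow> complex" where
  "fock_shift F w u = F (u + w) * exp (- cdot u (vcnj w))"

text \<open>By polarization the real part of the exponent completes \<bar>u + w\<bar>^2, so the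
  value controlled by the norm of the space appears. Of the other factors, exp (\<bar>u\<bar>^2 / 2)
  is bounded on balls and exp (\<bar>w\<bar>^2 / 2) is the growth to be proved.\<close>

lemma norm_fock_shift:
  "norm (fock_shift F w u) = norm (F (u + w)) * exp (- (norm (u + w))\<^sup>2 / 2) * exp ((norm u)\<^sup>2 / 2) * exp ((norm w)\<^sup>2 / 2)"
proof -
  have "- Re (cdot u (vcnj w)) = - (norm (u + w))\<^sup>2 / 2 + (norm u)\<^sup>2 / 2 + (norm w)\<^sup>2 / 2"
    by (simp add: norm_add_squared field_simps)
  then show ?thesis
    unfolding fock_shift_def norm_mult norm_exp_eq_Re by (simp only: uminus_complex.sel exp_add mult.assoc)
qed

lemma continuous_on_fock_shift:
  assumes "entire F"
  shows "continuous_on S (fock_shift F w)"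
proof -
  have "continuous_on S (\<lambda>u. F (u + w))"
    by (rule continuous_on_compose2[OF entire_continuous_on[OF assms, of UNIV]]) (auto intro!: continuous_intros)
  then show ?thesis
    unfolding fock_shift_def cdot_def by (intro continuous_intros)
qed

text \<open>Used with two invariant densities: the indicator of the unit ball for pointwise bounds,
  the Gaussian for the reproducing formula.\<close>

lemma fock_shift_mean_value:
  fixes F :: "complex^'d::finite \<Rightarrow> complex" and \<rho> :: "(real^'d) \<times> (real^'d) \<Rightarrow> real"
  assumes F: "entire F" and \<rho>: "\<And>t X. \<rho> (rot t X) = \<rho> X" "integrable lborel \<rho>"
    and int: "integrable lborel (\<lambda>X. fock_shift F w (tau X) * \<rho> X)"
  shows "(\<integral>X. fock_shift F w (tau X) * \<rho> X \<partial>lborel) = F w * (\<integral>X. \<rho> X \<partial>lborel)"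
proof -
  have "(\<lambda>\<zeta>. fock_shift F w (\<zeta> *s v)) holomorphic_on UNIV" for v
    unfolding fock_shift_def cdot_smult_left
    by (intro holomorphic_intros entire_holomorphic_on_line F)
  from rotation_mean_value[OF continuous_on_fock_shift[OF F] this \<rho> int]
  show ?thesis by (simp add: fock_shift_def)
qed

text \<open>\<open>h\<close> will contain the weight, whose slices need not be measurable, so
  Tonelli is applied only to the continuous minorant \<open>g\<close>. M is independent of the
  centre because all unit balls have the same volume.\<close>

lemma A_space_local_integral_bound:
  fixes g \<Phi> :: "(real^'d::finite) \<times> (real^'d) \<Rightarrow> real"
  assumes p: "1 \<le> p" and q: "1 \<le> q"
    and g: "continuous_on UNIV g" and le: "\<And>X. g X \<le> h X"
    and fin: "Lp_norm q lebesgue (\<lambda>\<xi>. Lp_norm p lebesgue (\<lambda>x. ennreal (h (x, \<xi>)))) < \<infinity>"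
  shows "\<exists>M\<ge>0. \<forall>X0. (\<integral>\<^sup>+X\<in>cball X0 1. ennreal (g X) \<partial>lborel) \<le> ennreal M"
proof -
  define L where "L = Lp_norm q lebesgue (\<lambda>\<xi>. Lp_norm p lebesgue (\<lambda>x. ennreal (h (x, \<xi>))))"
  define k where "k = ennreal (unit_ball_vol (real DIM(real^'d)) + 1)"
  have k: "emeasure lborel (cball x 1) + 1 = k" "k \<noteq> 0" "k \<noteq> top" for x :: "real^'d"
    by (auto simp: k_def emeasure_cball ennreal_plus unit_ball_vol_nonneg ennreal_eq_0_iff add_nonneg_pos not_le)
  have [measurable]: "g \<in> borel_measurable (borel \<Otimes>\<^sub>M borel)"
    unfolding borel_prod by (rule borel_measurable_continuous_onI[OF g])
  have main: "(\<integral>\<^sup>+X\<in>cball X0 1. ennreal (g X) \<partial>lborel) \<le> k * (k * L)" for X0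
  proof -
    obtain x0 \<xi>0 where X0: "X0 = (x0, \<xi>0)" by (cases X0)
    define J where "J = (\<lambda>\<xi>. \<integral>\<^sup>+x\<in>cball x0 1. ennreal (g (x, \<xi>)) \<partial>lborel)"
    have [measurable]: "cball x0 1 \<in> sets borel" "cball \<xi>0 1 \<in> sets borel" by simp_all
    have [measurable]: "J \<in> borel_measurable borel" unfolding J_def by measurable
    have J: "J \<xi> \<le> k * Lp_norm p lebesgue (\<lambda>x. ennreal (h (x, \<xi>)))" for \<xi>
      unfolding J_def k(1)[of x0, symmetric]
      by (rule set_nn_integral_le_Lp_norm[OF p]) (auto intro: ennreal_leI le)
    \<comment> \<open>The inner bound carries a factor k; dividing by it gives the pointwise
      domination required to repeat the argument with the exponent q.\<close>
    have "(\<integral>\<^sup>+\<xi>\<in>cball \<xi>0 1. J \<xi> / k \<partial>lborel) \<le> k * L"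
      unfolding k(1)[of \<xi>0, symmetric] L_def
    proof (rule set_nn_integral_le_Lp_norm[OF q])
      show "J \<xi> / (emeasure lborel (cball \<xi>0 1) + 1) \<le> Lp_norm p lebesgue (\<lambda>x. ennreal (h (x, \<xi>)))" for \<xi>
        unfolding k(1) using J[of \<xi>] k(2) by (intro divide_le_posI_ennreal) (auto simp: mult.commute zero_less_iff_neq_zero)
    qed measurable
    then have 1: "k * (\<integral>\<^sup>+\<xi>\<in>cball \<xi>0 1. J \<xi> / k \<partial>lborel) \<le> k * (k * L)" by (rule mult_left_mono) simp
    have Jk: "k * (J \<xi> / k) = J \<xi>" for \<xi>
      using k(2,3) by (simp add: ennreal_times_divide mult.commute[of k] mult_divide_eq_ennreal)
    have "(\<integral>\<^sup>+X\<in>cball X0 1. ennreal (g X) \<partial>lborel)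
       \<le> (\<integral>\<^sup>+X. ennreal (g X) * indicator (cball x0 1) (fst X) * indicator (cball \<xi>0 1) (snd X) \<partial>lborel)"
    proof (intro nn_integral_mono)
      fix X :: "(real^'d) \<times> (real^'d)"
      have "dist x0 (fst X) \<le> dist X0 X" "dist \<xi>0 (snd X) \<le> dist X0 X"
        unfolding X0 using dist_fst_le[of "(x0, \<xi>0)" X] dist_snd_le[of "(x0, \<xi>0)" X] by auto
      then show "ennreal (g X) * indicator (cball X0 1) X \<le> ennreal (g X) * indicator (cball x0 1) (fst X) * indicator (cball \<xi>0 1) (snd X)"
        by (auto simp: indicator_def)
    qed
    also have "\<dots> = (\<integral>\<^sup>+X. ennreal (g X) * indicator (cball x0 1) (fst X) * indicator (cball \<xi>0 1) (snd X) \<partial>(lborel \<Otimes>\<^sub>M lborel))"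
      by (simp add: lborel_prod)
    also have "\<dots> = (\<integral>\<^sup>+\<xi>. (\<integral>\<^sup>+x. ennreal (g (x, \<xi>)) * indicator (cball x0 1) x * indicator (cball \<xi>0 1) \<xi> \<partial>lborel) \<partial>lborel)"
      by (subst lborel_pair.nn_integral_snd[symmetric]) auto
    also have "\<dots> = (\<integral>\<^sup>+\<xi>\<in>cball \<xi>0 1. J \<xi> \<partial>lborel)"
      unfolding J_def by (subst nn_integral_multc) auto
    also have "\<dots> = (\<integral>\<^sup>+\<xi>. k * ((J \<xi> / k) * indicator (cball \<xi>0 1) \<xi>) \<partial>lborel)"
      by (simp only: mult.assoc[symmetric] Jk)
    also have "\<dots> = k * (\<integral>\<^sup>+\<xi>\<in>cball \<xi>0 1. J \<xi> / k \<partial>lborel)"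
      by (rule nn_integral_cmult) measurable
    finally show ?thesis using 1 by (rule order_trans)
  qed
  have "k * (k * L) \<noteq> top" using fin k by (auto simp: L_def ennreal_mult_eq_top_iff)
  then have "ennreal (enn2real (k * (k * L))) = k * (k * L)" by (simp add: less_top)
  then show ?thesis using main by (metis enn2real_nonneg)
qed

text \<open>F w is the mean of its Fock shift over the unit ball, which is controlled by the local
  integral of the Gaussian-weighted F around a preimage of w; inserting the weight there costs a
  power of \<open>jap w\<close>.\<close>

lemma A_space_growth:
  fixes F :: "complex^'d::finite \<Rightarrow> complex"
  assumes p: "1 \<le> p" and q: "1 \<le> q" and \<omega>: "\<omega> \<in> poly_weights" and "F \<in> A_space p q \<omega>"
  shows "\<exists>C m. 0 \<le> C \<and> (\<forall>z. norm (F z) \<le> C * jap z ^ m * exp ((norm z)\<^sup>2 / 2))"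
proof -
  have F: "entire F" using assms by (simp add: A_space_def)
  obtain c m where c: "0 < c" "\<And>X. c * inverse (jap X ^ m) \<le> \<omega> X"
    using poly_weight_lower_bound[OF \<omega>] by blast
  have \<omega>_pos: "0 < \<omega> X" for X using \<omega> unfolding poly_weights_def by blast
  define \<Phi> where "\<Phi> = (\<lambda>X. norm (F (tau X)) * exp (- (norm (tau X))\<^sup>2 / 2))"
  have \<Phi>_nonneg: "0 \<le> \<Phi> X" for X by (simp add: \<Phi>_def)
  have \<Phi>_cont: "continuous_on UNIV \<Phi>"
    unfolding \<Phi>_def
    by (intro continuous_intros continuous_on_compose2[OF entire_continuous_on[OF F, of UNIV]]) auto
  have \<Phi>m[measurable]: "\<Phi> \<in> borel_measurable borel" by (rule borel_measurable_continuous_onI[OF \<Phi>_cont])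
  have h_eq: "norm (dilation_S (\<lambda>z. F z * of_real (exp (- (norm z)\<^sup>2 / 2))) X * of_real (\<omega> X)) = \<Phi> X * \<omega> X" for X
    using \<omega>_pos[of X] by (simp add: dilation_S_eq \<Phi>_def norm_mult)
  have "mixed_norm p q (\<lambda>X. dilation_S (\<lambda>z. F z * of_real (exp (- (norm z)\<^sup>2 / 2))) X * of_real (\<omega> X)) < \<infinity>"
    using assms(4) by (simp add: A_space_def)
  then have fin: "Lp_norm q lebesgue (\<lambda>\<xi>. Lp_norm p lebesgue (\<lambda>x. ennreal (\<Phi> (x, \<xi>) * \<omega> (x, \<xi>)))) < \<infinity>"
    unfolding mixed_norm_def h_eq .
  obtain M where M: "0 \<le> M"
    "\<And>X0. (\<integral>\<^sup>+X\<in>cball X0 1. ennreal (\<Phi> X * (c * inverse (jap X ^ m))) \<partial>lborel) \<le> ennreal M"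
  proof -
    have "continuous_on UNIV (\<lambda>X. \<Phi> X * (c * inverse (jap X ^ m)))"
      by (intro continuous_intros \<Phi>_cont) (auto simp: jap_nz)
    moreover have "\<Phi> X * (c * inverse (jap X ^ m)) \<le> \<Phi> X * \<omega> X" for X
      by (intro mult_left_mono c \<Phi>_nonneg)
    ultimately show ?thesis
      using A_space_local_integral_bound[OF p q, of "\<lambda>X. \<Phi> X * (c * inverse (jap X ^ m))" "\<lambda>X. \<Phi> X * \<omega> X"] fin that
      by auto
  qed
  define V where "V = measure lborel (cball (0 :: (real^'d) \<times> (real^'d)) 1)"
  have V: "0 < V" unfolding V_def by (simp add: content_cball unit_ball_vol_pos)
  have "norm (F w) \<le> (exp 1 * (M * 8 ^ m / c) / V) * jap w ^ m * exp ((norm w)\<^sup>2 / 2)" for w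
  proof -
    obtain X0 where X0: "tau X0 = w" using surj_tau by (metis surjD)
    have [measurable]: "cball X0 1 \<in> sets borel" by simp
    \<comment> \<open>On the unit ball around X0, \<open>jap_add\<close> gives jap X \<le> 4 * jap
      X0, so the minorant c * inverse (jap X ^ m) of the weight is at least 1 / K there.\<close>
    define K where "K = (4 * jap X0) ^ m / c"
    have "0 \<le> K" using c by (simp add: K_def jap_nonneg)
    have \<Phi>_le: "\<Phi> X \<le> K * (\<Phi> X * (c * inverse (jap X ^ m)))" if X: "X \<in> cball X0 1" for X
    proof -
      have "jap X = jap (X0 + (X - X0))" by simp
      also have "\<dots> \<le> 2 * jap X0 * jap (X - X0)" by (rule jap_add)
      also have "\<dots> \<le> 2 * jap X0 * 2"
        using X by (intro mult_left_mono) (auto simp: jap_def dist_norm norm_minus_commute power_le_one jap_nonneg)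
      finally have "jap X ^ m \<le> (4 * jap X0) ^ m" by (intro power_mono) (auto simp: jap_nonneg)
      then have "1 \<le> (4 * jap X0) ^ m * inverse (jap X ^ m)" by (simp add: field_simps jap_pos)
      then have "\<Phi> X * 1 \<le> \<Phi> X * ((4 * jap X0) ^ m * inverse (jap X ^ m))"
        by (rule mult_left_mono) (rule \<Phi>_nonneg)
      then show ?thesis using c by (simp add: K_def mult_ac)
    qed
    have "(\<integral>\<^sup>+X\<in>cball X0 1. ennreal (\<Phi> X) \<partial>lborel) \<le> (\<integral>\<^sup>+X. ennreal K * (ennreal (\<Phi> X * (c * inverse (jap X ^ m))) * indicator (cball X0 1) X) \<partial>lborel)"
    proof (intro nn_integral_mono)
      fix X
      show "ennreal (\<Phi> X) * indicator (cball X0 1) X \<le> ennreal K * (ennreal (\<Phi> X * (c * inverse (jap X ^ m))) * indicator (cball X0 1) X)"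
        using \<Phi>_le[of X] \<open>0 \<le> K\<close> by (auto simp: indicator_def ennreal_mult'[symmetric] intro!: ennreal_leI)
    qed
    also have "\<dots> = ennreal K * (\<integral>\<^sup>+X\<in>cball X0 1. ennreal (\<Phi> X * (c * inverse (jap X ^ m))) \<partial>lborel)"
      by (rule nn_integral_cmult) measurable
    also have "\<dots> \<le> ennreal K * ennreal M" by (intro mult_left_mono M) simp
    finally have \<Phi>_int: "(\<integral>\<^sup>+X\<in>cball X0 1. ennreal (\<Phi> X) \<partial>lborel) \<le> ennreal (K * M)"
      using \<open>0 \<le> K\<close> by (simp add: ennreal_mult')
    let ?\<rho> = "\<lambda>X :: (real^'d) \<times> (real^'d). indicator (cball 0 1) X :: real"
    let ?G = "\<lambda>X. fock_shift F w (tau X) * ?\<rho> X"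
    have "integrable lborel (\<lambda>X. indicator (cball 0 1) X *\<^sub>R fock_shift F w (tau X))"
      by (intro borel_integrable_compact compact_cball continuous_on_compose2[OF continuous_on_fock_shift[OF F, of UNIV]]
         continuous_intros) auto
    then have intG: "integrable lborel ?G" by (simp add: scaleR_conv_of_real mult.commute)
    have "(\<integral>X. ?G X \<partial>lborel) = F w * (\<integral>X. ?\<rho> X \<partial>lborel)"
    proof (rule fock_shift_mean_value[OF F _ _ intG])
      show "?\<rho> (rot t X) = ?\<rho> X" for t X by (simp add: indicator_def)
      show "integrable lborel ?\<rho>"
        using emeasure_bounded_finite[of "cball (0 :: (real^'d) \<times> (real^'d)) 1"]
        by (simp add: integrable_indicator_iff)
    qed
    then have "norm (F w) * V = norm (\<integral>X. ?G X \<partial>lborel)"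
      using V by (simp add: V_def norm_mult)
    then have "ennreal (norm (F w) * V) \<le> (\<integral>\<^sup>+X. norm (?G X) \<partial>lborel)"
      using integral_norm_bound_ennreal[OF intG] by simp
    also have "\<dots> \<le> (\<integral>\<^sup>+X. ennreal (exp 1 * exp ((norm w)\<^sup>2 / 2)) * (ennreal (\<Phi> (X0 + 1 *\<^sub>R X)) * indicator (cball X0 1) (X0 + 1 *\<^sub>R X)) \<partial>lborel)"
    proof (intro nn_integral_mono)
      fix X :: "(real^'d) \<times> (real^'d)"
      show "ennreal (norm (?G X)) \<le> ennreal (exp 1 * exp ((norm w)\<^sup>2 / 2)) * (ennreal (\<Phi> (X0 + 1 *\<^sub>R X)) * indicator (cball X0 1) (X0 + 1 *\<^sub>R X))"
      proof (cases "X \<in> cball 0 1")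
        case True
        then have "norm X \<le> 1" by simp
        then have "(norm (tau X))\<^sup>2 / 2 \<le> 1"
          unfolding norm_tau_squared using power_le_one[of "norm X" 2] by simp
        then have e: "exp ((norm (tau X))\<^sup>2 / 2) \<le> exp 1" by simp
        have "norm (?G X) = \<Phi> (X0 + X) * exp ((norm (tau X))\<^sup>2 / 2) * exp ((norm w)\<^sup>2 / 2)"
          using True by (simp add: norm_mult norm_fock_shift \<Phi>_def tau_add X0 add.commute)
        also have "\<dots> \<le> \<Phi> (X0 + X) * exp 1 * exp ((norm w)\<^sup>2 / 2)"
          by (intro mult_right_mono mult_left_mono e \<Phi>_nonneg) simp
        finally have "norm (?G X) \<le> exp 1 * exp ((norm w)\<^sup>2 / 2) * \<Phi> (X0 + X)" by (simp only: mult_ac)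
        from ennreal_leI[OF this] True show ?thesis by (simp add: dist_norm ennreal_mult' \<Phi>_nonneg)
      qed simp
    qed
    also have "\<dots> = ennreal (exp 1 * exp ((norm w)\<^sup>2 / 2)) * (\<integral>\<^sup>+X. ennreal (\<Phi> (X0 + 1 *\<^sub>R X)) * indicator (cball X0 1) (X0 + 1 *\<^sub>R X) \<partial>lborel)"
      by (rule nn_integral_cmult) measurable
    also have "(\<integral>\<^sup>+X. ennreal (\<Phi> (X0 + 1 *\<^sub>R X)) * indicator (cball X0 1) (X0 + 1 *\<^sub>R X) \<partial>lborel) = (\<integral>\<^sup>+X\<in>cball X0 1. ennreal (\<Phi> X) \<partial>lborel)"
      by (rule nn_integral_lborel_affine[of "\<lambda>X. ennreal (\<Phi> X) * indicator (cball X0 1) X" 1 X0]) auto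
    also have "ennreal (exp 1 * exp ((norm w)\<^sup>2 / 2)) * \<dots> \<le> ennreal (exp 1 * exp ((norm w)\<^sup>2 / 2)) * ennreal (K * M)"
      by (intro mult_left_mono \<Phi>_int) simp
    also have "\<dots> = ennreal (exp 1 * exp ((norm w)\<^sup>2 / 2) * (K * M))" by (simp add: ennreal_mult')
    finally have 1: "norm (F w) * V \<le> exp 1 * exp ((norm w)\<^sup>2 / 2) * (K * M)"
      using \<open>0 \<le> K\<close> M(1) by (subst (asm) ennreal_le_iff) auto
    \<comment> \<open>Return from X0 to w: squared norms double, so jap X0 \<le> 2 * jap w and the
      constant 4 becomes 8.\<close>
    have "(norm X0)\<^sup>2 = 2 * (norm w)\<^sup>2" using norm_tau_squared[of X0] X0 by simp
    then have "jap X0 \<le> 2 * jap w" by (simp add: jap_def)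
    then have "(4 * jap X0) ^ m \<le> (8 * jap w) ^ m" by (intro power_mono) (auto simp: jap_nonneg)
    then have "K \<le> (8 * jap w) ^ m / c" unfolding K_def using c by (intro divide_right_mono) auto
    then have "exp 1 * exp ((norm w)\<^sup>2 / 2) * (K * M) \<le> exp 1 * exp ((norm w)\<^sup>2 / 2) * ((8 * jap w) ^ m / c * M)"
      by (intro mult_left_mono mult_right_mono M) auto
    with 1 have "norm (F w) \<le> (exp 1 * exp ((norm w)\<^sup>2 / 2) * ((8 * jap w) ^ m / c * M)) / V"
      using V by (simp only: pos_le_divide_eq)
    then show ?thesis by (simp add: power_mult_distrib mult_ac)
  qed
  moreover have "0 \<le> exp 1 * (M * 8 ^ m / c) / V" using M c V by simp
  ultimately show ?thesis by blast
qed

section \<open>Inversion of the Bargmann transform\<close>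

lemma integral_prod_vec:
  fixes f :: "'d::finite \<Rightarrow> real \<Rightarrow> complex"
  assumes f: "\<And>j. integrable lborel (f j)"
  shows "(\<integral>x. (\<Prod>j\<in>UNIV. f j (x $ j)) \<partial>(lborel :: (real^'d) measure)) = (\<Prod>j\<in>UNIV. \<integral>t. f j t \<partial>lborel)"
proof -
  define a where "a = (\<lambda>j::'d. axis j (1::real))"
  have inj: "inj a" by (simp add: a_def inj_on_def axis_eq_axis)
  have B: "Basis = range a" by (auto simp: a_def Basis_vec_def)
  have reindex: "(\<Prod>b\<in>Basis. h b) = (\<Prod>j\<in>UNIV. h (a j))" for h :: "real^'d \<Rightarrow> complex"
    unfolding B by (subst prod.reindex[OF inj]) simp
  have eq: "(\<Prod>b\<in>Basis. f (inv a b) (x \<bullet> b)) = (\<Prod>j\<in>UNIV. f j (x $ j))" for x :: "real^'d"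
    unfolding reindex by (simp add: inv_f_f[OF inj]) (simp add: a_def inner_axis)
  show "(\<integral>x. (\<Prod>j\<in>UNIV. f j (x $ j)) \<partial>(lborel :: (real^'d) measure)) = (\<Prod>j\<in>UNIV. \<integral>t. f j t \<partial>lborel)"
    using integral_prod_Basis[of "\<lambda>b::real^'d. f (inv a b)"] f
    by (simp add: eq reindex inv_f_f[OF inj])
qed

section \<open>Gaussian integrals\<close>

lemma integrable_gaussian: "integrable lborel (\<lambda>x::'a::euclidean_space. exp (- (norm x)\<^sup>2 / 2))"
proof -
  obtain C where C: "\<And>x::'a. exp (- (norm x)\<^sup>2 / 2) \<le> C * inverse (jap x ^ DIM('a))"
    using exp_minus_le_inverse_jap[of 2 "DIM('a)"] by auto
  show ?thesis
  proof (rule integrable_bounded_by_jap[OF _ order_refl])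
    show "norm (exp (- (norm x)\<^sup>2 / 2)) \<le> C * inverse (jap x ^ DIM('a))" for x :: 'a
      using C[of x] by simp
  qed measurable
qed

text \<open>Translating by Re u makes the linear term purely imaginary up to a constant factor; what
  remains is the characteristic function of the normal distribution at Im u. No contour has to be
  moved.\<close>

lemma
  fixes u :: complex
  shows integrable_gaussian_real: "integrable lborel (\<lambda>t::real. exp (- (of_real t)\<^sup>2 / 2 + u * of_real t))"
    and integral_gaussian_real: "(\<integral>t. exp (- (of_real (t::real))\<^sup>2 / 2 + u * of_real t) \<partial>lborel) = of_real (sqrt (2 * pi)) * exp (u\<^sup>2 / 2)"
proof -
  define a b where "a = Re u" and "b = Im u"
  let ?f = "\<lambda>t::real. exp (- (of_real t)\<^sup>2 / 2 + u * of_real t)"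
  let ?g = "\<lambda>r::real. complex_of_real (exp (- r\<^sup>2 / 2)) * iexp (b * r)"
  let ?c = "exp (of_real a ^ 2 / 2 + \<i> * of_real (a * b))"
  have u: "u = of_real a + \<i> * of_real b" by (simp add: a_def b_def complex_eq_iff)
  have shift: "?f (a + r) = ?c * ?g r" for r
  proof -
    have "- (of_real (a + r))\<^sup>2 / 2 + u * of_real (a + r) =
      (of_real a ^ 2 / 2 + \<i> * of_real (a * b)) + (of_real (- r\<^sup>2 / 2) + \<i> * of_real (b * r))"
      unfolding u by (simp add: power2_eq_square field_simps)
    then show ?thesis by (simp only: exp_add exp_of_real)
  qed
  have int: "integrable lborel ?g"
    by (rule Bochner_Integration.integrable_bound[OF integrable_gaussian[where 'a=real]]) (auto simp: norm_mult)
  have m: "?f \<in> borel_measurable borel" by measurable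
  show "integrable lborel ?f"
    using int by (subst integrable_translate[OF m, of a, symmetric]) (simp only: shift, simp)
  have "(\<integral>r. std_normal_density r *\<^sub>R iexp (b * r) \<partial>lborel) = of_real (exp (- b\<^sup>2 / 2))"
    using fun_cong[OF char_std_normal_distribution, of b]
    by (simp add: char_def integral_density normal_density_nonneg)
  then have "(\<integral>r. (1 / complex_of_real (sqrt (2 * pi))) * ?g r \<partial>lborel) = of_real (exp (- b\<^sup>2 / 2))"
    by (simp add: std_normal_density_def scaleR_conv_of_real)
  then have "(1 / complex_of_real (sqrt (2 * pi))) * (\<integral>r. ?g r \<partial>lborel) = of_real (exp (- b\<^sup>2 / 2))"
    by (subst (asm) integral_mult_right_zero)
  then have g: "(\<integral>r. ?g r \<partial>lborel) = of_real (sqrt (2 * pi)) * of_real (exp (- b\<^sup>2 / 2))"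
    by (simp add: field_simps)
  have "(\<integral>t. ?f t \<partial>lborel) = (\<integral>r. ?f (a + r) \<partial>lborel)"
    by (rule integral_translate[OF m, symmetric])
  also have "\<dots> = ?c * (of_real (sqrt (2 * pi)) * of_real (exp (- b\<^sup>2 / 2)))"
    unfolding shift integral_mult_right_zero g ..
  also have "\<dots> = of_real (sqrt (2 * pi)) * (?c * exp (of_real (- b\<^sup>2 / 2)))"
    by (simp only: exp_of_real mult_ac)
  also have "?c * exp (of_real (- b\<^sup>2 / 2)) = exp (u\<^sup>2 / 2)"
  proof -
    have "of_real a ^ 2 / 2 + \<i> * of_real (a * b) + of_real (- b\<^sup>2 / 2) = u\<^sup>2 / 2"
      unfolding u by (simp add: complex_eq_iff power2_eq_square)
    then show ?thesis by (simp only: exp_add[symmetric])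
  qed
  finally show "(\<integral>t. ?f t \<partial>lborel) = of_real (sqrt (2 * pi)) * exp (u\<^sup>2 / 2)" .
qed

text \<open>The previous integral scaled by sqrt 2: a product of two kernels has the exponent - t^2
  instead of - t^2 / 2.\<close>

lemma
  fixes u :: complex
  shows integrable_gaussian_sqrt2: "integrable lborel (\<lambda>t::real. exp (- (of_real t)\<^sup>2 + of_real (sqrt 2) * u * of_real t))"
    and integral_gaussian_sqrt2: "(\<integral>t. exp (- (of_real (t::real))\<^sup>2 + of_real (sqrt 2) * u * of_real t) \<partial>lborel) = of_real (sqrt pi) * exp (u\<^sup>2 / 2)"
proof -
  let ?f = "\<lambda>t::real. exp (- (of_real t)\<^sup>2 / 2 + u * of_real t)"
  have eq: "?f (0 + sqrt 2 * t) = exp (- (of_real t)\<^sup>2 + of_real (sqrt 2) * u * of_real t)" for t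
    by (simp add: power_mult_distrib mult_ac flip: of_real_power)
  show "integrable lborel (\<lambda>t::real. exp (- (of_real t)\<^sup>2 + of_real (sqrt 2) * u * of_real t))"
    using lborel_integrable_real_affine[OF integrable_gaussian_real[of u], of "sqrt 2" 0] unfolding eq by simp
  have "of_real (sqrt (2 * pi)) * exp (u\<^sup>2 / 2) = of_real (sqrt 2) * (\<integral>t. exp (- (of_real (t::real))\<^sup>2 + of_real (sqrt 2) * u * of_real t) \<partial>lborel)"
    using lborel_integral_real_affine[of "sqrt 2" ?f 0] unfolding eq integral_gaussian_real
    by (simp add: scaleR_conv_of_real)
  then show "(\<integral>t. exp (- (of_real (t::real))\<^sup>2 + of_real (sqrt 2) * u * of_real t) \<partial>lborel) = of_real (sqrt pi) * exp (u\<^sup>2 / 2)"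
    by (simp add: real_sqrt_mult)
qed

lemma integral_gaussian:
  "(\<integral>x. exp (- (norm (x::'a::euclidean_space))\<^sup>2 / 2) \<partial>lborel) = sqrt (2 * pi) ^ DIM('a)"
proof -
  have "complex_of_real (exp (- (norm x)\<^sup>2 / 2)) = (\<Prod>b\<in>Basis. exp (- (of_real (x \<bullet> b))\<^sup>2 / 2 + 0 * of_real (x \<bullet> b)))" for x :: 'a
  proof -
    have "- (norm x)\<^sup>2 / 2 = (\<Sum>b\<in>Basis. - (x \<bullet> b)\<^sup>2 / 2)"
      using jap_conv_Basis[of x] by (simp add: jap_def sum_divide_distrib sum_negf)
    then show ?thesis by (simp add: exp_sum flip: exp_of_real)
  qed
  then have "(\<integral>x. complex_of_real (exp (- (norm (x::'a))\<^sup>2 / 2)) \<partial>lborel) = (\<Prod>b\<in>(Basis::'a set). of_real (sqrt (2 * pi)) * exp (0\<^sup>2 / 2))"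
    using integral_prod_Basis[of "\<lambda>(_::'a) t. exp (- (of_real t)\<^sup>2 / 2 + 0 * of_real t)"]
      integrable_gaussian_real[of 0] unfolding integral_gaussian_real by simp
  then have "complex_of_real (\<integral>x. exp (- (norm (x::'a))\<^sup>2 / 2) \<partial>lborel) = complex_of_real (sqrt (2 * pi) ^ DIM('a))"
    by simp
  then show ?thesis by (simp only: of_real_eq_iff)
qed

section \<open>The Bargmann transform of Schwartz functions\<close>

definition schwartz_sup :: "(real^'d::finite \<Rightarrow> complex) \<Rightarrow> real" where
  "schwartz_sup = schwartz_seminorm (\<lambda>_. 0) []"

lemma norm_le_schwartz_sup: "\<phi> \<in> schwartz_space \<Longrightarrow> norm (\<phi> y) \<le> schwartz_sup \<phi>"
  using schwartz_seminorm_upper[of \<phi> "\<lambda>_. 0" y "[]"] by (simp add: schwartz_sup_def monomial_def)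

lemma schwartz_sup_nonneg: "\<phi> \<in> schwartz_space \<Longrightarrow> 0 \<le> schwartz_sup \<phi>"
  by (simp add: schwartz_sup_def schwartz_seminorm_nonneg)

lemma schwartz_borel_measurable: "\<phi> \<in> schwartz_space \<Longrightarrow> \<phi> \<in> borel_measurable borel"
  using smooth_continuous_on[OF schwartz_smooth, of \<phi> UNIV "[]"] by (intro borel_measurable_continuous_onI) simp

lemma kfun_borel_measurable: "kfun P z \<in> borel_measurable borel"
  using smooth_continuous_on[OF smooth_kfun, of UNIV "[]" P z] by (intro borel_measurable_continuous_onI) simp

lemma kfun_inverse_jap_bound: "\<exists>C. 0 \<le> C \<and> (\<forall>y. norm (kfun P z y) \<le> C * inverse (jap y ^ n))"
proof -
  obtain C m where "0 \<le> C" "\<And>z y. jap y ^ n * norm (kfun P z y) \<le> C * jap z ^ m * exp ((norm z)\<^sup>2 / 2)"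
    using kfun_bound[of n P] by blast
  then have "norm (kfun P z y) \<le> (C * jap z ^ m * exp ((norm z)\<^sup>2 / 2)) * inverse (jap y ^ n)"
    "0 \<le> C * jap z ^ m * exp ((norm z)\<^sup>2 / 2)" for y
    by (simp_all add: field_simps jap_pos jap_nonneg)
  then show ?thesis by blast
qed

lemma integrable_kfun_mult:
  assumes "\<phi> \<in> schwartz_space"
  shows "integrable lborel (\<lambda>y. kfun P z y * \<phi> y)"
proof -
  obtain C where C: "0 \<le> C" "\<And>y. norm (kfun P z y) \<le> C * inverse (jap y ^ DIM(real^'a))"
    using kfun_inverse_jap_bound by blast
  show ?thesis
  proof (rule integrable_bounded_by_jap[OF _ order_refl])
    show "(\<lambda>y. kfun P z y * \<phi> y) \<in> borel_measurable borel"
      by (intro borel_measurable_times kfun_borel_measurable schwartz_borel_measurable assms)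
    show "norm (kfun P z y * \<phi> y) \<le> (C * schwartz_sup \<phi>) * inverse (jap y ^ DIM(real^'a))" for y
      unfolding norm_mult using mult_mono[OF C(2)[of y] norm_le_schwartz_sup[OF assms, of y]] C(1)
      by (simp add: jap_nonneg mult_ac)
  qed
qed

text \<open>The transform of test functions, whereas \<open>bargmann\<close> acts on functionals;
  the two meet through the transpose in \<open>inverse_bargmann\<close>.\<close>

definition bargmann_function :: "(real^'d::finite \<Rightarrow> complex) \<Rightarrow> complex^'d \<Rightarrow> complex" where
  "bargmann_function \<phi> z = (\<integral>y. bargmann_kernel z y * \<phi> y \<partial>lborel)"

lemma integrable_kernel_mult:
  "\<phi> \<in> schwartz_space \<Longrightarrow> integrable lborel (\<lambda>y. bargmann_kernel z y * \<phi> y)"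
  using integrable_kfun_mult[of \<phi> "KConst 1" z] by (simp add: kfun_1)

lemma bargmann_function_add:
  "\<phi> \<in> schwartz_space \<Longrightarrow> \<psi> \<in> schwartz_space \<Longrightarrow>
    bargmann_function (\<lambda>y. \<phi> y + \<psi> y) z = bargmann_function \<phi> z + bargmann_function \<psi> z"
  unfolding bargmann_function_def distrib_left
  by (intro Bochner_Integration.integral_add integrable_kernel_mult)

lemma bargmann_function_cmult: "bargmann_function (\<lambda>y. c * \<phi> y) z = c * bargmann_function \<phi> z"
proof -
  have "(\<lambda>y. bargmann_kernel z y * (c * \<phi> y)) = (\<lambda>y. c * (bargmann_kernel z y * \<phi> y))"
    by (simp add: mult_ac)
  then show ?thesis unfolding bargmann_function_def by simp
qed

lemma bargmann_function_borel_measurable: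
  assumes "\<phi> \<in> schwartz_space"
  shows "bargmann_function \<phi> \<in> borel_measurable borel"
proof -
  have [measurable]: "(\<lambda>p. bargmann_kernel (fst p) (snd p)) \<in> borel_measurable (borel \<Otimes>\<^sub>M borel)"
    unfolding borel_prod kfun_1[symmetric] by (rule borel_measurable_continuous_onI[OF continuous_on_kfun])
  have [measurable]: "\<phi> \<in> borel_measurable borel" by (rule schwartz_borel_measurable[OF assms])
  have "(\<lambda>z. \<integral>y. bargmann_kernel z y * \<phi> y \<partial>lborel) \<in> borel_measurable borel"
    by (rule sigma_finite_measure.borel_measurable_lebesgue_integral[OF sigma_finite_lborel])
      (simp add: case_prod_beta)
  then show ?thesis by (simp add: bargmann_function_def[abs_def])
qed

text \<open>The L1 norm of the kernel in y is a constant times exp (\<bar>z\<bar>^2 / 2), since z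
  merely translates its Gaussian.\<close>

lemma bargmann_function_bound:
  "\<exists>C\<ge>0. \<forall>\<phi>\<in>schwartz_space. \<forall>z::complex^'d::finite. norm (bargmann_function \<phi> z) \<le> C * schwartz_sup \<phi> * exp ((norm z)\<^sup>2 / 2)"
proof -
  define c where "c = pi powr (- real CARD('d) / 4)"
  have "0 \<le> c" by (simp add: c_def)
  define I where "I = (\<integral>y. exp (- (norm (y :: real^'d))\<^sup>2 / 2) \<partial>lborel)"
  have "norm (bargmann_function \<phi> z) \<le> (c * I) * schwartz_sup \<phi> * exp ((norm z)\<^sup>2 / 2)"
    if \<phi>: "\<phi> \<in> schwartz_space" for \<phi> and z :: "complex^'d"
  proof -
    define a :: "real^'d" where "a = - (sqrt 2 *\<^sub>R (\<chi> j. Re (z $ j)))"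
    have m: "(\<lambda>y::real^'d. exp (- (norm y)\<^sup>2 / 2)) \<in> borel_measurable borel" by measurable
    have k: "norm (bargmann_kernel z y) = c * exp ((norm z)\<^sup>2 / 2) * exp (- (norm (a + y))\<^sup>2 / 2)" for y
      unfolding norm_bargmann_kernel c_def a_def by (simp add: norm_minus_commute)
    let ?h = "\<lambda>y. (c * exp ((norm z)\<^sup>2 / 2) * schwartz_sup \<phi>) * exp (- (norm (a + y))\<^sup>2 / 2)"
    have "norm (bargmann_function \<phi> z) \<le> (\<integral>y. norm (bargmann_kernel z y * \<phi> y) \<partial>lborel)"
      unfolding bargmann_function_def by (rule integral_norm_bound)
    also have "\<dots> \<le> (\<integral>y. ?h y \<partial>lborel)"
    proof (rule integral_mono)
      show "integrable lborel (\<lambda>y. norm (bargmann_kernel z y * \<phi> y))"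
        by (intro integrable_norm integrable_kernel_mult \<phi>)
      show "integrable lborel ?h"
        using integrable_translate[OF m, of a] integrable_gaussian[where 'a="real^'d"] by simp
      show "norm (bargmann_kernel z y * \<phi> y) \<le> ?h y" for y
        unfolding norm_mult k using mult_left_mono[OF norm_le_schwartz_sup[OF \<phi>, of y], of "c * exp ((norm z)\<^sup>2 / 2) * exp (- (norm (a + y))\<^sup>2 / 2)"] \<open>0 \<le> c\<close>
        by (simp add: mult_ac)
    qed
    also have "\<dots> = (c * exp ((norm z)\<^sup>2 / 2) * schwartz_sup \<phi>) * I"
      using integral_translate[OF m, of a] by (simp add: I_def)
    finally show ?thesis by (simp add: mult_ac)
  qed
  moreover have "0 \<le> c * I" using \<open>0 \<le> c\<close> unfolding I_def by (simp add: integral_nonneg)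
  ultimately show ?thesis by blast
qed

text \<open>Integration by parts: the derivative of the kernel in \<open>y $ j\<close> is
  \<open>sqrt 2 * z $ j - y $ j\<close> times the kernel.\<close>

lemma bargmann_function_raising:
  fixes \<phi> :: "real^'d::finite \<Rightarrow> complex"
  assumes \<phi>: "\<phi> \<in> schwartz_space"
  shows "bargmann_function (raising j \<phi>) z = of_real (sqrt 2) * z $ j * bargmann_function \<phi> z"
proof -
  let ?n = "DIM(real^'d)"
  let ?g = "\<lambda>y. bargmann_kernel z y * \<phi> y"
  let ?g' = "\<lambda>y. kfun (twisted_y j (KConst 1)) z y * \<phi> y + bargmann_kernel z y * partial_deriv j \<phi> y"
  have tw: "kfun (twisted_y j (KConst 1)) z y = (of_real (sqrt 2) * z $ j - of_real (y $ j)) * bargmann_kernel z y" for y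
    by (simp add: kfun_def twisted_y_def)
  \<comment> \<open>The term y $ j of the kernel derivative joins the derivative of \<phi> to form
    \<open>raising\<close>, so the vanishing of the integral of ?g' is the claimed identity.\<close>
  have g'_eq: "?g' y = of_real (sqrt 2) * z $ j * ?g y - bargmann_kernel z y * raising j \<phi> y" for y
    unfolding tw raising_def by (simp add: algebra_simps)
  obtain C where C: "0 \<le> C" "\<And>y. norm (kfun (twisted_y j (KConst 1)) z y) \<le> C * inverse (jap y ^ ?n)"
    using kfun_inverse_jap_bound by blast
  obtain D where D: "0 \<le> D" "\<And>y. norm (bargmann_kernel z y) \<le> D * inverse (jap y ^ ?n)"
    using kfun_inverse_jap_bound[of "KConst 1" z ?n] unfolding kfun_1 by blast
  let ?S = "schwartz_seminorm (\<lambda>_. 0) [j] \<phi>"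
  have S: "norm (partial_deriv j \<phi> y) \<le> ?S" for y
    using schwartz_seminorm_upper[OF \<phi>, of "\<lambda>_. 0" y "[j]"] by (simp add: monomial_def)
  have "(\<integral>y. ?g' y \<partial>lborel) = 0"
  proof (rule integral_directional_derivative_eq_0[where b = "axis j 1" and n = ?n and C = "C * schwartz_sup \<phi> + D * ?S"])
    fix y :: "real^'d"
    have l: "((\<lambda>t. y + t *\<^sub>R axis j 1) has_derivative (\<lambda>s. s *\<^sub>R axis j 1)) (at 0)"
      by (auto intro!: derivative_eq_intros)
    have d\<phi>: "(\<phi> has_derivative frechet_derivative \<phi> (at y)) (at y)"
      using smooth_has_derivative[OF schwartz_smooth[OF \<phi>], of "[]" y] by simp
    have dk: "(bargmann_kernel z has_derivative (\<lambda>h. \<Sum>i\<in>UNIV. of_real (h $ i) * kfun (twisted_y i (KConst 1)) z y)) (at y)"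
      using kfun_has_derivative_y[of "KConst 1" z y] by (simp add: kfun_1)
    have e: "(\<Sum>i\<in>UNIV. of_real ((s *\<^sub>R axis j 1) $ i) * kfun (twisted_y i (KConst 1)) z y) = s *\<^sub>R kfun (twisted_y j (KConst 1)) z y" for s
      by (simp add: axis_def if_distrib[of "\<lambda>x. x * _"] if_distrib[of "\<lambda>x. _ * x"] if_distrib[of of_real] cong: if_cong)
        (simp add: scaleR_conv_of_real)
    have lin: "frechet_derivative \<phi> (at y) (s *\<^sub>R axis j 1) = s *\<^sub>R partial_deriv j \<phi> y" for s
      using linear_scale[OF has_derivative_linear[OF d\<phi>]] by (simp add: partial_deriv_def)
    have "(?g has_derivative (\<lambda>h. bargmann_kernel z y * frechet_derivative \<phi> (at y) h +
        (\<Sum>i\<in>UNIV. of_real (h $ i) * kfun (twisted_y i (KConst 1)) z y) * \<phi> y)) (at (y + 0 *\<^sub>R axis j 1))"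
      using has_derivative_mult[OF dk d\<phi>] by simp
    from has_derivative_compose[OF l this]
    have "((\<lambda>t. ?g (y + t *\<^sub>R axis j 1)) has_derivative (\<lambda>s. bargmann_kernel z y * frechet_derivative \<phi> (at y) (s *\<^sub>R axis j 1) +
        (\<Sum>i\<in>UNIV. of_real ((s *\<^sub>R axis j 1) $ i) * kfun (twisted_y i (KConst 1)) z y) * \<phi> y)) (at 0)" .
    then show "((\<lambda>t. ?g (y + t *\<^sub>R axis j 1)) has_vector_derivative ?g' y) (at 0)"
      unfolding has_vector_derivative_def e lin by (simp add: scaleR_add_right add.commute)
  next
    show "integrable lborel ?g" by (rule integrable_kernel_mult[OF \<phi>])
    have "partial_deriv j \<phi> \<in> borel_measurable borel"
      using smooth_continuous_on[OF schwartz_smooth[OF \<phi>], of UNIV "[j]"]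
      by (intro borel_measurable_continuous_onI) simp
    then show "?g' \<in> borel_measurable borel"
      using kfun_borel_measurable[of "KConst 1" z]
      by (intro borel_measurable_add borel_measurable_times kfun_borel_measurable schwartz_borel_measurable[OF \<phi>])
        (simp_all add: kfun_1)
    show "norm (?g' y) \<le> (C * schwartz_sup \<phi> + D * ?S) * inverse (jap y ^ ?n)" for y
    proof -
      have "norm (?g' y) \<le> (C * inverse (jap y ^ ?n)) * schwartz_sup \<phi> + (D * inverse (jap y ^ ?n)) * ?S"
        unfolding norm_mult[symmetric]
        by (rule order_trans[OF norm_triangle_ineq], unfold norm_mult,
            intro add_mono mult_mono C D S norm_le_schwartz_sup \<phi>) (auto simp: C D jap_nonneg)
      then show ?thesis by (simp add: algebra_simps)
    qed
  qed simp
  moreover have "(\<integral>y. ?g' y \<partial>lborel) = of_real (sqrt 2) * z $ j * bargmann_function \<phi> z - bargmann_function (raising j \<phi>) z"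
    unfolding g'_eq bargmann_function_def
    by (subst Bochner_Integration.integral_diff)
      (simp_all add: integrable_kernel_mult \<phi> schwartz_raising(1))
  ultimately show ?thesis by simp
qed

lemma bargmann_function_raising_power:
  "\<phi> \<in> schwartz_space \<Longrightarrow>
    bargmann_function ((raising j ^^ m) \<phi>) z = (of_real (sqrt 2) * z $ j) ^ m * bargmann_function \<phi> z"
  by (induction m) (simp_all add: bargmann_function_raising schwartz_raising_power mult_ac)

text \<open>Raising operators yield powers of single coordinates only. The largest coordinate
  controls \<open>jap z\<close>, and the maximum with 1 in M covers the case in which it is
  small.\<close>

lemma jap_power_le_sum:
  fixes z :: "complex^'d::finite"
  shows "jap z ^ m \<le> (1 + real CARD('d)) ^ m * (1 + (\<Sum>j\<in>UNIV. norm (z $ j) ^ (2 * m)))"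
proof -
  have "Max (range (\<lambda>i. norm (z $ i))) \<in> range (\<lambda>i. norm (z $ i))" by (rule Max_in) auto
  then obtain j where "Max (range (\<lambda>i. norm (z $ i))) = norm (z $ j)" by blast
  then have j: "norm (z $ i) \<le> norm (z $ j)" for i
    using Max_ge[of "range (\<lambda>i. norm (z $ i))" "norm (z $ i)"] by simp
  define M where "M = max 1 ((norm (z $ j))\<^sup>2)"
  have "(norm z)\<^sup>2 \<le> (\<Sum>i\<in>(UNIV::'d set). M)"
    unfolding norm_vec_squared by (intro sum_mono) (auto simp: M_def le_max_iff_disj j power_mono)
  then have "jap z \<le> (1 + real CARD('d)) * M"
    by (simp add: jap_def algebra_simps) (simp add: M_def add_increasing2)
  then have "jap z ^ m \<le> ((1 + real CARD('d)) * M) ^ m" by (intro power_mono) (auto simp: jap_nonneg)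
  also have "\<dots> = (1 + real CARD('d)) ^ m * M ^ m" by (rule power_mult_distrib)
  also have "M ^ m \<le> 1 + norm (z $ j) ^ (2 * m)"
    by (auto simp: M_def max_def power_mult)
  also have "norm (z $ j) ^ (2 * m) \<le> (\<Sum>j\<in>UNIV. norm (z $ j) ^ (2 * m))"
    by (rule member_le_sum[of j UNIV "\<lambda>j. norm (z $ j) ^ (2 * m)"]) auto
  finally show ?thesis by simp
qed

text \<open>Each factor z $ j is paid for by one raising operator, hence 2 * m of them for the
  quadratic \<open>jap\<close>; the factors sqrt 2 only help. That Q is
  \<open>schwartz_bounded\<close> later makes the inverse transform continuous.\<close>

lemma bargmann_function_decay:
  "\<exists>Q. schwartz_bounded Q \<and> (\<forall>\<phi>\<in>schwartz_space. 0 \<le> Q \<phi> \<and>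
     (\<forall>z::complex^'d::finite. jap z ^ m * norm (bargmann_function \<phi> z) \<le> Q \<phi> * exp ((norm z)\<^sup>2 / 2)))"
proof -
  obtain C where C: "0 \<le> C" "\<And>\<phi> z. \<phi> \<in> schwartz_space \<Longrightarrow>
     norm (bargmann_function \<phi> (z::complex^'d)) \<le> C * schwartz_sup \<phi> * exp ((norm z)\<^sup>2 / 2)"
    using bargmann_function_bound by blast
  let ?q = "\<lambda>j \<phi>. schwartz_sup ((raising j ^^ (2 * m)) \<phi>)"
  let ?K = "(1 + real CARD('d)) ^ m"
  define Q where "Q = (\<lambda>\<phi>::real^'d \<Rightarrow> complex. ?K * (C * (schwartz_sup \<phi> + (\<Sum>j\<in>UNIV. ?q j \<phi>))))"
  have "schwartz_bounded Q"
    unfolding Q_def schwartz_sup_def using C(1)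
    by (intro schwartz_bounded_cmult schwartz_bounded_add schwartz_bounded_sum schwartz_bounded_seminorm
        schwartz_bounded_raising_power) auto
  moreover have "0 \<le> Q \<phi>" if "\<phi> \<in> schwartz_space" for \<phi>
    unfolding Q_def using C(1) that
    by (intro mult_nonneg_nonneg add_nonneg_nonneg sum_nonneg schwartz_sup_nonneg schwartz_raising_power) auto
  moreover have "jap z ^ m * norm (bargmann_function \<phi> z) \<le> Q \<phi> * exp ((norm z)\<^sup>2 / 2)"
    if \<phi>: "\<phi> \<in> schwartz_space" for \<phi> and z :: "complex^'d"
  proof -
    let ?E = "exp ((norm z)\<^sup>2 / 2)" and ?b = "norm (bargmann_function \<phi> z)"
    have 1: "norm (z $ j) ^ (2 * m) * ?b \<le> C * ?q j \<phi> * ?E" for j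
    proof -
      have "norm (z $ j) \<le> norm (of_real (sqrt 2) * z $ j)"
        by (simp add: norm_mult mult_le_cancel_right1)
      then have "norm (z $ j) ^ (2 * m) * ?b \<le> norm (of_real (sqrt 2) * z $ j) ^ (2 * m) * ?b"
        by (intro mult_right_mono power_mono) auto
      also have "\<dots> = norm (bargmann_function ((raising j ^^ (2 * m)) \<phi>) z)"
        unfolding bargmann_function_raising_power[OF \<phi>] by (simp add: norm_mult norm_power)
      also have "\<dots> \<le> C * ?q j \<phi> * ?E"
        by (intro C schwartz_raising_power \<phi>)
      finally show ?thesis .
    qed
    have "jap z ^ m * ?b \<le> ?K * (1 + (\<Sum>j\<in>UNIV. norm (z $ j) ^ (2 * m))) * ?b"
      by (intro mult_right_mono jap_power_le_sum) simp
    also have "\<dots> = ?K * (?b + (\<Sum>j\<in>UNIV. norm (z $ j) ^ (2 * m) * ?b))"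
      by (simp add: algebra_simps sum_distrib_right sum_distrib_left)
    also have "\<dots> \<le> ?K * (C * schwartz_sup \<phi> * ?E + (\<Sum>j\<in>UNIV. C * ?q j \<phi> * ?E))"
      by (intro mult_left_mono add_mono sum_mono 1 C \<phi>) auto
    also have "\<dots> = Q \<phi> * ?E"
      unfolding Q_def by (simp add: algebra_simps sum_distrib_right sum_distrib_left)
    finally show ?thesis .
  qed
  ultimately show ?thesis by blast
qed

text \<open>With z replaced by its conjugate, this is the reproducing kernel of the Fock space,
  which is why pairing F with transforms of test functions recovers F.\<close>

lemma bargmann_function_kernel:
  fixes z w :: "complex^'d::finite"
  shows "bargmann_function (bargmann_kernel w) z = exp (cdot z w)"
proof -
  let ?f = "\<lambda>j t. exp (- (1/2) * ((z $ j)\<^sup>2 + (w $ j)\<^sup>2)) * exp (- (complex_of_real t)\<^sup>2 + of_real (sqrt 2) * (z $ j + w $ j) * of_real t)"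
  let ?c = "complex_of_real (pi powr (- real CARD('d) / 4))"
  have "bargmann_kernel z y * bargmann_kernel w y = (?c * ?c) * (\<Prod>j\<in>UNIV. ?f j (y $ j))" for y
  proof -
    let ?e = "\<lambda>z j. - (1/2) * ((z $ j)\<^sup>2 + (complex_of_real (y $ j))\<^sup>2) + of_real (sqrt 2) * z $ j * of_real (y $ j)"
    have e: "?e z j + ?e w j =
       - (1/2) * ((z $ j)\<^sup>2 + (w $ j)\<^sup>2) + (- (complex_of_real (y $ j))\<^sup>2 + of_real (sqrt 2) * (z $ j + w $ j) * of_real (y $ j))" for j
      by (simp add: algebra_simps)
    have "bargmann_kernel z y * bargmann_kernel w y = (?c * ?c) * exp ((\<Sum>j\<in>UNIV. ?e z j) + (\<Sum>j\<in>UNIV. ?e w j))"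
      unfolding bargmann_kernel_eq exp_add by (simp only: mult_ac)
    then show ?thesis
      unfolding sum.distrib[symmetric] e by (simp only: exp_sum[OF finite] exp_add)
  qed
  then have "bargmann_function (bargmann_kernel w) z = (?c * ?c) * (\<integral>y. (\<Prod>j\<in>UNIV. ?f j (y $ j)) \<partial>(lborel :: (real^'d) measure))"
    by (simp add: bargmann_function_def)
  also have "(\<integral>y. (\<Prod>j\<in>UNIV. ?f j (y $ j)) \<partial>(lborel :: (real^'d) measure)) = (\<Prod>j\<in>UNIV. \<integral>t. ?f j t \<partial>lborel)"
    by (rule integral_prod_vec) (intro integrable_mult_right integrable_gaussian_sqrt2)
  also have "\<dots> = (\<Prod>j\<in>UNIV. of_real (sqrt pi) * exp (z $ j * w $ j))"
  proof (rule prod.cong[OF refl])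
    fix j :: 'd
    have "(\<integral>t. ?f j t \<partial>lborel) = exp (- (1/2) * ((z $ j)\<^sup>2 + (w $ j)\<^sup>2)) * (of_real (sqrt pi) * exp ((z $ j + w $ j)\<^sup>2 / 2))"
      by (simp only: integral_mult_right_zero integral_gaussian_sqrt2)
    also have "\<dots> = of_real (sqrt pi) * exp (- (1/2) * ((z $ j)\<^sup>2 + (w $ j)\<^sup>2) + (z $ j + w $ j)\<^sup>2 / 2)"
      by (simp only: exp_add mult_ac)
    also have "- (1/2) * ((z $ j)\<^sup>2 + (w $ j)\<^sup>2) + (z $ j + w $ j)\<^sup>2 / 2 = z $ j * w $ j"
      by (simp add: power2_eq_square field_simps)
    finally show "(\<integral>t. ?f j t \<partial>lborel) = of_real (sqrt pi) * exp (z $ j * w $ j)" .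
  qed
  also have "\<dots> = complex_of_real (sqrt pi ^ CARD('d)) * exp (cdot z w)"
    by (simp add: prod.distrib cdot_def exp_sum)
  finally have "bargmann_function (bargmann_kernel w) z = ?c * ?c * complex_of_real (sqrt pi ^ CARD('d)) * exp (cdot z w)"
    by (simp only: mult.assoc)
  \<comment> \<open>The normalization of the kernel: its square cancels one factor sqrt pi per
    coordinate.\<close>
  moreover have "pi powr (- real CARD('d) / 4) * pi powr (- real CARD('d) / 4) * sqrt pi ^ CARD('d) = 1"
    by (simp add: powr_half_sqrt[symmetric] powr_realpow[symmetric] powr_powr powr_add[symmetric])
  then have "?c * ?c * complex_of_real (sqrt pi ^ CARD('d)) = 1"
    by (metis of_real_1 of_real_mult)
  ultimately show ?thesis by simp
qed

text \<open>The transpose of the Bargmann transform, applied to the measure \<open>exp (- \<bar>z\<bar>\<^sup>2) dz\<close>, in the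
  coordinates \<open>z = tau X\<close>, whose Jacobian turns the normalization \<open>\<pi>\<^sup>- \<^sup>d\<close> into \<open>(2 \<pi>)\<^sup>- \<^sup>d\<close>.\<close>

definition inverse_bargmann :: "(complex^'d::finite \<Rightarrow> complex) \<Rightarrow> (real^'d \<Rightarrow> complex) \<Rightarrow> complex" where
  "inverse_bargmann F \<phi> = of_real (inverse (sqrt (2 * pi) ^ DIM((real^'d) \<times> (real^'d)))) *
     (\<integral>X. F (tau X) * of_real (exp (- (norm (tau X))\<^sup>2)) * bargmann_function \<phi> (vcnj (tau X)) \<partial>lborel)"

lemma norm_vcnj [simp]: "norm (vcnj z) = norm z"
proof -
  have "(norm (vcnj z))\<^sup>2 = (norm z)\<^sup>2" by (simp add: norm_vec_squared)
  then show ?thesis by (simp add: power2_eq_iff_nonneg)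
qed

section \<open>The inverse transform of an entire function of the given growth\<close>

context
  fixes F :: "complex^'d::finite \<Rightarrow> complex" and C :: real and m :: nat
  assumes F: "entire F" and C: "0 \<le> C" "\<And>z. norm (F z) \<le> C * jap z ^ m * exp ((norm z)\<^sup>2 / 2)"
begin

private abbreviation integrand :: "(real^'d \<Rightarrow> complex) \<Rightarrow> (real^'d) \<times> (real^'d) \<Rightarrow> complex" where
  "integrand \<phi> X \<equiv> F (tau X) * of_real (exp (- (norm (tau X))\<^sup>2)) * bargmann_function \<phi> (vcnj (tau X))"

lemma measurable_integrand:
  assumes "\<phi> \<in> schwartz_space"
  shows "integrand \<phi> \<in> borel_measurable borel"
proof -
  have "continuous_on UNIV (\<lambda>X. F (tau X) * of_real (exp (- (norm (tau X))\<^sup>2)))"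
    by (intro continuous_intros continuous_on_compose2[OF entire_continuous_on[OF F, of UNIV]]) auto
  then have 1: "(\<lambda>X. F (tau X) * of_real (exp (- (norm (tau X))\<^sup>2))) \<in> borel_measurable borel"
    by (rule borel_measurable_continuous_onI)
  have "continuous_on UNIV (\<lambda>X. vcnj (tau X) :: complex^'d)"
    unfolding vcnj_def by (intro continuous_intros)
  then have "(\<lambda>X. vcnj (tau X) :: complex^'d) \<in> borel_measurable borel"
    by (rule borel_measurable_continuous_onI)
  from borel_measurable_times[OF 1 measurable_compose[OF this bargmann_function_borel_measurable[OF assms]]]
  show ?thesis .
qed

text \<open>The Gaussian exp (- \<bar>z\<bar>^2) cancels the factors exp (\<bar>z\<bar>^2 / 2) of F
  and of the transform of \<phi>. Decay of order m plus the dimension then leaves an integrable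
  power.\<close>

lemma integrand_bound:
  "\<exists>Q. schwartz_bounded Q \<and> (\<forall>\<phi>\<in>schwartz_space. 0 \<le> Q \<phi> \<and>
     (\<forall>X. norm (integrand \<phi> X) \<le> Q \<phi> * inverse (jap X ^ DIM((real^'d) \<times> (real^'d)))))"
proof -
  let ?n = "DIM((real^'d) \<times> (real^'d))"
  obtain Q where Q: "schwartz_bounded Q" "\<And>\<phi>. \<phi> \<in> schwartz_space \<Longrightarrow> 0 \<le> Q \<phi>"
    "\<And>\<phi> z. \<phi> \<in> schwartz_space \<Longrightarrow> jap (z::complex^'d) ^ (m + ?n) * norm (bargmann_function \<phi> z) \<le> Q \<phi> * exp ((norm z)\<^sup>2 / 2)"
    using bargmann_function_decay[of "m + ?n", where 'd='d] by blast
  \<comment> \<open>The powers of 2 come from jap X \<le> 2 * jap (tau X).\<close>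
  let ?Q = "\<lambda>\<phi>. (C * 2 ^ ?n) * Q \<phi>"
  have "norm (integrand \<phi> X) \<le> ?Q \<phi> * inverse (jap X ^ ?n)" if \<phi>: "\<phi> \<in> schwartz_space" for \<phi> X
  proof -
    let ?z = "tau X" and ?E = "exp ((norm (tau X))\<^sup>2 / 2)"
    have jz: "jap (vcnj ?z) = jap ?z" by (simp add: jap_def)
    have b: "norm (bargmann_function \<phi> (vcnj ?z)) \<le> Q \<phi> * ?E * inverse (jap ?z ^ (m + ?n))"
      using Q(3)[OF \<phi>, of "vcnj ?z"] unfolding jz norm_vcnj by (simp add: field_simps jap_pos)
    have E: "exp (- (norm ?z)\<^sup>2) * (?E * ?E) = 1" by (simp flip: exp_add)
    have "norm (integrand \<phi> X) = norm (F ?z) * exp (- (norm ?z)\<^sup>2) * norm (bargmann_function \<phi> (vcnj ?z))"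
      by (simp add: norm_mult)
    also have "\<dots> \<le> (C * jap ?z ^ m * ?E) * exp (- (norm ?z)\<^sup>2) * (Q \<phi> * ?E * inverse (jap ?z ^ (m + ?n)))"
      by (intro mult_mono b C order_refl) (auto simp: C jap_nonneg)
    also have "\<dots> = C * Q \<phi> * (exp (- (norm ?z)\<^sup>2) * (?E * ?E)) * (jap ?z ^ m * inverse (jap ?z ^ (m + ?n)))"
      by (simp only: mult_ac)
    also have "\<dots> = C * Q \<phi> * inverse (jap ?z ^ ?n)"
      unfolding E power_add using jap_nz[of ?z] by (simp del: DIM_prod DIM_cart)
    also have "\<dots> \<le> C * Q \<phi> * (2 ^ ?n * inverse (jap X ^ ?n))"
    proof (rule mult_left_mono)
      have "jap X \<le> 2 * jap ?z" by (simp add: jap_def norm_tau_squared)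
      then have "jap X ^ ?n \<le> (2 * jap ?z) ^ ?n" by (intro power_mono) (auto simp: jap_nonneg)
      then show "inverse (jap ?z ^ ?n) \<le> 2 ^ ?n * inverse (jap X ^ ?n)"
        by (simp add: field_simps jap_pos power_mult_distrib del: DIM_prod DIM_cart)
    qed (use C Q(2)[OF \<phi>] in simp)
    finally show ?thesis by (simp only: mult_ac)
  qed
  moreover have "schwartz_bounded ?Q" using C(1) by (intro schwartz_bounded_cmult Q(1)) simp
  moreover have "0 \<le> ?Q \<phi>" if "\<phi> \<in> schwartz_space" for \<phi> using C(1) Q(2)[OF that] by simp
  ultimately show ?thesis by blast
qed

lemma integrable_integrand:
  assumes "\<phi> \<in> schwartz_space"
  shows "integrable lborel (integrand \<phi>)"
proof -
  obtain Q where "\<And>X. norm (integrand \<phi> X) \<le> Q * inverse (jap X ^ DIM((real^'d) \<times> (real^'d)))"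
    using integrand_bound assms by blast
  then show ?thesis by (rule integrable_bounded_by_jap[OF measurable_integrand[OF assms] order_refl])
qed

text \<open>Continuity is the integrated form of \<open>integrand_bound\<close>, in which all
  dependence on \<phi> sits in Q.\<close>

lemma inverse_bargmann_tempered: "inverse_bargmann F \<in> tempered_distributions"
  unfolding tempered_distributions_iff
proof (intro conjI ballI allI)
  fix \<phi> \<psi> :: "real^'d \<Rightarrow> complex" assume "\<phi> \<in> schwartz_space" "\<psi> \<in> schwartz_space"
  then show "inverse_bargmann F (\<lambda>x. \<phi> x + \<psi> x) = inverse_bargmann F \<phi> + inverse_bargmann F \<psi>"
    unfolding inverse_bargmann_def
    by (simp add: bargmann_function_add distrib_left Bochner_Integration.integral_add integrable_integrand)
next
  fix c and \<phi> :: "real^'d \<Rightarrow> complex"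
  have "integrand (\<lambda>x. c * \<phi> x) X = c * integrand \<phi> X" for X
    by (simp add: bargmann_function_cmult mult_ac)
  then show "inverse_bargmann F (\<lambda>x. c * \<phi> x) = c * inverse_bargmann F \<phi>"
    unfolding inverse_bargmann_def by (simp only: integral_mult_right_zero mult_ac)
next
  let ?n = "DIM((real^'d) \<times> (real^'d))"
  let ?c = "inverse (sqrt (2 * pi) ^ ?n)" and ?I = "\<integral>X. inverse (jap (X :: (real^'d) \<times> (real^'d)) ^ ?n) \<partial>lborel"
  obtain Q where Q: "schwartz_bounded Q" "\<And>\<phi>. \<phi> \<in> schwartz_space \<Longrightarrow> 0 \<le> Q \<phi>"
    "\<And>\<phi> X. \<phi> \<in> schwartz_space \<Longrightarrow> norm (integrand \<phi> X) \<le> Q \<phi> * inverse (jap X ^ ?n)"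
    using integrand_bound by blast
  have I: "0 \<le> ?I" by (rule Bochner_Integration.integral_nonneg) (simp add: jap_nonneg)
  have "norm (inverse_bargmann F \<phi>) \<le> (?c * ?I) * Q \<phi>" if \<phi>: "\<phi> \<in> schwartz_space" for \<phi>
  proof -
    have "norm (\<integral>X. integrand \<phi> X \<partial>lborel) \<le> (\<integral>X. norm (integrand \<phi> X) \<partial>lborel)"
      by (rule integral_norm_bound)
    also have "\<dots> \<le> (\<integral>X. Q \<phi> * inverse (jap (X :: (real^'d) \<times> (real^'d)) ^ ?n) \<partial>lborel)"
    proof (rule integral_mono)
      show "integrable lborel (\<lambda>X. norm (integrand \<phi> X))"
        by (intro integrable_norm integrable_integrand \<phi>)
      show "integrable lborel (\<lambda>X. Q \<phi> * inverse (jap (X :: (real^'d) \<times> (real^'d)) ^ ?n))"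
        by (intro integrable_mult_right integrable_inverse_jap order_refl)
    qed (rule Q(3)[OF \<phi>])
    also have "\<dots> = Q \<phi> * ?I" by (rule integral_mult_right_zero)
    finally have "?c * norm (\<integral>X. integrand \<phi> X \<partial>lborel) \<le> ?c * (Q \<phi> * ?I)"
      by (rule mult_left_mono) simp
    then show ?thesis
      unfolding inverse_bargmann_def norm_mult norm_of_real by (simp add: mult_ac del: DIM_prod DIM_cart)
  qed
  moreover have "schwartz_bounded (\<lambda>\<phi>. (?c * ?I) * Q \<phi>)"
    using I by (intro schwartz_bounded_cmult Q(1) mult_nonneg_nonneg) auto
  ultimately show "schwartz_bounded (\<lambda>\<phi>. norm (inverse_bargmann F \<phi>))"
    by (rule schwartz_bounded_mono[rotated])
qed

text \<open>The reproducing formula: translating by a preimage of \<open>w\<close> turns the integrand into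
  a Gaussian mean of \<open>fock_shift F w\<close>, whose value at the origin is \<open>F w\<close>.\<close>

lemma bargmann_inverse_bargmann: "bargmann (inverse_bargmann F) = F"
proof
  fix w :: "complex^'d"
  let ?n = "DIM((real^'d) \<times> (real^'d))"
  obtain X0 where X0: "tau X0 = w" using surj_tau by (metis surjD)
  let ?\<rho> = "\<lambda>X :: (real^'d) \<times> (real^'d). exp (- (norm X)\<^sup>2 / 2)"
  have shift: "integrand (bargmann_kernel w) (X0 + X) = fock_shift F w (tau X) * ?\<rho> X" for X
  proof -
    let ?u = "tau X" and ?a = "cdot (tau X) (vcnj w)"
    have t: "tau (X0 + X) = ?u + w" by (simp add: tau_add X0 add.commute)
    have "cdot w (vcnj w) = of_real ((norm w)\<^sup>2)"
      unfolding cdot_def norm_vec_squared of_real_sum complex_norm_square by simp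
    moreover have "cdot (vcnj (?u + w)) w = cnj ?a + cnj (cdot w (vcnj w))"
      by (simp add: cdot_def sum.distrib[symmetric] algebra_simps)
    ultimately have c: "cdot (vcnj (?u + w)) w = cnj ?a + of_real ((norm w)\<^sup>2)" by simp
    \<comment> \<open>Expanding \<bar>u + w\<bar>^2 leaves - 2 * Re ?a + cnj ?a = - ?a: the terms
      \<bar>w\<bar>^2 cancel, and the antiholomorphic term cnj ?a becomes the holomorphic exponent
      of \<open>fock_shift\<close>.\<close>
    have "of_real (- (norm (?u + w))\<^sup>2) + cdot (vcnj (?u + w)) w = - ?a + of_real (- (norm ?u)\<^sup>2)"
      unfolding c norm_add_squared by (simp add: complex_eq_iff)
    then have "exp (of_real (- (norm (?u + w))\<^sup>2)) * exp (cdot (vcnj (?u + w)) w) = exp (- ?a) * exp (of_real (- (norm ?u)\<^sup>2))"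
      by (simp only: exp_add[symmetric])
    then show ?thesis
      unfolding t bargmann_function_kernel fock_shift_def by (simp add: norm_tau_squared mult.assoc flip: exp_of_real)
  qed
  note m = measurable_integrand[OF bargmann_kernel_schwartz[of w]]
  have "integrable lborel (\<lambda>X. integrand (bargmann_kernel w) (X0 + X))"
    unfolding integrable_translate[OF m] by (rule integrable_integrand[OF bargmann_kernel_schwartz])
  then have int: "integrable lborel (\<lambda>X. fock_shift F w (tau X) * ?\<rho> X)" by (simp only: shift)
  have "(\<integral>X. integrand (bargmann_kernel w) X \<partial>lborel) = (\<integral>X. integrand (bargmann_kernel w) (X0 + X) \<partial>lborel)"
    by (rule integral_translate[OF m, symmetric])
  also have "\<dots> = F w * (\<integral>X. ?\<rho> X \<partial>lborel)"
    unfolding shift by (rule fock_shift_mean_value[OF F _ integrable_gaussian int]) simp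
  also have "\<dots> = F w * of_real (sqrt (2 * pi) ^ ?n)"
    unfolding integral_gaussian ..
  finally have "bargmann (inverse_bargmann F) w = of_real (inverse (sqrt (2 * pi) ^ ?n)) * (F w * of_real (sqrt (2 * pi) ^ ?n))"
    by (simp only: bargmann_def inverse_bargmann_def)
  also have "\<dots> = F w * (of_real (inverse (sqrt (2 * pi) ^ ?n) * sqrt (2 * pi) ^ ?n))"
    by (simp only: of_real_mult mult_ac)
  also have "inverse (sqrt (2 * pi) ^ ?n) * sqrt (2 * pi) ^ ?n = 1" by (rule left_inverse) simp
  finally show "bargmann (inverse_bargmann F) w = F w" by simp
qed

end

theorem mainTheorem2:
  fixes p q :: ennreal
  assumes "1 \<le> p" and "1 \<le> q"
  shows "bargmann ` (tempered_distributions :: ((real^'d::finite \<Rightarrow> complex) \<Rightarrow> complex) set)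
       = (\<Union>\<omega> \<in> (poly_weights :: ((real^'d) \<times> (real^'d) \<Rightarrow> real) set). A_space p q \<omega>)"
proof (intro equalityI subsetI)
  fix F :: "complex^'d \<Rightarrow> complex"
  assume "F \<in> bargmann ` tempered_distributions"
  then obtain T where T: "T \<in> tempered_distributions" "F = bargmann T" by blast
  obtain C m where "0 \<le> C" "\<And>z. norm (F z) \<le> C * jap z ^ m * exp ((norm z)\<^sup>2 / 2)"
    using bargmann_growth[OF T(1)] unfolding T(2) by blast
  then show "F \<in> (\<Union>\<omega>\<in>poly_weights. A_space p q \<omega>)"
    using growth_in_A_space[OF assms, of F C m] entire_bargmann[OF T(1)] T(2) by blast
next
  fix F :: "complex^'d \<Rightarrow> complex"
  assume "F \<in> (\<Union>\<omega>\<in>poly_weights. A_space p q \<omega>)"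
  then obtain \<omega> where \<omega>: "\<omega> \<in> poly_weights" "F \<in> A_space p q \<omega>" by blast
  then have F: "entire F" by (simp add: A_space_def)
  obtain C m where "0 \<le> C" "\<And>z. norm (F z) \<le> C * jap z ^ m * exp ((norm z)\<^sup>2 / 2)"
    using A_space_growth[OF assms \<omega>] by blast
  from inverse_bargmann_tempered[OF F this] bargmann_inverse_bargmann[OF F this]
  show "F \<in> bargmann ` tempered_distributions" by (metis imageI)
qed

end
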